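(* Let $u:\mathbb{R}^2\to\mathbb{R}$ be continuous, and let the payoffs $X_1,\dots,X_K$ of the $K$ arms have finite means $\mu_k$ and finite variances $\sigma_k^2\ge 0$. Suppose there exist $g\ge 1$ and a constant $c>0$ such that $|u(x,y)|\le c\,(1+\|(x,y)\|^{g-1})$ for all $(x,y)\in\mathbb{R}^2$ ($\|\cdot\|$ the Euclidean norm), and such that $\sup_{1\le k\le K}E_P[|X_k|^g]<\infty$. Let $V_n=\sup_{\theta\in\Theta}U_n(\theta)$. Then: (i) $V:=\lim_{n\to\infty}V_n$ exists. (ii) Consider another set of arms with random payoffs $X_k'$, $1\le k\le K'$, satisfying the same assumptions (finite means and variances, and $\sup_{1\le k\le K'}E_P[|X'_k|^g]<\infty$), with set of mean-variance pairs $\mathcal{A}'=\{(\mu_k',\sigma_k'^2):1\le k\le K'\}$ and corresponding values $V_n'$ and $V'=\lim_{n\to\infty} V_n'$ (for the same $u$). Then $\mathcal{A}'=\mathcal{A}$ implies $V'=V$. Thus one can write $V=V(\mathcal{A})$. (iii) $V(\mathcal{A})=V(\mathcal{A}^{ext})$, where $\mathcal{A}^{ext}$ is the set of extreme points of the convex hull of $\mathcal{A}$.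
   Context: Setting. $(\Omega,\mathcal{F},P)$ is a probability space on which all random variables are defined. There are $K$ arms. Arm $k$ has random payoff $X_k$ with mean $\mu_k=E_P[X_k]$ and variance $\sigma_k^2=Var_P[X_k]$; $\{X_{k,n}:n\ge1\}$ are i.i.d. copies of $X_k$, and payoffs are independent across arms and across stages. The set of mean-variance pairs is $\mathcal{A}=\{(\mu_k,\sigma_k^2):1\le k\le K\}$. A strategy $\theta=(\theta_1,\theta_2,\dots)$ is a sequence of $\{1,\dots,K\}$-valued random variables; the reward at stage $n$ is $Z_n^\theta=X_{k,n}$ on $\{\theta_n=k\}$. Let $\mathcal{H}_0^\theta=\{\emptyset,\Omega\}$ and $\mathcal{H}_{n-1}^\theta=\sigma\{Z_1^\theta,\dots,Z_{n-1}^\theta,\theta_1,\dots,\theta_{n-1}\}$ for $n>1$. $\theta$ is admissible if $\theta_n$ is $\mathcal{H}_{n-1}^\theta$-measurable for all $n\ge1$; $\Theta$ is the set of admissible strategies. For horizon $n$, the expected utility of $\theta$ is $$U_n(\theta)=E_P\Big[u\Big(\tfrac1n\sum_{i=1}^nZ_i^\theta,\ \tfrac1{\sqrt n}\sum_{i=1}^n\big(Z_i^\theta-E_P[Z_i^\theta\mid\mathcal{H}_{i-1}^\theta]\big)\Big)\Big].$$ $V(\mathcal{A}^{ext})$ denotes the limiting value when only the arms whose mean-variance pairs lie in $\mathcal{A}^{ext}$ are available. *)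

theory Defs
  imports "HOL-Probability.Probability"
begin

text \<open>The law of arm \<open>k\<close> is that of \<open>X k\<close>; \<open>Y k n\<close> is the copy of \<open>X k\<close> drawn at stage \<open>n \<ge> 1\<close>.\<close>

locale bandit = prob_space M
  for M :: "'a measure" and K :: nat and X :: "nat \<Rightarrow> 'a \<Rightarrow> real"
    and Y :: "nat \<Rightarrow> nat \<Rightarrow> 'a \<Rightarrow> real" and g :: real +
  assumes arms_nonempty: "K \<ge> 1"
    and payoff_rv: "\<And>k. k \<in> {1..K} \<Longrightarrow> X k \<in> borel_measurable M"
    and finite_mean: "\<And>k. k \<in> {1..K} \<Longrightarrow> integrable M (X k)"
    and finite_variance: "\<And>k. k \<in> {1..K} \<Longrightarrow> integrable M (\<lambda>\<omega>. (X k \<omega>)\<^sup>2)"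
    and finite_moment: "(SUP k\<in>{1..K}. \<integral>\<^sup>+\<omega>. ennreal (\<bar>X k \<omega>\<bar> powr g) \<partial>M) < \<infinity>"
    and copies: "\<And>k n. k \<in> {1..K} \<Longrightarrow> n \<ge> 1 \<Longrightarrow> distr M borel (Y k n) = distr M borel (X k)"
    and indep: "indep_vars (\<lambda>_. borel) (\<lambda>(k, n). Y k n) ({1..K} \<times> {1..})"

definition mv :: "'a measure \<Rightarrow> (nat \<Rightarrow> 'a \<Rightarrow> real) \<Rightarrow> nat \<Rightarrow> real \<times> real" where
  "mv M X k = (prob_space.expectation M (X k), prob_space.variance M (X k))"

definition extreme_points :: "(real \<times> real) set \<Rightarrow> (real \<times> real) set" where
  "extreme_points A = {p. p extreme_point_of (convex hull A)}"

definition reward :: "(nat \<Rightarrow> nat \<Rightarrow> 'a \<Rightarrow> real) \<Rightarrow> (nat \<Rightarrow> 'a \<Rightarrow> nat) \<Rightarrow> nat \<Rightarrow> 'a \<Rightarrow> real" where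
  "reward Y \<theta> n \<omega> = Y (\<theta> n \<omega>) n \<omega>"

text \<open>The \<open>\<sigma>\<close>-algebra generated by the rewards and arm choices of stages \<open>1, \<dots>, m\<close>; it is
  trivial for \<open>m = 0\<close>.  Only its space and measurable sets are meaningful.\<close>

definition history ::
  "'a measure \<Rightarrow> (nat \<Rightarrow> nat \<Rightarrow> 'a \<Rightarrow> real) \<Rightarrow> (nat \<Rightarrow> 'a \<Rightarrow> nat) \<Rightarrow> nat \<Rightarrow> 'a measure" where
  "history M Y \<theta> m = sigma (space M)
     ((\<Union>i\<in>{1..m}. {reward Y \<theta> i -` B \<inter> space M | B. B \<in> sets borel})
      \<union> (\<Union>i\<in>{1..m}. {\<theta> i -` C \<inter> space M | C. C \<in> sets (count_space UNIV)}))"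

text \<open>Admissible strategies that only use arms from \<open>S\<close>.  The value of \<open>\<theta>\<close> at index \<open>0\<close> is never
  used.\<close>

definition admissible ::
  "'a measure \<Rightarrow> nat set \<Rightarrow> (nat \<Rightarrow> nat \<Rightarrow> 'a \<Rightarrow> real) \<Rightarrow> (nat \<Rightarrow> 'a \<Rightarrow> nat) set" where
  "admissible M S Y =
     {\<theta>. \<forall>n\<ge>1. \<theta> n \<in> measurable (history M Y \<theta> (n - 1)) (count_space S)}"

definition expected_utility ::
  "'a measure \<Rightarrow> (nat \<Rightarrow> nat \<Rightarrow> 'a \<Rightarrow> real) \<Rightarrow> (real \<times> real \<Rightarrow> real) \<Rightarrow> nat
    \<Rightarrow> (nat \<Rightarrow> 'a \<Rightarrow> nat) \<Rightarrow> real" where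
  "expected_utility M Y u n \<theta> = prob_space.expectation M (\<lambda>\<omega>.
     u ((1 / real n) * (\<Sum>i=1..n. reward Y \<theta> i \<omega>),
        (1 / sqrt (real n)) * (\<Sum>i=1..n. reward Y \<theta> i \<omega>
            - real_cond_exp M (history M Y \<theta> (i - 1)) (reward Y \<theta> i) \<omega>)))"

text \<open>The supremum is taken in \<open>ereal\<close>, where it is meaningful without a boundedness proof.\<close>

definition bandit_value ::
  "'a measure \<Rightarrow> nat set \<Rightarrow> (nat \<Rightarrow> nat \<Rightarrow> 'a \<Rightarrow> real) \<Rightarrow> (real \<times> real \<Rightarrow> real) \<Rightarrow> nat \<Rightarrow> ereal" where
  "bandit_value M S Y u n = (SUP \<theta>\<in>admissible M S Y. ereal (expected_utility M Y u n \<theta>))"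

end

theory Submission
  imports Defs
begin

text \<open>
  Write the state after \<open>i\<close> of \<open>n\<close> stages as \<open>(a, y)\<close>, where \<open>a\<close> adds up the conditional means
  divided by \<open>n\<close> and \<open>y\<close> the martingale differences divided by \<open>\<surd>n\<close>; the utility is evaluated at
  \<open>(a + y / \<surd>n, y)\<close>. For bounded uniformly continuous \<open>f\<close>, the optimal expectation of
  \<open>f (a, y)\<close> is the \<open>n\<close>-th iterate of the Bellman operator, a maximum over the arms of averages over
  translations. No regularity theory for the limiting Hamilton-Jacobi-Bellman equation is needed:
  a value function dominates every one of these averages of the next value function, and since
  averages over translations commute, this linear inequality survives mollification. The mollified
  value function is a smooth supersolution, for which a Taylor expansion with finite variances
  shows that only the means and variances of the arms matter, up to \<open>o(1/n)\<close> per stage. The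
  generator is affine in the pair of mean and variance, so the supersolution property extends to
  every arm with mean-variance pair in the convex hull. Running \<open>m div n\<close> stages of a system with
  horizon \<open>m\<close> against one stage of a system with horizon \<open>n\<close> gives
  \<open>limsup V'\<^sub>n \<le> liminf V\<^sub>m\<close> whenever the mean-variance pairs of the primed system lie in the convex
  hull of those of the other one; all three claims are instances of this. Unbounded utilities are
  truncated, using a bound on \<open>E (1 + y\<^sup>2) powr q\<close> that is uniform in the strategy.
\<close>

section \<open>Averaging operators on bounded uniformly continuous functions\<close>

text \<open>Smoothing does not commute with the maximum over the arms: applied to the Bellman
  equation it keeps the domination of each single average but loses the equality with the maximizing
  one. Hence only upper barriers survive and every comparison is one-sided; the reverse bound comes
  from exchanging the two systems. Uniformity rests on translation invariance: each stage shifts the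
  state by an amount whose law depends only on the arm, so all value functions at all horizons share
  the bound and the modulus of continuity of the terminal function. For a fixed smoothing width
  \<open>e\<close> the derivatives of their mollifications are then bounded uniformly. The
  parameters are fixed in the order \<open>e\<close>, \<open>n\<close>, \<open>m\<close>; the width
  is never tied to the horizon, so the Taylor remainder needs no rate. The two time scales require
  that the value function hardly moves during a block of \<open>m div n\<close> stages, over which
  the generator is frozen, nor during the \<open>m mod n\<close> stages that fit into no
  block.\<close>

definition avg :: "(real \<times> real) measure \<Rightarrow> (real \<times> real \<Rightarrow> real) \<Rightarrow> real \<times> real \<Rightarrow> real" where
  "avg \<nu> h z = (\<integral>v. h (z + v) \<partial>\<nu>)"

text \<open>The pair \<open>B\<close>, \<open>w\<close> is a parameter and not existentially
  quantified, because error bounds have to be the same for all iterates of the Bellman operator;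
  averages and maxima of averages keep the pair.\<close>

definition bduc :: "real \<Rightarrow> (real \<Rightarrow> real) \<Rightarrow> (real \<times> real \<Rightarrow> real) \<Rightarrow> bool" where
  "bduc B w h \<longleftrightarrow> (\<forall>z. \<bar>h z\<bar> \<le> B) \<and> (\<forall>z z'. \<bar>h z - h z'\<bar> \<le> w (dist z z'))"

text \<open>The bound \<open>2 * B\<close> makes the Taylor remainder integrable against a law of
  finite variance and supplies its dominating function.\<close>

definition modulus :: "real \<Rightarrow> (real \<Rightarrow> real) \<Rightarrow> bool" where
  "modulus B w \<longleftrightarrow> mono w \<and> w 0 = 0 \<and> isCont w 0 \<and> (\<forall>d. w d \<le> 2 * B)"

definition plane_prob :: "(real \<times> real) measure \<Rightarrow> bool" where
  "plane_prob \<nu> \<longleftrightarrow> prob_space \<nu> \<and> sets \<nu> = sets borel"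

lemma bduc_bound: "bduc B w h \<Longrightarrow> \<bar>h z\<bar> \<le> B"
  unfolding bduc_def by blast

lemma bduc_modulus: "bduc B w h \<Longrightarrow> \<bar>h z - h z'\<bar> \<le> w (dist z z')"
  unfolding bduc_def by blast

lemma modulus_mono: "modulus B w \<Longrightarrow> a \<le> b \<Longrightarrow> w a \<le> w b"
  by (simp add: modulus_def mono_def)

lemma modulus_nonneg: "modulus B w \<Longrightarrow> 0 \<le> a \<Longrightarrow> 0 \<le> w a"
  by (metis modulus_def modulus_mono)

lemma bduc_continuous:
  assumes "modulus B w" "bduc B w h"
  shows "continuous_on UNIV h"
proof -
  have "isCont h z" for z
  proof -
    have "((\<lambda>y. dist y z) \<longlongrightarrow> dist z z) (at z)"
      by (rule tendsto_dist[OF tendsto_ident_at tendsto_const])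
    then have d: "((\<lambda>y. dist y z) \<longlongrightarrow> 0) (at z)" by simp
    have "isCont w 0" "w 0 = 0" using assms(1) by (simp_all add: modulus_def)
    then have "((\<lambda>y. w (dist y z)) \<longlongrightarrow> 0) (at z)"
      using isCont_tendsto_compose[OF _ d, of w] by simp
    then have "((\<lambda>y. h y - h z) \<longlongrightarrow> 0) (at z)"
      by (rule Lim_null_comparison[rotated]) (simp add: bduc_modulus[OF assms(2)])
    then show ?thesis
      by (simp add: LIM_zero_cancel isCont_def)
  qed
  then show ?thesis
    by (simp add: continuous_at_imp_continuous_on)
qed

lemma bduc_measurable: "modulus B w \<Longrightarrow> bduc B w h \<Longrightarrow> h \<in> borel_measurable borel"
  by (intro borel_measurable_continuous_onI bduc_continuous)

lemma bduc_integrable: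
  assumes "modulus B w" "bduc B w h" "plane_prob \<nu>"
  shows "integrable \<nu> (\<lambda>v. h (z + v))"
proof -
  interpret prob_space \<nu> using assms(3) by (simp add: plane_prob_def)
  have [measurable]: "h \<in> borel_measurable borel"
    by (rule bduc_measurable[OF assms(1,2)])
  have [measurable_cong]: "sets \<nu> = sets borel" using assms(3) by (simp add: plane_prob_def)
  show ?thesis
    by (rule integrable_const_bound[where B=B]) (auto intro: bduc_bound[OF assms(2)])
qed

text \<open>Translating two points by the same vector keeps their distance, so averaging passes on
  \<open>w\<close> unchanged. This is the source of the common modulus of all value
  functions.\<close>

lemma avg_bduc:
  assumes "modulus B w" "bduc B w h" "plane_prob \<nu>"
  shows "bduc B w (avg \<nu> h)"
  unfolding bduc_def
proof (intro conjI allI)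
  interpret prob_space \<nu> using assms(3) by (simp add: plane_prob_def)
  note I = bduc_integrable[OF assms]
  fix z z'
  have "\<bar>avg \<nu> h z\<bar> \<le> (\<integral>v. \<bar>h (z + v)\<bar> \<partial>\<nu>)"
    unfolding avg_def by simp
  also have "\<dots> \<le> (\<integral>v. B \<partial>\<nu>)"
    by (intro integral_mono) (auto intro: I bduc_bound[OF assms(2)])
  finally show "\<bar>avg \<nu> h z\<bar> \<le> B" by (simp add: prob_space)
  have "\<bar>avg \<nu> h z - avg \<nu> h z'\<bar> = \<bar>\<integral>v. h (z + v) - h (z' + v) \<partial>\<nu>\<bar>"
    unfolding avg_def using I by simp
  also have "\<dots> \<le> (\<integral>v. \<bar>h (z + v) - h (z' + v)\<bar> \<partial>\<nu>)" by simp
  also have "\<dots> \<le> (\<integral>v. w (dist z z') \<partial>\<nu>)"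
  proof (intro integral_mono)
    show "\<bar>h (z + v) - h (z' + v)\<bar> \<le> w (dist z z')" for v
      using bduc_modulus[OF assms(2), of "z+v" "z'+v"] by simp
  qed (use I in auto)
  finally show "\<bar>avg \<nu> h z - avg \<nu> h z'\<bar> \<le> w (dist z z')" by (simp add: prob_space)
qed

lemma avg_mono:
  assumes "modulus B w" "bduc B w h" "bduc B w h'" "plane_prob \<nu>" "\<And>z. h z \<le> h' z + c"
  shows "avg \<nu> h z \<le> avg \<nu> h' z + c"
proof -
  interpret prob_space \<nu> using assms(4) by (simp add: plane_prob_def)
  have "avg \<nu> h z \<le> (\<integral>v. h' (z + v) + c \<partial>\<nu>)"
    unfolding avg_def
    by (intro integral_mono) (use bduc_integrable assms in auto)
  also have "\<dots> = avg \<nu> h' z + c"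
    unfolding avg_def using bduc_integrable[OF assms(1,3,4)] by (simp add: prob_space)
  finally show ?thesis .
qed

text \<open>Convolutions commute by Fubini, applied to \<open>h (z + x + y)\<close>, which is
  bounded by \<open>B\<close>. This is what lets the smoothing be exchanged with one stage of an
  arm.\<close>

lemma avg_commute:
  assumes "modulus B w" "bduc B w h" "plane_prob \<nu>" "plane_prob \<nu>'"
  shows "avg \<nu> (avg \<nu>' h) = avg \<nu>' (avg \<nu> h)"
proof
  fix z
  interpret a: prob_space \<nu> using assms(3) by (simp add: plane_prob_def)
  interpret b: prob_space \<nu>' using assms(4) by (simp add: plane_prob_def)
  interpret pair_prob_space \<nu> \<nu>' ..
  have [measurable]: "h \<in> borel_measurable borel"
    by (rule bduc_measurable[OF assms(1,2)])
  have [measurable_cong]: "sets \<nu> = sets borel" "sets \<nu>' = sets borel"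
    using assms(3,4) by (simp_all add: plane_prob_def)
  have "integrable (\<nu> \<Otimes>\<^sub>M \<nu>') (\<lambda>(x, y). h (z + x + y))"
    by (rule P.integrable_const_bound[where B=B]) (auto intro: bduc_bound[OF assms(2)])
  from Fubini_integral[OF this]
  show "avg \<nu> (avg \<nu>' h) z = avg \<nu>' (avg \<nu> h) z"
    unfolding avg_def by (simp add: add_ac)
qed

lemma avg_near:
  assumes "modulus B w" "bduc B w h" "plane_prob \<nu>" "AE v in \<nu>. norm v \<le> e"
  shows "\<bar>avg \<nu> h z - h z\<bar> \<le> w e"
proof -
  interpret prob_space \<nu> using assms(3) by (simp add: plane_prob_def)
  note I = bduc_integrable[OF assms(1-3)]
  have "\<bar>avg \<nu> h z - h z\<bar> = \<bar>\<integral>v. h (z + v) - h z \<partial>\<nu>\<bar>"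
    unfolding avg_def using I by (simp add: prob_space)
  also have "\<dots> \<le> (\<integral>v. \<bar>h (z + v) - h z\<bar> \<partial>\<nu>)" by simp
  also have "\<dots> \<le> (\<integral>v. w e \<partial>\<nu>)"
  proof (intro integral_mono_AE)
    show "AE v in \<nu>. \<bar>h (z + v) - h z\<bar> \<le> w e"
      using assms(4)
    proof (eventually_elim)
      case (elim v)
      have "\<bar>h (z + v) - h z\<bar> \<le> w (dist (z + v) z)" by (rule bduc_modulus[OF assms(2)])
      also have "\<dots> \<le> w e" by (rule modulus_mono[OF assms(1)]) (use elim in \<open>simp add: dist_norm\<close>)
      finally show ?case .
    qed
  qed (use I in auto)
  finally show ?thesis by (simp add: prob_space)
qed

section \<open>Uniform averages along the coordinate axes and their derivatives\<close>

definition uniform_law :: "real \<Rightarrow> real measure" where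
  "uniform_law e = density lborel (\<lambda>r. ennreal (indicator {0..e} r / e))"

text \<open>The window lies on one side of the point, so derivatives of the averages are forward
  difference quotients.\<close>

definition uniform_x :: "real \<Rightarrow> (real \<times> real) measure" where
  "uniform_x e = distr (uniform_law e) borel (\<lambda>r. (r, 0))"

definition uniform_y :: "real \<Rightarrow> (real \<times> real) measure" where
  "uniform_y e = distr (uniform_law e) borel (\<lambda>r. (0, r))"

lemma plane_prob_distr: "prob_space N \<Longrightarrow> v \<in> borel_measurable N \<Longrightarrow> plane_prob (distr N borel v)"
  by (simp add: plane_prob_def prob_space.prob_space_distr)

lemma sets_uniform_law [simp, measurable_cong]: "sets (uniform_law e) = sets borel"
  by (simp add: uniform_law_def)

lemma space_uniform_law [simp]: "space (uniform_law e) = UNIV"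
  by (simp add: uniform_law_def)

lemma prob_space_uniform_law:
  assumes "0 < e" shows "prob_space (uniform_law e)"
proof
  have "emeasure (uniform_law e) UNIV = (\<integral>\<^sup>+r. ennreal (1 / e) * indicator {0..e} r \<partial>lborel)"
    unfolding uniform_law_def using assms
    by (subst emeasure_density) (auto intro!: nn_integral_cong split: split_indicator)
  also have "\<dots> = ennreal (1 / e) * ennreal e"
    using assms by (subst nn_integral_cmult_indicator) auto
  also have "\<dots> = 1"
    using assms by (simp add: ennreal_mult[symmetric])
  finally show "emeasure (uniform_law e) (space (uniform_law e)) = 1" by simp
qed

lemma plane_prob_uniform_xy:
  assumes "0 < e" shows "plane_prob (uniform_x e)" "plane_prob (uniform_y e)"
  unfolding uniform_x_def uniform_y_def by (intro plane_prob_distr prob_space_uniform_law[OF assms]; measurable)+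

lemma AE_uniform_xy:
  assumes "0 < e" shows "AE v in uniform_x e. norm v \<le> e" "AE v in uniform_y e. norm v \<le> e"
proof -
  have "AE r in uniform_law e. \<bar>r\<bar> \<le> e"
    unfolding uniform_law_def using assms by (subst AE_density) (auto intro!: AE_I2 split: split_indicator)
  then show "AE v in uniform_x e. norm v \<le> e" "AE v in uniform_y e. norm v \<le> e"
    unfolding uniform_x_def uniform_y_def by (simp_all add: AE_distr_iff norm_Pair)
qed

lemma interval_average:
  fixes p F :: "real \<Rightarrow> real"
  assumes "0 < e" "\<And>x. (F has_real_derivative p x) (at x)" "continuous_on UNIV p"
  shows "(\<integral>r. p (x + r) \<partial>uniform_law e) = (F (x + e) - F x) / e"
proof -
  have [measurable]: "p \<in> borel_measurable borel"
    by (rule borel_measurable_continuous_onI[OF assms(3)])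
  have c: "continuous_on {0..e} (\<lambda>r. p (x + r))"
    by (intro continuous_on_compose2[OF assms(3)] continuous_intros) auto
  have "(\<integral>r. p (x + r) \<partial>uniform_law e) = (\<integral>r. (indicator {0..e} r / e) *\<^sub>R p (x + r) \<partial>lborel)"
    unfolding uniform_law_def using assms(1) by (intro integral_density) auto
  also have "\<dots> = (\<integral>r. (indicator {0..e} r *\<^sub>R p (x + r)) / e \<partial>lborel)"
    by (intro Bochner_Integration.integral_cong) auto
  also have "\<dots> = (\<integral>r. indicator {0..e} r *\<^sub>R p (x + r) \<partial>lborel) / e"
    by (rule integral_divide_zero)
  also have "(\<integral>r. indicator {0..e} r *\<^sub>R p (x + r) \<partial>lborel) = F (x + e) - F (x + 0)"
  proof (intro integral_FTC_atLeastAtMost c)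
    fix r
    have "((\<lambda>r. F (x + r)) has_real_derivative p (x + r)) (at r within {0..e})"
      using DERIV_shift[of F "p (x + r)" r x] assms(2)
      by (simp add: add.commute has_field_derivative_at_within)
    then show "((\<lambda>r. F (x + r)) has_vector_derivative p (x + r)) (at r within {0..e})"
      by (simp add: has_real_derivative_iff_has_vector_derivative)
  qed (use assms(1) in auto)
  finally show ?thesis by simp
qed

text \<open>The average over a moving window is a difference quotient of an antiderivative of
  \<open>p\<close>; differentiating it leaves the difference quotient of \<open>p\<close>
  itself.\<close>

lemma interval_average_deriv:
  fixes p :: "real \<Rightarrow> real"
  assumes "0 < e" "continuous_on UNIV p"
  shows "((\<lambda>x. \<integral>r. p (x + r) \<partial>uniform_law e)
      has_real_derivative (p (x + e) - p x) / e) (at x)"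
proof -
  have "\<exists>F. \<forall>x :: real. -\<infinity> < ereal x \<longrightarrow> ereal x < \<infinity> \<longrightarrow> (F has_vector_derivative p x) (at x)"
    by (rule einterval_antiderivative)
      (use assms(2) in \<open>auto simp: continuous_on_eq_continuous_at\<close>)
  then obtain F where F: "\<And>x. (F has_real_derivative p x) (at x)"
    by (auto simp: has_real_derivative_iff_has_vector_derivative)
  have "((\<lambda>x. (F (x + e) - F x) / e) has_real_derivative (p (x + e) - p x) / e) (at x)"
    using F DERIV_shift[of F "p (x + e)" x e] by (intro DERIV_cdivide DERIV_diff) auto
  then show ?thesis
    using interval_average[OF assms(1) F assms(2)] by simp
qed

lemma avg_uniform_x_deriv:
  assumes "0 < e" "continuous_on UNIV h"
  shows "((\<lambda>x. avg (uniform_x e) h (x, y)) has_real_derivative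
     (h (x + e, y) - h (x, y)) / e) (at x)"
proof -
  have [measurable]: "h \<in> borel_measurable borel"
    by (rule borel_measurable_continuous_onI[OF assms(2)])
  have c: "continuous_on UNIV (\<lambda>x. h (x, y))"
    by (intro continuous_on_compose2[OF assms(2)] continuous_intros) auto
  show ?thesis
    using interval_average_deriv[OF assms(1) c, of x]
    by (simp add: avg_def uniform_x_def integral_distr)
qed

lemma avg_uniform_y_deriv:
  assumes "0 < e" "continuous_on UNIV h"
  shows "((\<lambda>y. avg (uniform_y e) h (x, y)) has_real_derivative
     (h (x, y + e) - h (x, y)) / e) (at y)"
proof -
  have [measurable]: "h \<in> borel_measurable borel"
    by (rule borel_measurable_continuous_onI[OF assms(2)])
  have c: "continuous_on UNIV (\<lambda>y. h (x, y))"
    by (intro continuous_on_compose2[OF assms(2)] continuous_intros) auto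
  show ?thesis
    using interval_average_deriv[OF assms(1) c, of y]
    by (simp add: avg_def uniform_y_def integral_distr)
qed

section \<open>Steklov smoothing\<close>

text \<open>Averaging once in \<open>x\<close> and twice in \<open>y\<close> turns the derivatives \<open>\<partial>\<^sub>x\<close>, \<open>\<partial>\<^sub>y\<close> and \<open>\<partial>\<^sub>y\<^sub>y\<close> into the
  difference quotients \<open>Dx\<close>, \<open>Dy\<close> and \<open>Dyy\<close> below, so that \<open>h\<close> itself need not be smooth.\<close>

definition smooth :: "real \<Rightarrow> (real \<times> real \<Rightarrow> real) \<Rightarrow> real \<times> real \<Rightarrow> real" where
  "smooth e h = avg (uniform_x e) (avg (uniform_y e) (avg (uniform_y e) h))"

definition Dx :: "real \<Rightarrow> (real \<times> real \<Rightarrow> real) \<Rightarrow> real \<times> real \<Rightarrow> real" where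
  "Dx e h z = (avg (uniform_y e) (avg (uniform_y e) h) (z + (e, 0)) - avg (uniform_y e) (avg (uniform_y e) h) z) / e"

definition Dy :: "real \<Rightarrow> (real \<times> real \<Rightarrow> real) \<Rightarrow> real \<times> real \<Rightarrow> real" where
  "Dy e h z = (avg (uniform_y e) (avg (uniform_x e) h) (z + (0, e)) - avg (uniform_y e) (avg (uniform_x e) h) z) / e"

definition Dyy :: "real \<Rightarrow> (real \<times> real \<Rightarrow> real) \<Rightarrow> real \<times> real \<Rightarrow> real" where
  "Dyy e h z = (avg (uniform_x e) h (z + (0, e) + (0, e)) - avg (uniform_x e) h (z + (0, e))
      - (avg (uniform_x e) h (z + (0, e)) - avg (uniform_x e) h z)) / e / e"

lemma smooth_bduc: "modulus B w \<Longrightarrow> bduc B w h \<Longrightarrow> 0 < e \<Longrightarrow> bduc B w (smooth e h)"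
  unfolding smooth_def by (intro avg_bduc plane_prob_uniform_xy)

lemma smooth_near:
  assumes "modulus B w" "bduc B w h" "0 < e"
  shows "\<bar>smooth e h z - h z\<bar> \<le> 3 * w e"
proof -
  note u1 = avg_bduc[OF assms(1,2) plane_prob_uniform_xy(2)[OF assms(3)]]
  note u2 = avg_bduc[OF assms(1) u1 plane_prob_uniform_xy(2)[OF assms(3)]]
  show ?thesis
    using avg_near[OF assms(1) u2 plane_prob_uniform_xy(1)[OF assms(3)] AE_uniform_xy(1)[OF assms(3)], of z]
      avg_near[OF assms(1) u1 plane_prob_uniform_xy(2)[OF assms(3)] AE_uniform_xy(2)[OF assms(3)], of z]
      avg_near[OF assms(1) assms(2) plane_prob_uniform_xy(2)[OF assms(3)] AE_uniform_xy(2)[OF assms(3)], of z]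
    unfolding smooth_def by linarith
qed

lemma smooth_mono:
  assumes "modulus B w" "bduc B w h" "bduc B w h'" "0 < e" "\<And>z. h z \<le> h' z + c"
  shows "smooth e h z \<le> smooth e h' z + c"
  unfolding smooth_def
  by (intro avg_mono[OF assms(1)] avg_bduc[OF assms(1)] plane_prob_uniform_xy[OF assms(4)] assms(2,3,5))

lemma smooth_commute:
  assumes "modulus B w" "bduc B w h" "plane_prob \<nu>" "0 < e"
  shows "avg \<nu> (smooth e h) = smooth e (avg \<nu> h)"
  unfolding smooth_def
  by (simp add: avg_commute[OF assms(1) _ assms(3)] avg_bduc[OF assms(1)] plane_prob_uniform_xy[OF assms(4)] assms)

text \<open>The derivative lemmas differentiate the outermost average. In \<open>smooth\<close> that
  is the one in \<open>x\<close>; for the derivatives in \<open>y\<close> a \<open>uniform_y\<close>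
  average has to be brought outside.\<close>

lemma smooth_alt:
  assumes "modulus B w" "bduc B w h" "0 < e"
  shows "smooth e h = avg (uniform_y e) (avg (uniform_y e) (avg (uniform_x e) h))"
  unfolding smooth_def
  by (simp add: avg_commute[OF assms(1) _ plane_prob_uniform_xy(1) plane_prob_uniform_xy(2)] avg_bduc[OF assms(1)] plane_prob_uniform_xy assms)

lemma smooth_has_Dx:
  assumes "modulus B w" "bduc B w h" "0 < e"
  shows "((\<lambda>x. smooth e h (x, y)) has_real_derivative Dx e h (x, y)) (at x)"
  using avg_uniform_x_deriv[OF assms(3) bduc_continuous[OF assms(1)], of "avg (uniform_y e) (avg (uniform_y e) h)" y x]
  by (simp add: smooth_def Dx_def avg_bduc[OF assms(1)] plane_prob_uniform_xy assms)

lemma smooth_has_Dy: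
  assumes "modulus B w" "bduc B w h" "0 < e"
  shows "((\<lambda>y. smooth e h (x, y)) has_real_derivative Dy e h (x, y)) (at y)"
  using avg_uniform_y_deriv[OF assms(3) bduc_continuous[OF assms(1)], of "avg (uniform_y e) (avg (uniform_x e) h)" x y]
  by (simp add: smooth_alt[OF assms] Dy_def avg_bduc[OF assms(1)] plane_prob_uniform_xy assms)

text \<open>One of the two \<open>uniform_y\<close> averages is still present in \<open>Dy\<close>,
  and it pays for the second derivative.\<close>

lemma Dy_has_Dyy:
  assumes "modulus B w" "bduc B w h" "0 < e"
  shows "((\<lambda>y. Dy e h (x, y)) has_real_derivative Dyy e h (x, y)) (at y)"
proof -
  define q where "q = avg (uniform_x e) h"
  have q: "continuous_on UNIV q"
    unfolding q_def by (intro bduc_continuous[OF assms(1)] avg_bduc[OF assms(1,2)] plane_prob_uniform_xy assms(3))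
  have "((\<lambda>y. (avg (uniform_y e) q (x, y + e) - avg (uniform_y e) q (x, y)) / e) has_real_derivative
      ((q (x, y + e + e) - q (x, y + e)) / e - (q (x, y + e) - q (x, y)) / e) / e) (at y)"
    using avg_uniform_y_deriv[OF assms(3) q, of x y] avg_uniform_y_deriv[OF assms(3) q, of x "y + e"]
      DERIV_shift[of "\<lambda>y. avg (uniform_y e) q (x, y)" _ y e]
    by (intro DERIV_cdivide DERIV_diff) auto
  moreover have "Dyy e h (x, y) = ((q (x, y + e + e) - q (x, y + e)) / e - (q (x, y + e) - q (x, y)) / e) / e"
    unfolding Dyy_def q_def[symmetric] by (simp add: diff_divide_distrib[symmetric] add.assoc del: minus_diff_eq)
  ultimately show ?thesis
    by (simp add: Dy_def q_def)
qed

lemma Dx_modulus: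
  assumes "modulus B w" "bduc B w h" "0 < e"
  shows "\<bar>Dx e h z - Dx e h z'\<bar> \<le> 2 / e * w (dist z z')"
proof -
  define q where "q = avg (uniform_y e) (avg (uniform_y e) h)"
  have q: "bduc B w q"
    unfolding q_def by (intro avg_bduc[OF assms(1)] plane_prob_uniform_xy assms(2,3))
  define f where "f z = q (z + (e, 0)) - q z" for z
  have "\<bar>f z - f z'\<bar> \<le> 2 * w (dist z z')"
    using bduc_modulus[OF q, of z z'] bduc_modulus[OF q, of "z + (e, 0)" "z' + (e, 0)"]
    unfolding f_def by simp
  then have "\<bar>f z - f z'\<bar> / e \<le> 2 * w (dist z z') / e"
    using assms(3) by (simp add: divide_right_mono)
  moreover have "Dx e h z - Dx e h z' = (f z - f z') / e"
    by (simp add: Dx_def q_def f_def diff_divide_distrib)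
  ultimately show ?thesis using assms(3) by simp
qed

lemma Dyy_modulus:
  assumes "modulus B w" "bduc B w h" "0 < e"
  shows "\<bar>Dyy e h z - Dyy e h z'\<bar> \<le> 4 / e\<^sup>2 * w (dist z z')"
proof -
  define q where "q = avg (uniform_x e) h"
  have q: "bduc B w q"
    unfolding q_def by (intro avg_bduc[OF assms(1)] plane_prob_uniform_xy assms(2,3))
  define f where "f z = q (z + (0, e) + (0, e)) - q (z + (0, e)) - (q (z + (0, e)) - q z)" for z
  have "\<bar>f z - f z'\<bar> \<le> 4 * w (dist z z')"
    using bduc_modulus[OF q, of z z'] bduc_modulus[OF q, of "z + (0, e)" "z' + (0, e)"]
      bduc_modulus[OF q, of "z + (0, e) + (0, e)" "z' + (0, e) + (0, e)"]
    unfolding f_def by simp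
  then have "\<bar>f z - f z'\<bar> / e\<^sup>2 \<le> 4 * w (dist z z') / e\<^sup>2"
    by (simp add: divide_right_mono)
  moreover have "Dyy e h z - Dyy e h z' = (f z - f z') / e\<^sup>2"
    using assms(3) by (simp add: Dyy_def q_def f_def power2_eq_square diff_divide_distrib)
  ultimately show ?thesis by simp
qed

text \<open>Difference quotients of a fixed width are bounded operators in the sup norm, so
  uniformly close functions have close smoothed derivatives. This allows the generator to be frozen
  while the value function moves a little.\<close>

lemma Dx_diff_bound:
  assumes "modulus B w" "bduc B w h" "bduc B w h'" "0 < e" "\<And>z. \<bar>h z - h' z\<bar> \<le> t"
  shows "\<bar>Dx e h z - Dx e h' z\<bar> \<le> 2 / e * t"
proof -
  note a = avg_mono[OF assms(1) _ _ plane_prob_uniform_xy(2)[OF assms(4)]] and u = avg_bduc[OF assms(1) _ plane_prob_uniform_xy(2)[OF assms(4)]]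
  define q q' where "q = avg (uniform_y e) (avg (uniform_y e) h)" and "q' = avg (uniform_y e) (avg (uniform_y e) h')"
  have "q z \<le> q' z + t" for z
    unfolding q_def q'_def by (intro a u assms(2,3)) (use assms(5) in \<open>auto simp: abs_le_iff algebra_simps\<close>)
  moreover have "q' z \<le> q z + t" for z
    unfolding q_def q'_def by (intro a u assms(2,3)) (use assms(5) in \<open>auto simp: abs_le_iff algebra_simps\<close>)
  ultimately have b: "\<bar>q z - q' z\<bar> \<le> t" for z
    by (simp add: abs_le_iff algebra_simps)
  define f where "f q z = q (z + (e, 0)) - q z" for q :: "real \<times> real \<Rightarrow> real" and z
  have "\<bar>f q z - f q' z\<bar> \<le> 2 * t"
    using b[of z] b[of "z + (e, 0)"] unfolding f_def by linarith
  then have "\<bar>f q z - f q' z\<bar> / e \<le> 2 * t / e"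
    using assms(4) by (simp add: divide_right_mono)
  moreover have "Dx e h z - Dx e h' z = (f q z - f q' z) / e"
    by (simp add: Dx_def q_def q'_def f_def diff_divide_distrib)
  ultimately show ?thesis using assms(4) by simp
qed

lemma Dyy_diff_bound:
  assumes "modulus B w" "bduc B w h" "bduc B w h'" "0 < e" "\<And>z. \<bar>h z - h' z\<bar> \<le> t"
  shows "\<bar>Dyy e h z - Dyy e h' z\<bar> \<le> 4 / e\<^sup>2 * t"
proof -
  note a = avg_mono[OF assms(1) _ _ plane_prob_uniform_xy(1)[OF assms(4)]]
  define q q' where "q = avg (uniform_x e) h" and "q' = avg (uniform_x e) h'"
  have "q z \<le> q' z + t" for z
    unfolding q_def q'_def by (intro a assms(2,3)) (use assms(5) in \<open>auto simp: abs_le_iff algebra_simps\<close>)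
  moreover have "q' z \<le> q z + t" for z
    unfolding q_def q'_def by (intro a assms(2,3)) (use assms(5) in \<open>auto simp: abs_le_iff algebra_simps\<close>)
  ultimately have b: "\<bar>q z - q' z\<bar> \<le> t" for z
    by (simp add: abs_le_iff algebra_simps)
  define f where "f q z = q (z + (0, e) + (0, e)) - q (z + (0, e)) - (q (z + (0, e)) - q z)"
    for q :: "real \<times> real \<Rightarrow> real" and z
  have "\<bar>f q z - f q' z\<bar> \<le> 4 * t"
    using b[of z] b[of "z + (0, e)"] b[of "z + (0, e) + (0, e)"] unfolding f_def by linarith
  then have "\<bar>f q z - f q' z\<bar> / e\<^sup>2 \<le> 4 * t / e\<^sup>2"
    by (simp add: divide_right_mono)
  moreover have "Dyy e h z - Dyy e h' z = (f q z - f q' z) / e\<^sup>2"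
    using assms(4) by (simp add: Dyy_def q_def q'_def f_def power2_eq_square diff_divide_distrib)
  ultimately show ?thesis by simp
qed

text \<open>The displacement is split into a move in \<open>x\<close> at height \<open>y + d\<close>
  and a move in \<open>y\<close> at the original \<open>x\<close>. The first uses the mean value
  theorem with \<open>Dx\<close>, the second a second-order expansion with Lagrange remainder
  \<open>Dyy\<close>. The moduli of these two difference quotients absorb the displacement of the
  intermediate points, so neither mixed nor second \<open>x\<close> derivatives occur.\<close>

lemma smooth_taylor:
  assumes "modulus B w" "bduc B w h" "0 < e"
  shows "\<bar>smooth e h (z + (a, d)) - smooth e h z - a * Dx e h z - d * Dy e h z - d\<^sup>2 / 2 * Dyy e h z\<bar>
    \<le> (2 / e + 2 / e\<^sup>2) * (\<bar>a\<bar> + d\<^sup>2) * w (\<bar>a\<bar> + \<bar>d\<bar>)"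
proof -
  obtain x y where z: "z = (x, y)" by fastforce
  let ?W = "w (\<bar>a\<bar> + \<bar>d\<bar>)"
  have near: "w (dist (x + s, y + t) (x, y)) \<le> ?W" if "\<bar>s\<bar> \<le> \<bar>a\<bar>" "\<bar>t\<bar> \<le> \<bar>d\<bar>" for s t
  proof (rule modulus_mono[OF assms(1)])
    have "norm (s, t) \<le> \<bar>s\<bar> + \<bar>t\<bar>" using norm_Pair_le[of s t] by simp
    then show "dist (x + s, y + t) (x, y) \<le> \<bar>a\<bar> + \<bar>d\<bar>" using that by (simp add: dist_norm)
  qed
  define dg where "dg m t = (if m = 0 then smooth e h (x + t, y + d) else Dx e h (x + t, y + d))"
    for m :: nat and t
  have "\<exists>t. \<bar>t\<bar> \<le> \<bar>a\<bar> \<and> smooth e h (x + a, y + d)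
      = (\<Sum>m<1. dg m 0 / fact m * a ^ m) + dg 1 t / fact 1 * a ^ 1"
  proof (rule Maclaurin_bi_le, goal_cases)
    case 2
    show ?case
    proof (intro allI impI)
      fix m :: nat and t :: real assume "m < 1 \<and> \<bar>t\<bar> \<le> \<bar>a\<bar>"
      then show "(dg m has_real_derivative dg (Suc m) t) (at t)"
        using smooth_has_Dx[OF assms, of "y + d" "t + x"]
          DERIV_shift[of "\<lambda>x. smooth e h (x, y + d)" _ t x]
        by (auto simp: dg_def[abs_def] add.commute)
    qed
  qed (auto simp: dg_def)
  then obtain s where s: "\<bar>s\<bar> \<le> \<bar>a\<bar>"
    "smooth e h (x + a, y + d) = smooth e h (x, y + d) + Dx e h (x + s, y + d) * a"
    by (auto simp: dg_def)
  have "\<bar>Dx e h (x + s, y + d) - Dx e h z\<bar> \<le> 2 / e * w (dist (x + s, y + d) z)"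
    by (rule Dx_modulus[OF assms])
  also have "\<dots> \<le> 2 / e * ?W"
    using near[OF s(1), of d] assms(3) by (intro mult_left_mono) (auto simp: z)
  finally have "\<bar>a\<bar> * \<bar>Dx e h (x + s, y + d) - Dx e h z\<bar> \<le> \<bar>a\<bar> * (2 / e * ?W)"
    by (rule mult_left_mono) auto
  then have 1: "\<bar>smooth e h (x + a, y + d) - smooth e h (x, y + d) - a * Dx e h z\<bar> \<le> \<bar>a\<bar> * (2 / e * ?W)"
    unfolding s(2) abs_mult[symmetric] by (simp add: right_diff_distrib mult.commute)
  define df where "df m t = (if m = 0 then smooth e h (x, y + t) else if m = 1 then Dy e h (x, y + t)
      else Dyy e h (x, y + t))" for m :: nat and t
  have "\<exists>t. \<bar>t\<bar> \<le> \<bar>d\<bar> \<and> smooth e h (x, y + d)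
      = (\<Sum>m<2. df m 0 / fact m * d ^ m) + df 2 t / fact 2 * d ^ 2"
  proof (rule Maclaurin_bi_le, goal_cases)
    case 2
    show ?case
    proof (intro allI impI)
      fix m :: nat and t :: real assume "m < 2 \<and> \<bar>t\<bar> \<le> \<bar>d\<bar>"
      then have "m = 0 \<or> m = 1" by auto
      then show "(df m has_real_derivative df (Suc m) t) (at t)"
        using smooth_has_Dy[OF assms, of x "t + y"] Dy_has_Dyy[OF assms, of x "t + y"]
          DERIV_shift[of "\<lambda>y. smooth e h (x, y)" _ t y] DERIV_shift[of "\<lambda>y. Dy e h (x, y)" _ t y]
        by (auto simp: df_def[abs_def] add.commute)
    qed
  qed (auto simp: df_def)
  then obtain t where t: "\<bar>t\<bar> \<le> \<bar>d\<bar>"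
    "smooth e h (x, y + d) = smooth e h z + Dy e h z * d + Dyy e h (x, y + t) / 2 * d\<^sup>2"
    by (auto simp: df_def z numeral_2_eq_2)
  have "\<bar>Dyy e h (x, y + t) - Dyy e h z\<bar> \<le> 4 / e\<^sup>2 * w (dist (x, y + t) z)"
    by (rule Dyy_modulus[OF assms])
  also have "\<dots> \<le> 4 / e\<^sup>2 * ?W"
    using near[of 0, OF _ t(1)] by (intro mult_left_mono) (auto simp: z)
  finally have "d\<^sup>2 / 2 * \<bar>Dyy e h (x, y + t) - Dyy e h z\<bar> \<le> d\<^sup>2 / 2 * (4 / e\<^sup>2 * ?W)"
    by (rule mult_left_mono) auto
  moreover have "smooth e h (x, y + d) - smooth e h z - d * Dy e h z - d\<^sup>2 / 2 * Dyy e h z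
      = d\<^sup>2 / 2 * (Dyy e h (x, y + t) - Dyy e h z)"
    unfolding t(2) by (simp add: field_simps)
  ultimately have 2: "\<bar>smooth e h (x, y + d) - smooth e h z - d * Dy e h z - d\<^sup>2 / 2 * Dyy e h z\<bar>
      \<le> d\<^sup>2 / 2 * (4 / e\<^sup>2 * ?W)"
    by (simp only: abs_mult) (simp only: abs_divide abs_power2 abs_numeral)
  have W: "0 \<le> ?W" by (rule modulus_nonneg[OF assms(1)]) auto
  \<comment> \<open>The constants \<open>2 / e\<close> and \<open>4 / e\<^sup>2 / 2\<close> from the
    moduli of \<open>Dx\<close> and \<open>Dyy\<close> are merged into one product, so that the
    remainder integrates as a single expression.\<close>
  have 3: "\<bar>a\<bar> * (2 / e * ?W) + d\<^sup>2 / 2 * (4 / e\<^sup>2 * ?W) \<le> (2 / e + 2 / e\<^sup>2) * (\<bar>a\<bar> + d\<^sup>2) * ?W"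
  proof -
    have "(2 / e + 2 / e\<^sup>2) * (\<bar>a\<bar> + d\<^sup>2) * ?W - (\<bar>a\<bar> * (2 / e * ?W) + d\<^sup>2 / 2 * (4 / e\<^sup>2 * ?W))
      = (2 / e * d\<^sup>2 + 2 / e\<^sup>2 * \<bar>a\<bar>) * ?W"
      by (simp add: algebra_simps add_divide_distrib)
    moreover have "0 \<le> (2 / e * d\<^sup>2 + 2 / e\<^sup>2 * \<bar>a\<bar>) * ?W"
      using W assms(3) by (intro mult_nonneg_nonneg add_nonneg_nonneg) auto
    ultimately show ?thesis by (metis diff_ge_0_iff_ge)
  qed
  have "smooth e h (z + (a, d)) - smooth e h z - a * Dx e h z - d * Dy e h z - d\<^sup>2 / 2 * Dyy e h z
    = (smooth e h (x + a, y + d) - smooth e h (x, y + d) - a * Dx e h z)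
      + (smooth e h (x, y + d) - smooth e h z - d * Dy e h z - d\<^sup>2 / 2 * Dyy e h z)"
    by (simp add: z)
  then show ?thesis
    using order_trans[OF abs_triangle_ineq order_trans[OF add_mono[OF 1 2] 3]] by (simp only:)
qed

section \<open>One-step consistency\<close>

definition arm :: "real measure \<Rightarrow> bool" where
  "arm \<nu> \<longleftrightarrow> prob_space \<nu> \<and> sets \<nu> = sets borel \<and> integrable \<nu> (\<lambda>x. x\<^sup>2)"

definition amean :: "real measure \<Rightarrow> real" where
  "amean \<nu> = (\<integral>x. x \<partial>\<nu>)"

definition avar :: "real measure \<Rightarrow> real" where
  "avar \<nu> = (\<integral>x. (x - amean \<nu>)\<^sup>2 \<partial>\<nu>)"

definition increment_law :: "real measure \<Rightarrow> nat \<Rightarrow> (real \<times> real) measure" where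
  "increment_law \<nu> n = distr \<nu> borel (\<lambda>x. (amean \<nu> / real n, (x - amean \<nu>) / sqrt (real n)))"

text \<open>The drift and diffusion operator with coefficients \<open>p\<close>, applied to
  \<open>smooth e h\<close> rather than to \<open>h\<close>. It has no first derivative in
  \<open>y\<close> because the \<open>y\<close> increments are centred.\<close>

definition generator :: "real \<Rightarrow> real \<times> real \<Rightarrow> (real \<times> real \<Rightarrow> real) \<Rightarrow> real \<times> real \<Rightarrow> real" where
  "generator e p h z = fst p * Dx e h z + snd p / 2 * Dyy e h z"

text \<open>The integrated remainder of \<open>smooth_taylor\<close> after a factor
  \<open>1 / real n\<close> has been taken out: both the drift and the squared fluctuation of one
  stage are of that order.\<close>

definition taylor_error :: "real \<Rightarrow> (real \<Rightarrow> real) \<Rightarrow> real measure \<Rightarrow> nat \<Rightarrow> real" where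
  "taylor_error e w \<nu> n = (2 / e + 2 / e\<^sup>2) * (\<integral>x. (\<bar>amean \<nu>\<bar> + (x - amean \<nu>)\<^sup>2)
     * w (\<bar>amean \<nu>\<bar> / real n + \<bar>x - amean \<nu>\<bar> / sqrt (real n)) \<partial>\<nu>)"

lemma modulus_measurable: "modulus B w \<Longrightarrow> w \<in> borel_measurable borel"
  by (intro borel_measurable_mono) (simp add: modulus_def)

lemma modulus_small:
  assumes "modulus B w" "0 < t"
  shows "\<exists>e>0. w e < t"
proof -
  have "isCont w 0" "w 0 < t" using assms by (auto simp: modulus_def)
  then have "\<forall>\<^sub>F x in at 0. w x < t"
    by (auto simp: isCont_def intro: order_tendstoD)
  then obtain d where "d > 0" "\<And>x. x \<noteq> 0 \<Longrightarrow> dist x 0 < d \<Longrightarrow> w x < t"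
    by (auto simp: eventually_at)
  then show ?thesis by (intro exI[of _ "d/2"]) auto
qed

lemma arm_integrable:
  assumes "arm \<nu>"
  shows "integrable \<nu> (\<lambda>x. x)" "integrable \<nu> (\<lambda>x. x - amean \<nu>)" "integrable \<nu> (\<lambda>x. (x - amean \<nu>)\<^sup>2)"
    "(\<integral>x. x - amean \<nu> \<partial>\<nu>) = 0"
proof -
  interpret prob_space \<nu> using assms by (simp add: arm_def)
  have [measurable_cong]: "sets \<nu> = sets borel" using assms by (simp add: arm_def)
  have sq: "integrable \<nu> (\<lambda>x. x\<^sup>2)" using assms by (simp add: arm_def)
  show 1: "integrable \<nu> (\<lambda>x. x)"
    by (rule square_integrable_imp_integrable[OF _ sq]) measurable
  then show "integrable \<nu> (\<lambda>x. x - amean \<nu>)" by simp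
  show "integrable \<nu> (\<lambda>x. (x - amean \<nu>)\<^sup>2)"
    unfolding power2_diff using 1 sq by simp
  show "(\<integral>x. x - amean \<nu> \<partial>\<nu>) = 0"
    using 1 by (simp add: prob_space amean_def)
qed

lemma increment_law_measurable: "arm \<nu> \<Longrightarrow> (\<lambda>x. (amean \<nu> / real n, (x - amean \<nu>) / sqrt (real n))) \<in> borel_measurable \<nu>"
proof -
  assume "arm \<nu>"
  then have [measurable_cong]: "sets \<nu> = sets borel" by (simp add: arm_def)
  show ?thesis by measurable
qed

lemma plane_prob_increment_law: "arm \<nu> \<Longrightarrow> plane_prob (increment_law \<nu> n)"
  unfolding increment_law_def by (intro plane_prob_distr increment_law_measurable) (simp_all add: arm_def)

lemma avg_increment_law:
  assumes "arm \<nu>" "h \<in> borel_measurable borel"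
  shows "avg (increment_law \<nu> n) h z = (\<integral>x. h (z + (amean \<nu> / real n, (x - amean \<nu>) / sqrt (real n))) \<partial>\<nu>)"
  unfolding avg_def increment_law_def using assms(2) increment_law_measurable[OF assms(1)]
  by (intro integral_distr) auto

lemma taylor_error_integrable:
  assumes "modulus B w" "arm \<nu>"
  shows "integrable \<nu> (\<lambda>x. (\<bar>amean \<nu>\<bar> + (x - amean \<nu>)\<^sup>2)
     * w (\<bar>amean \<nu>\<bar> / real n + \<bar>x - amean \<nu>\<bar> / sqrt (real n)))"
proof (rule Bochner_Integration.integrable_bound)
  interpret prob_space \<nu> using assms by (simp add: arm_def)
  have [measurable_cong]: "sets \<nu> = sets borel" using assms by (simp add: arm_def)
  note [measurable] = modulus_measurable[OF assms(1)]
  show "integrable \<nu> (\<lambda>x. (\<bar>amean \<nu>\<bar> + (x - amean \<nu>)\<^sup>2) * (2 * B))"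
    using arm_integrable[OF assms(2)] by simp
  show "AE x in \<nu>. norm ((\<bar>amean \<nu>\<bar> + (x - amean \<nu>)\<^sup>2)
     * w (\<bar>amean \<nu>\<bar> / real n + \<bar>x - amean \<nu>\<bar> / sqrt (real n)))
    \<le> norm ((\<bar>amean \<nu>\<bar> + (x - amean \<nu>)\<^sup>2) * (2 * B))"
  proof (intro AE_I2)
    fix x
    let ?d = "\<bar>amean \<nu>\<bar> / real n + \<bar>x - amean \<nu>\<bar> / sqrt (real n)"
    have "0 \<le> w ?d" by (rule modulus_nonneg[OF assms(1)]) simp
    moreover have "w ?d \<le> 2 * B" using assms(1) by (simp add: modulus_def)
    ultimately show "norm ((\<bar>amean \<nu>\<bar> + (x - amean \<nu>)\<^sup>2) * w ?d)
      \<le> norm ((\<bar>amean \<nu>\<bar> + (x - amean \<nu>)\<^sup>2) * (2 * B))"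
      unfolding norm_mult by (intro mult_left_mono) auto
  qed
  show "(\<lambda>x. (\<bar>amean \<nu>\<bar> + (x - amean \<nu>)\<^sup>2)
     * w (\<bar>amean \<nu>\<bar> / real n + \<bar>x - amean \<nu>\<bar> / sqrt (real n))) \<in> borel_measurable \<nu>"
    by measurable
qed

lemma taylor_error_nonneg:
  assumes "modulus B w" "0 < e"
  shows "0 \<le> taylor_error e w \<nu> n"
  unfolding taylor_error_def using assms(2)
  by (intro mult_nonneg_nonneg Bochner_Integration.integral_nonneg modulus_nonneg[OF assms(1)] add_nonneg_nonneg) auto

text \<open>The increments tend to zero pointwise, hence so does \<open>w\<close> of them, and
  \<open>2 * B\<close> times the integrable weight dominates. Dominated convergence gives o(1) from
  a finite variance.\<close>

lemma taylor_error_tendsto: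
  assumes "modulus B w" "arm \<nu>"
  shows "(\<lambda>n. taylor_error e w \<nu> n) \<longlonglongrightarrow> 0"
proof -
  interpret prob_space \<nu> using assms by (simp add: arm_def)
  have [measurable_cong]: "sets \<nu> = sets borel" using assms by (simp add: arm_def)
  note [measurable] = modulus_measurable[OF assms(1)]
  let ?m = "amean \<nu>"
  have "(\<lambda>n. \<integral>x. (\<bar>?m\<bar> + (x - ?m)\<^sup>2) * w (\<bar>?m\<bar> / real n + \<bar>x - ?m\<bar> / sqrt (real n)) \<partial>\<nu>)
      \<longlonglongrightarrow> (\<integral>x. 0 \<partial>\<nu>)"
  proof (rule integral_dominated_convergence)
    show "integrable \<nu> (\<lambda>x. (\<bar>?m\<bar> + (x - ?m)\<^sup>2) * (2 * B))"
      using arm_integrable[OF assms(2)] by simp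
    show "AE x in \<nu>. norm ((\<bar>?m\<bar> + (x - ?m)\<^sup>2) * w (\<bar>?m\<bar> / real n + \<bar>x - ?m\<bar> / sqrt (real n)))
      \<le> (\<bar>?m\<bar> + (x - ?m)\<^sup>2) * (2 * B)" for n
    proof (intro AE_I2)
      fix x
      let ?d = "\<bar>?m\<bar> / real n + \<bar>x - ?m\<bar> / sqrt (real n)"
      have "0 \<le> w ?d" by (rule modulus_nonneg[OF assms(1)]) simp
      moreover have "w ?d \<le> 2 * B" using assms(1) by (simp add: modulus_def)
      ultimately show "norm ((\<bar>?m\<bar> + (x - ?m)\<^sup>2) * w ?d) \<le> (\<bar>?m\<bar> + (x - ?m)\<^sup>2) * (2 * B)"
        by (simp add: abs_mult mult_left_mono)
    qed
    show "AE x in \<nu>. (\<lambda>n. (\<bar>?m\<bar> + (x - ?m)\<^sup>2) * w (\<bar>?m\<bar> / real n + \<bar>x - ?m\<bar> / sqrt (real n))) \<longlonglongrightarrow> 0"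
    proof (intro AE_I2)
      fix x
      have "(\<lambda>n. \<bar>?m\<bar> / real n + \<bar>x - ?m\<bar> / sqrt (real n)) \<longlonglongrightarrow> 0"
        by (intro tendsto_add_zero lim_const_over_n real_tendsto_divide_at_top[OF tendsto_const]
          filterlim_compose[OF sqrt_at_top filterlim_real_sequentially])
      then have "(\<lambda>n. w (\<bar>?m\<bar> / real n + \<bar>x - ?m\<bar> / sqrt (real n))) \<longlonglongrightarrow> w 0"
        using assms(1) isCont_tendsto_compose[of 0 w] by (simp add: modulus_def)
      then show "(\<lambda>n. (\<bar>?m\<bar> + (x - ?m)\<^sup>2) * w (\<bar>?m\<bar> / real n + \<bar>x - ?m\<bar> / sqrt (real n))) \<longlonglongrightarrow> 0"
        using assms(1) tendsto_mult_right_zero by (fastforce simp: modulus_def)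
    qed
  qed measurable
  then show ?thesis
    unfolding taylor_error_def using tendsto_mult_right_zero by fastforce
qed

text \<open>The Taylor expansion is integrated over one draw: the term with \<open>Dy\<close>
  vanishes since the fluctuation has mean zero, and the quadratic term contributes the
  variance.\<close>

lemma consistency:
  assumes "modulus B w" "bduc B w h" "0 < e" "arm \<nu>" "n \<ge> 1"
  shows "\<bar>avg (increment_law \<nu> n) (smooth e h) z - smooth e h z - generator e (amean \<nu>, avar \<nu>) h z / real n\<bar>
    \<le> taylor_error e w \<nu> n / real n"
proof -
  interpret prob_space \<nu> using assms by (simp add: arm_def)
  note A = arm_integrable[OF assms(4)]
  let ?m = "amean \<nu>"
  note su = smooth_bduc[OF assms(1-3)]
  define a where "a = ?m / real n"
  define d where "d x = (x - ?m) / sqrt (real n)" for x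
  define D where "D x = smooth e h (z + (a, d x)) - smooth e h z - a * Dx e h z - d x * Dy e h z
      - (d x)\<^sup>2 / 2 * Dyy e h z" for x
  have d2: "(d x)\<^sup>2 = (x - ?m)\<^sup>2 / real n" for x
    using assms(5) by (simp add: d_def power_divide)
  have sm: "smooth e h \<in> borel_measurable borel"
    by (rule bduc_measurable[OF assms(1) su])
  have I0: "integrable \<nu> (\<lambda>x. smooth e h (z + (a, d x)))"
  proof -
    have "integrable (increment_law \<nu> n) (\<lambda>v. smooth e h (z + v))"
      by (rule bduc_integrable[OF assms(1) su plane_prob_increment_law[OF assms(4)]])
    then show ?thesis
      unfolding increment_law_def a_def d_def
      by (subst (asm) integrable_distr_eq) (use sm increment_law_measurable[OF assms(4)] in auto)
  qed
  have I1: "integrable \<nu> d" "(\<integral>x. d x \<partial>\<nu>) = 0"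
    unfolding d_def using A by simp_all
  have I2: "integrable \<nu> (\<lambda>x. (d x)\<^sup>2)" "(\<integral>x. (d x)\<^sup>2 \<partial>\<nu>) = avar \<nu> / real n"
    unfolding d2 using A by (simp_all add: avar_def)
  have ID: "integrable \<nu> D"
    unfolding D_def using I0 I1(1) I2(1) by simp
  have "(\<integral>x. D x \<partial>\<nu>) = avg (increment_law \<nu> n) (smooth e h) z - smooth e h z - a * Dx e h z
      - 0 * Dy e h z - avar \<nu> / real n / 2 * Dyy e h z"
    unfolding D_def avg_increment_law[OF assms(4) sm] a_def[symmetric] d_def[symmetric] using I0 I1 I2
    by (simp add: prob_space)
  also have "\<dots> = avg (increment_law \<nu> n) (smooth e h) z - smooth e h z - generator e (?m, avar \<nu>) h z / real n"
    by (simp add: generator_def a_def add_divide_distrib)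
  finally have eq: "\<dots> = (\<integral>x. D x \<partial>\<nu>)" ..
  have "\<bar>\<integral>x. D x \<partial>\<nu>\<bar> \<le> (\<integral>x. \<bar>D x\<bar> \<partial>\<nu>)"
    by simp
  also have "\<dots> \<le> (\<integral>x. (2 / e + 2 / e\<^sup>2) / real n * ((\<bar>?m\<bar> + (x - ?m)\<^sup>2)
     * w (\<bar>?m\<bar> / real n + \<bar>x - ?m\<bar> / sqrt (real n))) \<partial>\<nu>)"
  proof (intro integral_mono integrable_abs ID integrable_mult_right taylor_error_integrable[OF assms(1,4)])
    fix x
    have "\<bar>D x\<bar> \<le> (2 / e + 2 / e\<^sup>2) * (\<bar>a\<bar> + (d x)\<^sup>2) * w (\<bar>a\<bar> + \<bar>d x\<bar>)"
      unfolding D_def by (rule smooth_taylor[OF assms(1-3)])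
    also have "\<bar>a\<bar> + (d x)\<^sup>2 = (\<bar>?m\<bar> + (x - ?m)\<^sup>2) / real n"
      by (simp add: d2 a_def add_divide_distrib)
    finally show "\<bar>D x\<bar> \<le> (2 / e + 2 / e\<^sup>2) / real n * ((\<bar>?m\<bar> + (x - ?m)\<^sup>2)
     * w (\<bar>?m\<bar> / real n + \<bar>x - ?m\<bar> / sqrt (real n)))"
      by (simp add: a_def d_def)
  qed
  also have "\<dots> = taylor_error e w \<nu> n / real n"
    by (simp add: taylor_error_def)
  finally show ?thesis unfolding eq .
qed

lemma generator_diff_bound:
  assumes "modulus B w" "bduc B w h" "bduc B w h'" "0 < e" "\<And>z. \<bar>h z - h' z\<bar> \<le> t"
  shows "\<bar>generator e p h z - generator e p h' z\<bar> \<le> (2 / e + 2 / e\<^sup>2) * (\<bar>fst p\<bar> + \<bar>snd p\<bar>) * t"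
proof -
  have t: "0 \<le> t" using assms(5)[of z] by linarith
  have "\<bar>generator e p h z - generator e p h' z\<bar> = \<bar>fst p * (Dx e h z - Dx e h' z) + snd p / 2 * (Dyy e h z - Dyy e h' z)\<bar>"
    by (simp add: generator_def algebra_simps)
  also have "\<dots> \<le> \<bar>fst p\<bar> * \<bar>Dx e h z - Dx e h' z\<bar> + \<bar>snd p\<bar> / 2 * \<bar>Dyy e h z - Dyy e h' z\<bar>"
    by (rule order_trans[OF abs_triangle_ineq]) (simp add: abs_mult)
  also have "\<dots> \<le> \<bar>fst p\<bar> * (2 / e * t) + \<bar>snd p\<bar> / 2 * (4 / e\<^sup>2 * t)"
    by (intro add_mono mult_left_mono Dx_diff_bound[OF assms] Dyy_diff_bound[OF assms]) auto
  also have "\<dots> \<le> (2 / e + 2 / e\<^sup>2) * (\<bar>fst p\<bar> + \<bar>snd p\<bar>) * t"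
  proof -
    have "(2 / e + 2 / e\<^sup>2) * (\<bar>fst p\<bar> + \<bar>snd p\<bar>) * t
        - (\<bar>fst p\<bar> * (2 / e * t) + \<bar>snd p\<bar> / 2 * (4 / e\<^sup>2 * t))
      = (2 / e * \<bar>snd p\<bar> + 2 / e\<^sup>2 * \<bar>fst p\<bar>) * t"
      by (simp add: algebra_simps add_divide_distrib)
    moreover have "0 \<le> (2 / e * \<bar>snd p\<bar> + 2 / e\<^sup>2 * \<bar>fst p\<bar>) * t"
      using assms(4) t by (intro mult_nonneg_nonneg add_nonneg_nonneg) auto
    ultimately show ?thesis by (metis diff_ge_0_iff_ge)
  qed
  finally show ?thesis .
qed

lemma bduc_zero: "modulus B w \<Longrightarrow> 0 \<le> B \<Longrightarrow> bduc B w (\<lambda>_. 0)"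
  unfolding bduc_def by (auto intro: modulus_nonneg)

lemma generator_bound:
  assumes "modulus B w" "bduc B w h" "0 < e"
  shows "\<bar>generator e p h z\<bar> \<le> (2 / e + 2 / e\<^sup>2) * (\<bar>fst p\<bar> + \<bar>snd p\<bar>) * B"
proof -
  have "0 \<le> B" using bduc_bound[OF assms(2), of z] by linarith
  moreover have "generator e p (\<lambda>_. 0) z = 0" by (simp add: generator_def Dx_def Dyy_def avg_def)
  ultimately show ?thesis
    using generator_diff_bound[OF assms(1,2) bduc_zero[OF assms(1)] assms(3), of B p z] bduc_bound[OF assms(2)]
    by simp
qed

section \<open>The Bellman operator of a finite set of arms\<close>

definition bellman :: "nat set \<Rightarrow> (nat \<Rightarrow> real measure) \<Rightarrow> nat \<Rightarrow> (real \<times> real \<Rightarrow> real) \<Rightarrow> real \<times> real \<Rightarrow> real" where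
  "bellman S L n h z = Max ((\<lambda>k. avg (increment_law (L k) n) h z) ` S)"

locale arms =
  fixes S :: "nat set" and L :: "nat \<Rightarrow> real measure"
  assumes finite_arms: "finite S" and arms_nonempty: "S \<noteq> {}"
    and arm: "\<And>k. k \<in> S \<Longrightarrow> arm (L k)"
begin

lemma bellman_ge: "k \<in> S \<Longrightarrow> avg (increment_law (L k) n) h z \<le> bellman S L n h z"
  unfolding bellman_def using finite_arms by (intro Max_ge) auto

lemma bellman_le_iff: "bellman S L n h z \<le> c \<longleftrightarrow> (\<forall>k\<in>S. avg (increment_law (L k) n) h z \<le> c)"
  unfolding bellman_def using finite_arms arms_nonempty by (subst Max_le_iff) auto

lemma bellman_attained: "\<exists>k\<in>S. avg (increment_law (L k) n) h z = bellman S L n h z"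
proof -
  have "bellman S L n h z \<in> (\<lambda>k. avg (increment_law (L k) n) h z) ` S"
    unfolding bellman_def using finite_arms arms_nonempty by (intro Max_in) auto
  then show ?thesis by auto
qed

lemma bellman_bduc:
  assumes "modulus B w" "bduc B w h"
  shows "bduc B w (bellman S L n h)"
  unfolding bduc_def
proof (intro conjI allI)
  note u = avg_bduc[OF assms plane_prob_increment_law[OF arm]]
  fix z z'
  obtain k where "k \<in> S" "avg (increment_law (L k) n) h z = bellman S L n h z"
    using bellman_attained by blast
  then show "\<bar>bellman S L n h z\<bar> \<le> B" using bduc_bound[OF u] by metis
  have "bellman S L n h z \<le> bellman S L n h z' + w (dist z z')" for z z'
  proof (subst bellman_le_iff, intro ballI)
    fix k assume k: "k \<in> S"
    show "avg (increment_law (L k) n) h z \<le> bellman S L n h z' + w (dist z z')"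
      using bduc_modulus[OF u[OF k], of n z z'] bellman_ge[OF k, of n h z'] by linarith
  qed
  from this[of z z'] this[of z' z] show "\<bar>bellman S L n h z - bellman S L n h z'\<bar> \<le> w (dist z z')"
    by (simp add: abs_le_iff dist_commute algebra_simps)
qed

lemma bellman_mono:
  assumes "modulus B w" "bduc B w h" "bduc B w h'" "\<And>z. h z \<le> h' z + c"
  shows "bellman S L n h z \<le> bellman S L n h' z + c"
proof (subst bellman_le_iff, intro ballI)
  fix k assume k: "k \<in> S"
  show "avg (increment_law (L k) n) h z \<le> bellman S L n h' z + c"
    using avg_mono[OF assms(1-3) plane_prob_increment_law[OF arm[OF k]] assms(4), of n z] bellman_ge[OF k, of n h' z]
    by linarith
qed

lemma iter_bduc:
  assumes "modulus B w" "bduc B w h"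
  shows "bduc B w ((bellman S L n ^^ j) h)"
  by (induction j) (use assms bellman_bduc in auto)

lemma iter_mono:
  assumes "modulus B w" "bduc B w h" "bduc B w h'" "\<And>z. h z \<le> h' z + c"
  shows "(bellman S L n ^^ j) h z \<le> (bellman S L n ^^ j) h' z + c"
proof (induction j arbitrary: z)
  case (Suc j)
  then show ?case
    using bellman_mono[OF assms(1) iter_bduc[OF assms(1,2)] iter_bduc[OF assms(1,3)]] by simp
qed (use assms(4) in simp)

lemma iter_nonexpansive:
  assumes "modulus B w" "bduc B w h" "bduc B w h'" "\<And>z. \<bar>h z - h' z\<bar> \<le> c"
  shows "\<bar>(bellman S L n ^^ j) h z - (bellman S L n ^^ j) h' z\<bar> \<le> c"
proof -
  have "h z \<le> h' z + c" "h' z \<le> h z + c" for z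
    using assms(4)[of z] by (auto simp: abs_le_iff algebra_simps)
  from iter_mono[OF assms(1-3) this(1)] iter_mono[OF assms(1,3,2) this(2)]
  show ?thesis by (simp add: abs_le_iff algebra_simps)
qed

text \<open>By consistency and the boundedness of the generator, one stage moves a smoothed function
  by O(1/n). The constant depends on \<open>h\<close> only through \<open>B\<close> and
  \<open>w\<close>.\<close>

lemma bellman_smooth_step:
  assumes "modulus B w" "0 < e"
  shows "\<exists>C\<ge>0. \<forall>h n z. n \<ge> 1 \<longrightarrow> bduc B w h \<longrightarrow> \<bar>bellman S L n (smooth e h) z - smooth e h z\<bar> \<le> C / real n"
proof -
  have "\<exists>C\<ge>0. \<forall>h n z. n \<ge> 1 \<longrightarrow> bduc B w h \<longrightarrow>
      \<bar>avg (increment_law (L k) n) (smooth e h) z - smooth e h z\<bar> \<le> C / real n" if k: "k \<in> S" for k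
  proof -
    have "convergent (\<lambda>n. taylor_error e w (L k) n)"
      using taylor_error_tendsto[OF assms(1) arm[OF k]] convergent_def by blast
    then obtain C1 where C1: "\<And>n. \<bar>taylor_error e w (L k) n\<bar> \<le> C1"
      using convergent_imp_Bseq BseqE by (metis real_norm_def)
    define C2 where "C2 = (2 / e + 2 / e\<^sup>2) * (\<bar>amean (L k)\<bar> + \<bar>avar (L k)\<bar>) * B"
    have "\<bar>avg (increment_law (L k) n) (smooth e h) z - smooth e h z\<bar> \<le> (C1 + C2) / real n"
      if "n \<ge> 1" "bduc B w h" for h n z
    proof -
      have "\<bar>generator e (amean (L k), avar (L k)) h z\<bar> \<le> C2"
        using generator_bound[OF assms(1) that(2) assms(2), of "(amean (L k), avar (L k))" z] by (simp add: C2_def)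
      then have "\<bar>generator e (amean (L k), avar (L k)) h z / real n\<bar> \<le> C2 / real n"
        by (simp add: divide_right_mono)
      moreover have "taylor_error e w (L k) n / real n \<le> C1 / real n"
        using C1[of n] by (simp add: divide_right_mono)
      ultimately show ?thesis
        using consistency[OF assms(1) that(2) assms(2) arm[OF k] that(1), of z]
        unfolding add_divide_distrib by linarith
    qed
    \<comment> \<open>The sign of \<open>C2\<close> is drawn from a function that is bounded by
      \<open>B\<close>; if there is none, the claim holds vacuously.\<close>
    moreover have "0 \<le> C1 + C2 \<or> (\<forall>h. \<not> bduc B w h)"
    proof -
      have "0 \<le> C1" using C1[of 0] by linarith
      moreover have "0 \<le> C2" if "bduc B w h" for h
        using bduc_bound[OF that, of 0] assms(2) unfolding C2_def
        by (intro mult_nonneg_nonneg add_nonneg_nonneg) auto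
      ultimately show ?thesis by fastforce
    qed
    ultimately show ?thesis by (metis order_refl)
  qed
  then obtain C where C: "\<And>k. k \<in> S \<Longrightarrow> 0 \<le> C k"
    "\<And>k h n z. k \<in> S \<Longrightarrow> n \<ge> 1 \<Longrightarrow> bduc B w h \<Longrightarrow>
      \<bar>avg (increment_law (L k) n) (smooth e h) z - smooth e h z\<bar> \<le> C k / real n"
    by metis
  have "\<bar>bellman S L n (smooth e h) z - smooth e h z\<bar> \<le> sum C S / real n" if "n \<ge> 1" "bduc B w h" for h n z
  proof -
    obtain k where k: "k \<in> S" "avg (increment_law (L k) n) (smooth e h) z = bellman S L n (smooth e h) z"
      using bellman_attained by blast
    have "C k \<le> sum C S" using k(1) C(1) finite_arms by (intro member_le_sum) auto
    then have "C k / real n \<le> sum C S / real n" by (simp add: divide_right_mono)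
    then show ?thesis using C(2)[OF k(1) that, of z] k(2) by simp
  qed
  moreover have "0 \<le> sum C S" using C(1) by (rule sum_nonneg)
  ultimately show ?thesis by blast
qed

text \<open>One stage need not move \<open>f\<close> itself by only O(1/n). Therefore
  \<open>f\<close> is replaced by a smoothed version, whose stages cost \<open>C / real n\<close>
  each, and nonexpansiveness carries the replacement error through the iterates.\<close>

lemma iter_time_continuity:
  assumes "modulus B w" "bduc B w f" "0 < t"
  shows "\<exists>C\<ge>0. \<forall>n\<ge>1. \<forall>j z. \<bar>(bellman S L n ^^ j) f z - f z\<bar> \<le> t + C * real j / real n"
proof -
  \<comment> \<open>Smoothing costs \<open>3 * w e\<close>, less than \<open>t / 2\<close>, and is
    paid twice: under the iterate and for \<open>f\<close> itself.\<close>
  obtain e where e: "e > 0" "w e < t / 6"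
    using modulus_small[OF assms(1), of "t/6"] assms(3) by auto
  obtain C where C: "C \<ge> 0" "\<And>h n z. n \<ge> 1 \<Longrightarrow> bduc B w h \<Longrightarrow>
      \<bar>bellman S L n (smooth e h) z - smooth e h z\<bar> \<le> C / real n"
    using bellman_smooth_step[OF assms(1) e(1)] by blast
  let ?g = "smooth e f"
  have ug: "bduc B w ?g" by (rule smooth_bduc[OF assms(1,2) e(1)])
  have near: "\<bar>f z - ?g z\<bar> \<le> t / 2" for z
    using smooth_near[OF assms(1,2) e(1), of z] e(2) by linarith
  have "\<bar>(bellman S L n ^^ j) f z - f z\<bar> \<le> t + C * real j / real n" if n: "n \<ge> 1" for n j z
  proof -
    have "\<bar>(bellman S L n ^^ j) ?g z - ?g z\<bar> \<le> C * real j / real n" for z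
    proof (induction j arbitrary: z)
      case (Suc j)
      have "\<bar>(bellman S L n ^^ Suc j) ?g z - (bellman S L n ^^ j) ?g z\<bar> \<le> C / real n"
        using iter_nonexpansive[OF assms(1) bellman_bduc[OF assms(1) ug] ug C(2)[OF n assms(2)], of j n z]
        by (simp only: funpow_Suc_right o_apply)
      then have "\<bar>(bellman S L n ^^ Suc j) ?g z - ?g z\<bar> \<le> C / real n + C * real j / real n"
        using Suc[of z] by linarith
      then show ?case by (simp add: algebra_simps add_divide_distrib)
    qed simp
    from this[of z] show ?thesis
      using iter_nonexpansive[OF assms(1,2) ug near, of j n z] near[of z] by linarith
  qed
  then show ?thesis using C(1) by blast
qed

text \<open>Smoothing commutes with the average of an arm, which lies below
  \<open>bellman S L n h\<close>; consistency then turns the average into the generator. The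
  inequality so obtained is affine in \<open>p\<close>, hence the set \<open>?P\<close> is convex
  and contains the hull. Summing the Taylor errors over all arms makes the error independent of
  \<open>p\<close>.\<close>

lemma smooth_supersolution:
  assumes "modulus B w" "bduc B w h" "0 < e" "n \<ge> 1"
    "p \<in> convex hull ((\<lambda>k. (amean (L k), avar (L k))) ` S)"
  shows "smooth e h z + generator e p h z / real n - (\<Sum>k\<in>S. taylor_error e w (L k) n) / real n
    \<le> smooth e (bellman S L n h) z"
proof -
  let ?E = "\<Sum>k\<in>S. taylor_error e w (L k) n"
  let ?P = "{p. smooth e h z + generator e p h z / real n - ?E / real n \<le> smooth e (bellman S L n h) z}"
  have "convex ?P"
  proof (rule convexI)
    fix p q :: "real \<times> real" and u v :: real
    assume p: "p \<in> ?P" and q: "q \<in> ?P" and uv: "0 \<le> u" "0 \<le> v" "u + v = 1"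
    let ?c = "smooth e h z - ?E / real n" and ?d = "smooth e (bellman S L n h) z"
    have "generator e (u *\<^sub>R p + v *\<^sub>R q) h z = u * generator e p h z + v * generator e q h z"
      by (simp add: generator_def algebra_simps add_divide_distrib)
    then have "?c + generator e (u *\<^sub>R p + v *\<^sub>R q) h z / real n
      = u * (?c + generator e p h z / real n) + v * (?c + generator e q h z / real n)"
      using uv(3) by (simp add: add_divide_distrib distrib_left flip: distrib_right)
    also have "\<dots> \<le> u * ?d + v * ?d"
      using p q uv by (intro add_mono mult_left_mono) auto
    also have "\<dots> = ?d" using uv(3) by (simp flip: distrib_right)
    finally show "u *\<^sub>R p + v *\<^sub>R q \<in> ?P" by simp
  qed
  moreover have "(amean (L k), avar (L k)) \<in> ?P" if k: "k \<in> S" for k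
  proof -
    have "taylor_error e w (L k) n \<le> ?E"
      using k finite_arms taylor_error_nonneg[OF assms(1,3)] by (intro member_le_sum) auto
    then have "taylor_error e w (L k) n / real n \<le> ?E / real n" by (simp add: divide_right_mono)
    moreover have "avg (increment_law (L k) n) (smooth e h) z \<le> smooth e (bellman S L n h) z"
      using smooth_mono[OF assms(1) avg_bduc[OF assms(1,2) plane_prob_increment_law[OF arm[OF k]]] bellman_bduc[OF assms(1,2)] assms(3),
          of n n 0 z] bellman_ge[OF k]
      by (simp add: smooth_commute[OF assms(1,2) plane_prob_increment_law[OF arm[OF k]] assms(3)])
    ultimately show ?thesis
      using consistency[OF assms(1-3) arm[OF k] assms(4), of z] by simp
  qed
  ultimately have "convex hull ((\<lambda>k. (amean (L k), avar (L k))) ` S) \<subseteq> ?P"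
    by (intro hull_minimal) auto
  with assms(5) show ?thesis by auto
qed

text \<open>The one-stage inequality is added up over \<open>N\<close> stages with the same
  \<open>p\<close>. Freezing the generator at \<open>v j\<close> costs its operator norm times
  \<open>t\<close> and makes all increments equal.\<close>

lemma smooth_supersolution_steps:
  fixes f :: "real \<times> real \<Rightarrow> real" and n :: nat
  defines "v \<equiv> \<lambda>j. (bellman S L n ^^ j) f"
  assumes "modulus B w" "bduc B w f" "0 < e" "n \<ge> 1"
    "p \<in> convex hull ((\<lambda>k. (amean (L k), avar (L k))) ` S)"
    "\<And>i z. i \<le> N \<Longrightarrow> \<bar>v i z - f z\<bar> \<le> t"
  shows "smooth e (v j) z + real N * ((generator e p (v j) z
      - (2 / e + 2 / e\<^sup>2) * (\<bar>fst p\<bar> + \<bar>snd p\<bar>) * t - (\<Sum>k\<in>S. taylor_error e w (L k) n)) / real n)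
    \<le> smooth e (v (j + N)) z"
proof -
  let ?E = "\<Sum>k\<in>S. taylor_error e w (L k) n" and ?K = "(2 / e + 2 / e\<^sup>2) * (\<bar>fst p\<bar> + \<bar>snd p\<bar>)"
  have uv: "bduc B w (v j)" for j unfolding v_def by (rule iter_bduc[OF assms(2,3)])
  have "smooth e (v j) z + real i * ((generator e p (v j) z - ?K * t - ?E) / real n) \<le> smooth e (v (j + i)) z"
    if "i \<le> N" for i
    using that
  proof (induction i)
    case (Suc i)
    \<comment> \<open>Both functions arise by applying \<open>j\<close> nonexpansive stages, to
      \<open>v i\<close> and to \<open>f\<close>; so closeness of the first \<open>N\<close>
      iterates to \<open>f\<close> is enough at every \<open>j\<close>.\<close>
    have "\<bar>v (j + i) z - v j z\<bar> \<le> t" for z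
      using iter_nonexpansive[OF assms(2) uv[of i] assms(3) assms(7), of j n z] Suc.prems
      by (simp add: v_def funpow_add)
    from generator_diff_bound[OF assms(2) uv uv assms(4) this, of p z]
    have "generator e p (v j) z - ?K * t - ?E \<le> generator e p (v (j + i)) z - ?E" by linarith
    then have "(generator e p (v j) z - ?K * t - ?E) / real n \<le> (generator e p (v (j + i)) z - ?E) / real n"
      by (rule divide_right_mono) simp
    moreover have "smooth e (v (j + i)) z + (generator e p (v (j + i)) z - ?E) / real n \<le> smooth e (v (j + Suc i)) z"
      using smooth_supersolution[OF assms(2) uv assms(4-6), of "j + i" z]
      by (simp add: v_def diff_divide_distrib)
    moreover have "smooth e (v j) z + real i * ((generator e p (v j) z - ?K * t - ?E) / real n) \<le> smooth e (v (j + i)) z"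
      using Suc by simp
    moreover have distr: "real (Suc i) * c = real i * c + c" for c :: real by (simp add: algebra_simps)
    ultimately show ?case unfolding distr by linarith
  qed simp
  then show ?thesis by simp
qed

end

section \<open>Comparison of two systems of arms\<close>

text \<open>The mollified values \<open>\<phi> (i * N)\<close> of the unprimed system, with
  \<open>N = m div n\<close>, are an upper barrier for the \<open>i\<close>-stage values of the
  primed one. The errors are: smoothing at both ends, \<open>3 * w e\<close> each; the Taylor errors
  of the two systems; freezing of the generator, \<open>K * t\<close>; the \<open>m mod n\<close>
  leftover stages, \<open>t'\<close>; and the mismatch between the durations \<open>N / m\<close>
  and \<open>1 / n\<close>.\<close>

lemma comparison_finite:
  fixes f :: "real \<times> real \<Rightarrow> real"
  assumes "modulus B w" "bduc B w f" "arms S L" "arms S' L'" "0 < e" "1 \<le> n" "n \<le> m"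
    and hull: "\<And>k. k \<in> S' \<Longrightarrow> (amean (L' k), avar (L' k)) \<in> convex hull ((\<lambda>k. (amean (L k), avar (L k))) ` S)"
    and K: "\<And>k. k \<in> S' \<Longrightarrow> (2 / e + 2 / e\<^sup>2) * (\<bar>amean (L' k)\<bar> + \<bar>avar (L' k)\<bar>) \<le> K"
    and t: "\<And>i z. i \<le> m div n \<Longrightarrow> \<bar>(bellman S L m ^^ i) f z - f z\<bar> \<le> t"
    and t': "\<And>z. \<bar>(bellman S L m ^^ (m mod n)) f z - f z\<bar> \<le> t'"
  shows "(bellman S' L' n ^^ n) f z \<le> (bellman S L m ^^ m) f z + 6 * w e + (\<Sum>k\<in>S'. taylor_error e w (L' k) n)
    + (\<Sum>k\<in>S. taylor_error e w (L k) m) + K * t + t' + real n * (K * B / real m)"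
proof -
  interpret a: arms S L by fact
  interpret b: arms S' L' by fact
  define N where "N = m div n"
  define v where "v j = (bellman S L m ^^ j) f" for j
  define \<phi> where "\<phi> j = smooth e (v j)" for j
  let ?E = "\<Sum>k\<in>S. taylor_error e w (L k) m" and ?E' = "\<Sum>k\<in>S'. taylor_error e w (L' k) n"
  \<comment> \<open>The defect of the barrier in one primed stage; it is paid \<open>n\<close>
    times.\<close>
  define D where "D = (?E' + K * t + ?E) / real n + K * B / real m"
  have uv: "bduc B w (v j)" for j unfolding v_def by (rule a.iter_bduc[OF assms(1,2)])
  have u\<phi>: "bduc B w (\<phi> j)" for j unfolding \<phi>_def by (rule smooth_bduc[OF assms(1) uv assms(5)])
  have m1: "1 \<le> m" using assms(6,7) by linarith
  have t0: "0 \<le> t" using t[of 0 z] by simp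
  have B0: "0 \<le> B" using bduc_bound[OF assms(2), of z] by linarith
  have N: "real N / real m \<le> 1 / real n" "1 / real n - real N / real m \<le> 1 / real m"
  proof -
    have "m = n * N + m mod n" unfolding N_def by simp
    then have mr: "real m = real n * real N + real (m mod n)"
      by (metis of_nat_add of_nat_mult)
    have "m mod n < n" using assms(6) by simp
    then have r: "real (m mod n) \<le> real n" by simp
    have "1 / real n - real N / real m = real (m mod n) / (real n * real m)"
      using assms(6) m1 by (simp add: field_simps) (use mr in \<open>simp add: algebra_simps\<close>)
    moreover have "0 \<le> real (m mod n) / (real n * real m)" by simp
    moreover have "real (m mod n) / (real n * real m) \<le> 1 / real m"
      using r assms(6) m1 by (simp add: field_simps)
    ultimately show "real N / real m \<le> 1 / real n" "1 / real n - real N / real m \<le> 1 / real m"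
      by linarith+
  qed
  have step: "avg (increment_law (L' k) n) (\<phi> j) z \<le> \<phi> (j + N) z + D" if k: "k \<in> S'" for k j z
  proof -
    let ?p = "(amean (L' k), avar (L' k))"
    let ?Q = "generator e ?p (v j) z"
    have K': "(2 / e + 2 / e\<^sup>2) * (\<bar>fst ?p\<bar> + \<bar>snd ?p\<bar>) \<le> K" using K[OF k] by simp
    have K0: "0 \<le> K" by (rule order_trans[OF _ K']) (use assms(5) in simp)
    have "taylor_error e w (L' k) n \<le> ?E'"
      using k b.finite_arms taylor_error_nonneg[OF assms(1,5)] by (intro member_le_sum) auto
    then have "taylor_error e w (L' k) n / real n \<le> ?E' / real n" by (simp add: divide_right_mono)
    then have 1: "avg (increment_law (L' k) n) (\<phi> j) z \<le> \<phi> j z + ?Q / real n + ?E' / real n"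
      using consistency[OF assms(1) uv[of j] assms(5) b.arm[OF k] assms(6), of z] unfolding \<phi>_def by linarith
    have "\<phi> j z + real N * ((?Q - (2 / e + 2 / e\<^sup>2) * (\<bar>fst ?p\<bar> + \<bar>snd ?p\<bar>) * t - ?E) / real m) \<le> \<phi> (j + N) z"
      unfolding \<phi>_def v_def
      by (rule a.smooth_supersolution_steps[OF assms(1,2,5) m1 hull[OF k]]) (use t N_def in auto)
    moreover have "(?Q - K * t - ?E) / real m
        \<le> (?Q - (2 / e + 2 / e\<^sup>2) * (\<bar>fst ?p\<bar> + \<bar>snd ?p\<bar>) * t - ?E) / real m"
      using mult_right_mono[OF K' t0] by (intro divide_right_mono) auto
    then have "real N * ((?Q - K * t - ?E) / real m)
        \<le> real N * ((?Q - (2 / e + 2 / e\<^sup>2) * (\<bar>fst ?p\<bar> + \<bar>snd ?p\<bar>) * t - ?E) / real m)"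
      by (rule mult_left_mono) simp
    ultimately have "\<phi> j z + real N * ((?Q - K * t - ?E) / real m) \<le> \<phi> (j + N) z" by linarith
    moreover have "real N * ((?Q - K * t - ?E) / real m) = real N / real m * ?Q - real N / real m * (K * t + ?E)"
      by (simp add: diff_divide_distrib algebra_simps add_divide_distrib)
    moreover have "real N / real m * (K * t + ?E) \<le> 1 / real n * (K * t + ?E)"
      using K0 t0 taylor_error_nonneg[OF assms(1,5)]
      by (intro mult_right_mono N(1) add_nonneg_nonneg mult_nonneg_nonneg sum_nonneg) auto
    ultimately have 2: "\<phi> j z + real N / real m * ?Q - 1 / real n * (K * t + ?E) \<le> \<phi> (j + N) z" by linarith
    have "\<bar>?Q\<bar> \<le> (2 / e + 2 / e\<^sup>2) * (\<bar>fst ?p\<bar> + \<bar>snd ?p\<bar>) * B"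
      by (rule generator_bound[OF assms(1) uv assms(5)])
    then have Q: "\<bar>?Q\<bar> \<le> K * B" using mult_right_mono[OF K' B0] by linarith
    \<comment> \<open>The generator has weight \<open>1 / n\<close> on the primed side and
      \<open>N / m\<close> on the other. The weights differ by at most \<open>1 / m\<close>, and
      \<open>?Q\<close> is bounded by \<open>K * B\<close>.\<close>
    have "?Q * (1 / real n - real N / real m) \<le> (K * B) * (1 / real m)"
      using Q N by (intro mult_mono) auto
    then have "?Q / real n - real N / real m * ?Q \<le> K * B / real m" by (simp add: algebra_simps)
    with 1 2 show ?thesis unfolding D_def by (simp add: add_divide_distrib)
  qed
  then have bstep: "bellman S' L' n (\<phi> j) z \<le> \<phi> (j + N) z + D" for j z
    by (simp add: b.bellman_le_iff)
  have "(bellman S' L' n ^^ i) f z \<le> \<phi> (i * N) z + (3 * w e + real i * D)" for i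
  proof (induction i arbitrary: z)
    case 0
    show ?case using smooth_near[OF assms(1,2,5), of z] by (simp add: \<phi>_def v_def)
  next
    case (Suc i)
    have "(bellman S' L' n ^^ Suc i) f z \<le> bellman S' L' n (\<phi> (i * N)) z + (3 * w e + real i * D)"
      using b.bellman_mono[OF assms(1) b.iter_bduc[OF assms(1,2)] u\<phi> Suc] by simp
    also have "\<dots> \<le> \<phi> (i * N + N) z + D + (3 * w e + real i * D)"
      using bstep by simp
    finally show ?case by (simp add: algebra_simps)
  qed
  from this[of n] have "(bellman S' L' n ^^ n) f z \<le> \<phi> (n * N) z + (3 * w e + real n * D)" .
  moreover have "\<phi> (n * N) z \<le> v (n * N) z + 3 * w e"
    using smooth_near[OF assms(1) uv assms(5), of "n * N" z] unfolding \<phi>_def by linarith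
  moreover have "v (n * N) z \<le> v m z + t'"
  proof -
    \<comment> \<open>The leftover stages are applied to \<open>f\<close> first, so they are those
      nearest to the horizon; nonexpansiveness carries their error through the other
      \<open>n * N\<close> stages.\<close>
    have "m = n * N + m mod n" unfolding N_def by simp
    then have "v m = (bellman S L m ^^ (n * N)) (v (m mod n))"
      unfolding v_def by (metis funpow_add o_apply)
    then show ?thesis
      using a.iter_nonexpansive[OF assms(1) uv[of "m mod n"] assms(2) t'[folded v_def], of "n * N" m z]
      unfolding v_def by simp
  qed
  moreover have "real n * D = ?E' + K * t + ?E + real n * (K * B / real m)"
  proof -
    have "real n * (x / real n + y) = x + real n * y" for x y
      using assms(6) by (simp add: distrib_left)
    then show ?thesis unfolding D_def .
  qed
  ultimately show ?thesis unfolding v_def by linarith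
qed

text \<open>All errors of \<open>comparison_finite\<close> become small if \<open>e\<close> is
  chosen first, then \<open>n\<close> large, and \<open>m\<close> large in dependence on
  \<open>n\<close>. The last dependence is genuine in this estimate, as it contains ratios
  \<open>n / m\<close>.\<close>

lemma comparison:
  fixes f :: "real \<times> real \<Rightarrow> real"
  assumes "modulus B w" "bduc B w f" "arms S L" "arms S' L'" "0 < E"
    and hull: "\<And>k. k \<in> S' \<Longrightarrow> (amean (L' k), avar (L' k)) \<in> convex hull ((\<lambda>k. (amean (L k), avar (L k))) ` S)"
  shows "\<exists>n0. \<forall>n\<ge>n0. \<exists>m0. \<forall>m\<ge>m0. (bellman S' L' n ^^ n) f z \<le> (bellman S L m ^^ m) f z + E"
proof -
  interpret a: arms S L by fact
  interpret b: arms S' L' by fact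
  \<comment> \<open>Budget: \<open>6 * w e\<close>, \<open>K * t\<close> and \<open>t\<close> get
    \<open>E / 6\<close> each; the terms that vanish in \<open>n\<close> and those that vanish in
    \<open>m\<close> get \<open>E / 4\<close> each.\<close>
  obtain e where e: "e > 0" "w e < E / 36"
    using modulus_small[OF assms(1), of "E / 36"] assms(5) by auto
  define K where "K = (\<Sum>k\<in>S'. (2 / e + 2 / e\<^sup>2) * (\<bar>amean (L' k)\<bar> + \<bar>avar (L' k)\<bar>))"
  have K: "(2 / e + 2 / e\<^sup>2) * (\<bar>amean (L' k)\<bar> + \<bar>avar (L' k)\<bar>) \<le> K" if "k \<in> S'" for k
    unfolding K_def using that e(1) b.finite_arms
    by (intro member_le_sum[where f = "\<lambda>k. (2 / e + 2 / e\<^sup>2) * (\<bar>amean (L' k)\<bar> + \<bar>avar (L' k)\<bar>)"]) auto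
  have K0: "0 \<le> K" unfolding K_def using e(1) by (intro sum_nonneg) auto
  \<comment> \<open>With \<open>K + 1\<close> in the denominator both \<open>t\<close> and
    \<open>K * t\<close> are at most \<open>E / 6\<close>, also for \<open>K = 0\<close>.\<close>
  define t where "t = E / (6 * (K + 1))"
  have t: "0 < t" "t \<le> E / 6" "K * t \<le> E / 6"
    using K0 assms(5) by (auto simp: t_def field_simps)
  obtain C where C: "C \<ge> 0" "\<And>n j z. n \<ge> 1 \<Longrightarrow> \<bar>(bellman S L n ^^ j) f z - f z\<bar> \<le> t + C * real j / real n"
    using a.iter_time_continuity[OF assms(1,2) t(1)] by blast
  have "(\<lambda>n. (\<Sum>k\<in>S'. taylor_error e w (L' k) n) + K * C / real n) \<longlonglongrightarrow> (\<Sum>k\<in>S'. 0) + 0"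
    by (intro tendsto_add tendsto_sum taylor_error_tendsto[OF assms(1)] b.arm lim_const_over_n)
  then have "\<forall>\<^sub>F n in sequentially. (\<Sum>k\<in>S'. taylor_error e w (L' k) n) + K * C / real n < E / 4"
    using assms(5) by (intro order_tendstoD) auto
  then obtain n1 where n1: "\<And>n. n \<ge> n1 \<Longrightarrow> (\<Sum>k\<in>S'. taylor_error e w (L' k) n) + K * C / real n < E / 4"
    by (auto simp: eventually_sequentially)
  show ?thesis
  proof (rule exI[of _ "max 1 n1"], intro allI impI)
    fix n assume "max 1 n1 \<le> n"
    then have n: "1 \<le> n" "n1 \<le> n" by auto
    have "(\<lambda>m. (\<Sum>k\<in>S. taylor_error e w (L k) m) + (real n * K * B + C * real n) / real m) \<longlonglongrightarrow> (\<Sum>k\<in>S. 0) + 0"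
      by (intro tendsto_add tendsto_sum taylor_error_tendsto[OF assms(1)] a.arm lim_const_over_n)
    then have "\<forall>\<^sub>F m in sequentially. (\<Sum>k\<in>S. taylor_error e w (L k) m) + (real n * K * B + C * real n) / real m < E / 4"
      using assms(5) by (intro order_tendstoD) auto
    then obtain m1 where m1: "\<And>m. m \<ge> m1 \<Longrightarrow>
        (\<Sum>k\<in>S. taylor_error e w (L k) m) + (real n * K * B + C * real n) / real m < E / 4"
      by (auto simp: eventually_sequentially)
    show "\<exists>m0. \<forall>m\<ge>m0. (bellman S' L' n ^^ n) f z \<le> (bellman S L m ^^ m) f z + E"
    proof (intro exI[of _ "max n m1"] allI impI)
      fix m assume "max n m1 \<le> m"
      then have m: "n \<le> m" "m1 \<le> m" "1 \<le> m" using n(1) by auto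
      \<comment> \<open>A block of at most \<open>m div n\<close> stages lasts at most the time
        \<open>1 / n\<close>, so this bound does not depend on \<open>m\<close>.\<close>
      have tau: "\<bar>(bellman S L m ^^ i) f z - f z\<bar> \<le> t + C / real n" if i: "i \<le> m div n" for i z
      proof -
        have "i * n \<le> m" using i n(1) by (metis div_times_less_eq_dividend le_trans mult_le_mono1)
        then have "real i * real n \<le> real m" by (metis of_nat_le_iff of_nat_mult)
        then have "real i / real m \<le> 1 / real n" using n(1) m(3) by (simp add: field_simps)
        then have "C * (real i / real m) \<le> C * (1 / real n)" using C(1) by (rule mult_left_mono)
        then show ?thesis using C(2)[OF m(3), of i z] by simp
      qed
      have tau': "\<bar>(bellman S L m ^^ (m mod n)) f z - f z\<bar> \<le> t + C * real n / real m" for z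
      proof -
        have "m mod n \<le> n" using n(1) by (simp add: order_less_imp_le)
        then have "C * real (m mod n) / real m \<le> C * real n / real m"
          using C(1) by (intro divide_right_mono mult_left_mono) auto
        then show ?thesis using C(2)[OF m(3), of "m mod n" z] by linarith
      qed
      have "(bellman S' L' n ^^ n) f z \<le> (bellman S L m ^^ m) f z + 6 * w e + (\<Sum>k\<in>S'. taylor_error e w (L' k) n)
        + (\<Sum>k\<in>S. taylor_error e w (L k) m) + K * (t + C / real n) + (t + C * real n / real m) + real n * (K * B / real m)"
        by (rule comparison_finite[OF assms(1-4) e(1) n(1) m(1) hull K tau tau']) auto
      moreover have "K * (t + C / real n) = K * t + K * C / real n" by (simp add: distrib_left)
      moreover have "(real n * K * B + C * real n) / real m = C * real n / real m + real n * (K * B / real m)"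
        by (simp add: add_divide_distrib)
      ultimately show "(bellman S' L' n ^^ n) f z \<le> (bellman S L m ^^ m) f z + E"
        using e(2) t n1[OF n(2)] m1[OF m(2)] by linarith
    qed
  qed
qed

section \<open>Independence of past and present draws\<close>

context bandit
begin

definition law :: "nat \<Rightarrow> real measure" where
  "law k = distr M borel (X k)"

lemma law_props:
  assumes "k \<in> {1..K}"
  shows "arm (law k)" "amean (law k) = expectation (X k)" "avar (law k) = variance (X k)"
proof -
  have [measurable]: "X k \<in> borel_measurable M" by (rule payoff_rv[OF assms])
  show m: "amean (law k) = expectation (X k)"
    unfolding amean_def law_def by (simp add: integral_distr)
  show "avar (law k) = variance (X k)"
    unfolding avar_def m unfolding law_def by (simp add: integral_distr)
  show "arm (law k)"
    unfolding arm_def law_def using finite_variance[OF assms]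
    by (auto intro: prob_space_distr simp: integrable_distr_eq)
qed

lemma mv_law: "k \<in> {1..K} \<Longrightarrow> mv M X k = (amean (law k), avar (law k))"
  by (simp add: mv_def law_props)

lemma Y_measurable: "k \<in> {1..K} \<Longrightarrow> 1 \<le> n \<Longrightarrow> Y k n \<in> borel_measurable M"
  using indep unfolding indep_vars_def by fastforce

lemma distr_Y: "k \<in> {1..K} \<Longrightarrow> 1 \<le> n \<Longrightarrow> distr M borel (Y k n) = law k"
  by (simp add: copies law_def)

definition draws :: "nat \<Rightarrow> 'a \<Rightarrow> nat \<times> nat \<Rightarrow> real" where
  "draws m \<omega> = (\<lambda>p\<in>{1..K} \<times> {1..m}. (case p of (k, i) \<Rightarrow> Y k i) \<omega>)"

text \<open>Generated by the draws of all arms up to stage \<open>m\<close>, played or not. It does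
  not depend on the strategy, contains the history of every admissible one, and is independent of
  each draw at stage \<open>Suc m\<close>.\<close>

definition past :: "nat \<Rightarrow> 'a measure" where
  "past m = vimage_algebra (space M) (draws m) (PiM ({1..K} \<times> {1..m}) (\<lambda>_. borel))"

lemma space_past [simp]: "space (past m) = space M"
  by (simp add: past_def)

lemma Y_past: "k \<in> {1..K} \<Longrightarrow> i \<in> {1..m} \<Longrightarrow> Y k i \<in> borel_measurable (past m)"
proof -
  assume k: "k \<in> {1..K}" "i \<in> {1..m}"
  have "draws m \<in> measurable (past m) (PiM ({1..K} \<times> {1..m}) (\<lambda>_. borel))"
    unfolding past_def
    by (rule measurable_vimage_algebra1) (auto simp: draws_def space_PiM PiE_def)
  then have "(\<lambda>\<omega>. draws m \<omega> (k, i)) \<in> borel_measurable (past m)"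
    by (rule measurable_compose[OF _ measurable_component_singleton]) (use k in auto)
  moreover have "(\<lambda>\<omega>. draws m \<omega> (k, i)) = Y k i"
    using k by (auto simp: draws_def fun_eq_iff)
  ultimately show ?thesis by simp
qed

lemma past_in:
  assumes "space N = space M" "\<And>k i. k \<in> {1..K} \<Longrightarrow> i \<in> {1..m} \<Longrightarrow> Y k i \<in> borel_measurable N"
    "f \<in> measurable (past m) R"
  shows "f \<in> measurable N R"
proof -
  have "(\<lambda>x. x) \<in> measurable N (past m)"
    unfolding past_def
  proof (rule measurable_vimage_algebra2)
    show "draws m \<in> measurable N (PiM ({1..K} \<times> {1..m}) (\<lambda>_. borel))"
      unfolding draws_def using assms(2) by (intro measurable_restrict) auto
  qed (use assms(1) in auto)
  from measurable_compose[OF this assms(3)] show ?thesis .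
qed

lemma past_mono: "m \<le> m' \<Longrightarrow> f \<in> measurable (past m) R \<Longrightarrow> f \<in> measurable (past m') R"
  by (rule past_in) (auto intro!: Y_past)

lemma past_measurable: "f \<in> measurable (past m) R \<Longrightarrow> f \<in> measurable M R"
  by (rule past_in) (auto intro!: Y_measurable)

lemma sets_past: "sets (past m) = sigma_sets (space M)
    {draws m -` A \<inter> space M | A. A \<in> sets (PiM ({1..K} \<times> {1..m}) (\<lambda>_. borel))}"
  by (simp add: past_def sets_vimage_algebra)

text \<open>The draws up to stage \<open>m\<close> and the draw at \<open>(k, Suc m)\<close> have
  disjoint index sets, and disjoint blocks of an independent family are independent. The single draw
  is written as a block with one coordinate to fit that form.\<close>

lemma prob_past_draw:
  assumes k: "k \<in> {1..K}" and A: "A \<in> sets (past m)" and B: "B \<in> sets borel"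
  shows "prob (A \<inter> (Y k (Suc m) -` B \<inter> space M)) = prob A * prob (Y k (Suc m) -` B \<inter> space M)"
proof -
  let ?J = "{1..K} \<times> {1..m}" and ?j = "(k, Suc m)"
  let ?D = "\<lambda>\<omega>. \<lambda>p\<in>{?j}. (case p of (k, i) \<Rightarrow> Y k i) \<omega>"
  have "indep_var (PiM ?J (\<lambda>_. borel)) (draws m) (PiM {?j} (\<lambda>_. borel)) ?D"
    unfolding draws_def using indep by (rule indep_var_restrict) (use k in auto)
  then have "indep_set (sets (past m)) (sigma_sets (space M) {?D -` B \<inter> space M | B. B \<in> sets (PiM {?j} (\<lambda>_. borel))})"
    unfolding indep_var_eq sets_past by blast
  moreover have "Y k (Suc m) -` B \<inter> space M \<in> sigma_sets (space M) {?D -` B \<inter> space M | B. B \<in> sets (PiM {?j} (\<lambda>_. borel))}"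
  proof (intro sigma_sets.Basic CollectI exI conjI)
    show "(\<lambda>f. f ?j) -` B \<inter> space (PiM {?j} (\<lambda>_. borel :: real measure)) \<in> sets (PiM {?j} (\<lambda>_. borel))"
      using B by (intro measurable_sets[OF measurable_component_singleton]) auto
    show "Y k (Suc m) -` B \<inter> space M = ?D -` ((\<lambda>f. f ?j) -` B \<inter> space (PiM {?j} (\<lambda>_. borel :: real measure))) \<inter> space M"
      by (auto simp: space_PiM PiE_def)
  qed
  ultimately show ?thesis
    using A unfolding indep_sets2_eq by blast
qed

text \<open>\<open>indep_var\<close> requires both variables to have the same type, hence the formulation through
  product measures.\<close>

lemma pair_law:
  assumes k: "k \<in> {1..K}" and Z: "Z \<in> measurable (past m) N"
  shows "distr M N Z \<Otimes>\<^sub>M law k = distr M (N \<Otimes>\<^sub>M borel) (\<lambda>\<omega>. (Z \<omega>, Y k (Suc m) \<omega>))"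
proof (rule pair_measure_eqI)
  have [measurable]: "Z \<in> measurable M N" by (rule past_measurable[OF Z])
  have [measurable]: "Y k (Suc m) \<in> borel_measurable M" by (rule Y_measurable) (use k in auto)
  have l: "law k = distr M borel (Y k (Suc m))" using k by (simp add: distr_Y)
  interpret Z: prob_space "distr M N Z" by (rule prob_space_distr) measurable
  interpret L: prob_space "law k" using law_props(1)[OF k] by (simp add: arm_def)
  show "sigma_finite_measure (distr M N Z)" "sigma_finite_measure (law k)"
    by unfold_locales
  show "sets (distr M N Z \<Otimes>\<^sub>M law k) = sets (distr M (N \<Otimes>\<^sub>M borel) (\<lambda>\<omega>. (Z \<omega>, Y k (Suc m) \<omega>)))"
    unfolding l by (simp cong: sets_pair_measure_cong)
  fix A B assume AB: "A \<in> sets (distr M N Z)" "B \<in> sets (law k)"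
  then have [measurable]: "A \<in> sets N" "B \<in> sets borel" by (auto simp: law_def)
  have "emeasure (distr M N Z) A * emeasure (law k) B
      = ennreal (prob (Z -` A \<inter> space M) * prob (Y k (Suc m) -` B \<inter> space M))"
    unfolding l by (simp add: emeasure_distr emeasure_eq_measure ennreal_mult)
  also have "\<dots> = prob ((Z -` A \<inter> space M) \<inter> (Y k (Suc m) -` B \<inter> space M))"
    using prob_past_draw[OF k measurable_sets[OF Z], of A B] by simp
  also have "(Z -` A \<inter> space M) \<inter> (Y k (Suc m) -` B \<inter> space M)
      = (\<lambda>\<omega>. (Z \<omega>, Y k (Suc m) \<omega>)) -` (A \<times> B) \<inter> space M" by auto
  also have "ennreal (prob \<dots>) = emeasure (distr M (N \<Otimes>\<^sub>M borel) (\<lambda>\<omega>. (Z \<omega>, Y k (Suc m) \<omega>))) (A \<times> B)"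
    by (simp add: emeasure_distr emeasure_eq_measure)
  finally show "emeasure (distr M N Z) A * emeasure (law k) B
    = emeasure (distr M (N \<Otimes>\<^sub>M borel) (\<lambda>\<omega>. (Z \<omega>, Y k (Suc m) \<omega>))) (A \<times> B)" .
qed

text \<open>The joint law is a product, so Tonelli integrates out the new draw with the past frozen.
  The nonnegative form spares integrability conditions.\<close>

lemma joint_law:
  assumes k: "k \<in> {1..K}" and Z: "Z \<in> measurable (past m) N" and h: "h \<in> borel_measurable (N \<Otimes>\<^sub>M borel)"
  shows "(\<integral>\<^sup>+\<omega>. h (Z \<omega>, Y k (Suc m) \<omega>) \<partial>M) = (\<integral>\<^sup>+\<omega>. (\<integral>\<^sup>+x. h (Z \<omega>, x) \<partial>law k) \<partial>M)"
proof -
  have [measurable]: "Z \<in> measurable M N" by (rule past_measurable[OF Z])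
  have [measurable]: "Y k (Suc m) \<in> borel_measurable M" by (rule Y_measurable) (use k in auto)
  note [measurable] = h
  interpret L: prob_space "law k" using law_props(1)[OF k] by (simp add: arm_def)
  have [measurable_cong]: "sets (law k) = sets borel" by (simp add: law_def)
  note e = pair_law[OF k Z]
  have "(\<integral>\<^sup>+\<omega>. h (Z \<omega>, Y k (Suc m) \<omega>) \<partial>M) = (\<integral>\<^sup>+v. h v \<partial>(distr M N Z \<Otimes>\<^sub>M law k))"
    unfolding e by (subst nn_integral_distr) auto
  also have "\<dots> = (\<integral>\<^sup>+z. (\<integral>\<^sup>+x. h (z, x) \<partial>law k) \<partial>distr M N Z)"
    by (subst L.nn_integral_fst[symmetric]) auto
  also have "\<dots> = (\<integral>\<^sup>+\<omega>. (\<integral>\<^sup>+x. h (Z \<omega>, x) \<partial>law k) \<partial>M)"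
    by (subst nn_integral_distr) auto
  finally show ?thesis .
qed

text \<open>The arm is random, but it takes finitely many values and is determined by the past. The
  integral splits over the events that a given arm is chosen, and on each of them the arm is
  fixed.\<close>

lemma joint_law_choice:
  fixes h :: "nat \<Rightarrow> (real \<times> real) \<times> real \<Rightarrow> ennreal"
  assumes S: "S \<subseteq> {1..K}" and \<theta>: "\<theta> \<in> measurable (past m) (count_space S)"
    and Z: "Z \<in> borel_measurable (past m)" and h: "\<And>k. k \<in> S \<Longrightarrow> h k \<in> borel_measurable (borel \<Otimes>\<^sub>M borel)"
  shows "(\<integral>\<^sup>+\<omega>. h (\<theta> \<omega>) (Z \<omega>, Y (\<theta> \<omega>) (Suc m) \<omega>) \<partial>M)
    = (\<integral>\<^sup>+\<omega>. (\<integral>\<^sup>+x. h (\<theta> \<omega>) (Z \<omega>, x) \<partial>law (\<theta> \<omega>)) \<partial>M)"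
proof -
  have fin: "finite S" using S finite_subset by blast
  have \<theta>S: "\<theta> \<omega> \<in> S" if "\<omega> \<in> space M" for \<omega>
    using measurable_space[OF \<theta>] that by simp
  have [measurable]: "\<theta> \<in> measurable M (count_space S)" "Z \<in> borel_measurable M"
    using past_measurable \<theta> Z by auto
  have split: "g (\<theta> \<omega>) = (\<Sum>k\<in>S. indicator {k} (\<theta> \<omega>) * g k)" if "\<omega> \<in> space M" for g :: "nat \<Rightarrow> ennreal" and \<omega>
    using \<theta>S[OF that] fin by (simp add: indicator_def sum.delta' if_distrib cong: if_cong)
  \<comment> \<open>The choice joins the past variable, so that its indicator can be part of the
    integrand of \<open>joint_law\<close>.\<close>
  have \<theta>Z: "(\<lambda>\<omega>. (\<theta> \<omega>, Z \<omega>)) \<in> measurable (past m) (count_space S \<Otimes>\<^sub>M borel)"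
    by (rule measurable_Pair[OF \<theta> Z])
  have meas: "(\<lambda>v. indicator {k} (fst (fst v)) * h k (snd (fst v), snd v))
      \<in> borel_measurable ((count_space S \<Otimes>\<^sub>M borel) \<Otimes>\<^sub>M borel)" if k: "k \<in> S" for k
  proof -
    have "(\<lambda>v. h k (snd (fst v), snd v)) \<in> borel_measurable ((count_space S \<Otimes>\<^sub>M borel) \<Otimes>\<^sub>M borel)"
      by (rule measurable_compose[OF _ h[OF k]]) measurable
    moreover have "(\<lambda>v. indicator {k} (fst (fst v)) :: ennreal) \<in> borel_measurable ((count_space S \<Otimes>\<^sub>M borel) \<Otimes>\<^sub>M borel)"
      by (rule measurable_compose[OF measurable_compose[OF measurable_fst measurable_fst]]) simp
    ultimately show ?thesis by (intro borel_measurable_times_ennreal)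
  qed
  have Ym: "Y k (Suc m) \<in> borel_measurable M" if "k \<in> S" for k
    using Y_measurable that S by auto
  have \<theta>k: "(\<lambda>\<omega>. indicator {k} (\<theta> \<omega>) :: ennreal) \<in> borel_measurable M" for k
    by (rule measurable_compose[OF past_measurable[OF \<theta>]]) simp
  have "(\<integral>\<^sup>+\<omega>. h (\<theta> \<omega>) (Z \<omega>, Y (\<theta> \<omega>) (Suc m) \<omega>) \<partial>M)
      = (\<integral>\<^sup>+\<omega>. (\<Sum>k\<in>S. indicator {k} (\<theta> \<omega>) * h k (Z \<omega>, Y k (Suc m) \<omega>)) \<partial>M)"
    by (intro nn_integral_cong split)
  also have "\<dots> = (\<Sum>k\<in>S. \<integral>\<^sup>+\<omega>. indicator {k} (\<theta> \<omega>) * h k (Z \<omega>, Y k (Suc m) \<omega>) \<partial>M)"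
  proof (intro nn_integral_sum)
    fix k assume k: "k \<in> S"
    have "(\<lambda>\<omega>. h k (Z \<omega>, Y k (Suc m) \<omega>)) \<in> borel_measurable M"
      using Ym[OF k] by (intro measurable_compose[OF _ h[OF k]]) measurable
    then show "(\<lambda>\<omega>. indicator {k} (\<theta> \<omega>) * h k (Z \<omega>, Y k (Suc m) \<omega>)) \<in> borel_measurable M"
      by (rule borel_measurable_times_ennreal[OF \<theta>k])
  qed
  also have "\<dots> = (\<Sum>k\<in>S. \<integral>\<^sup>+\<omega>. (\<integral>\<^sup>+x. indicator {k} (\<theta> \<omega>) * h k (Z \<omega>, x) \<partial>law k) \<partial>M)"
    using S joint_law[OF _ \<theta>Z meas] by (intro sum.cong refl) (fastforce)
  also have "\<dots> = (\<Sum>k\<in>S. \<integral>\<^sup>+\<omega>. indicator {k} (\<theta> \<omega>) * (\<integral>\<^sup>+x. h k (Z \<omega>, x) \<partial>law k) \<partial>M)"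
  proof (intro sum.cong refl nn_integral_cong nn_integral_cmult)
    fix k \<omega> assume k: "k \<in> S"
    have [measurable_cong]: "sets (law k) = sets borel" by (simp add: law_def)
    show "(\<lambda>x. h k (Z \<omega>, x)) \<in> borel_measurable (law k)"
      by (rule measurable_compose[OF _ h[OF k]]) measurable
  qed
  also have "\<dots> = (\<integral>\<^sup>+\<omega>. (\<Sum>k\<in>S. indicator {k} (\<theta> \<omega>) * (\<integral>\<^sup>+x. h k (Z \<omega>, x) \<partial>law k)) \<partial>M)"
  proof (intro nn_integral_sum[symmetric])
    fix k assume k: "k \<in> S"
    interpret L: prob_space "law k" using law_props(1) k S by (auto simp: arm_def)
    have [measurable_cong]: "sets (law k) = sets borel" by (simp add: law_def)
    have "(\<lambda>(\<omega>, x). h k (Z \<omega>, x)) \<in> borel_measurable (M \<Otimes>\<^sub>M law k)"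
      unfolding split_beta by (rule measurable_compose[OF _ h[OF k]]) measurable
    then have "(\<lambda>\<omega>. \<integral>\<^sup>+x. h k (Z \<omega>, x) \<partial>law k) \<in> borel_measurable M"
      using L.borel_measurable_nn_integral_fst[of "\<lambda>(\<omega>, x). h k (Z \<omega>, x)" M] by simp
    then show "(\<lambda>\<omega>. indicator {k} (\<theta> \<omega>) * (\<integral>\<^sup>+x. h k (Z \<omega>, x) \<partial>law k)) \<in> borel_measurable M"
      by (rule borel_measurable_times_ennreal[OF \<theta>k])
  qed
  also have "\<dots> = (\<integral>\<^sup>+\<omega>. (\<integral>\<^sup>+x. h (\<theta> \<omega>) (Z \<omega>, x) \<partial>law (\<theta> \<omega>)) \<partial>M)"
    by (intro nn_integral_cong split[symmetric])
  finally show ?thesis .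
qed

end

section \<open>Strategies and dynamic programming\<close>

context bandit
begin

lemma space_history [simp]: "space (history M Y \<theta> m) = space M"
  unfolding history_def by (rule space_measure_of_conv)

lemma sets_history: "sets (history M Y \<theta> m) = sigma_sets (space M)
     ((\<Union>i\<in>{1..m}. {reward Y \<theta> i -` B \<inter> space M | B. B \<in> sets borel})
      \<union> (\<Union>i\<in>{1..m}. {\<theta> i -` C \<inter> space M | C. C \<in> sets (count_space UNIV)}))"
  unfolding history_def by (rule sets_measure_of) auto

lemma history_reward: "i \<in> {1..m} \<Longrightarrow> reward Y \<theta> i \<in> borel_measurable (history M Y \<theta> m)"
  by (intro measurableI) (auto simp: sets_history intro!: sigma_sets.Basic)

lemma history_choice: "i \<in> {1..m} \<Longrightarrow> \<theta> i \<in> measurable (history M Y \<theta> m) (count_space UNIV)"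
  by (rule measurableI)
    (auto simp del: atLeastAtMost_iff simp: sets_history intro!: sigma_sets.Basic UnI2 UN_I[of i])

lemma history_id:
  assumes "space N = space M" "\<And>i. i \<in> {1..m} \<Longrightarrow> reward Y \<theta> i \<in> borel_measurable N"
    "\<And>i. i \<in> {1..m} \<Longrightarrow> \<theta> i \<in> measurable N (count_space UNIV)"
  shows "(\<lambda>x. x) \<in> measurable N (history M Y \<theta> m)"
  unfolding history_def
proof (rule measurable_measure_of)
  fix y assume "y \<in> (\<Union>i\<in>{1..m}. {reward Y \<theta> i -` B \<inter> space M | B. B \<in> sets borel})
    \<union> (\<Union>i\<in>{1..m}. {\<theta> i -` C \<inter> space M | C. C \<in> sets (count_space UNIV)})"
  then show "(\<lambda>x. x) -` y \<inter> space N \<in> sets N"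
    using measurable_sets[OF assms(2)] measurable_sets[OF assms(3)] by (auto simp: assms(1) Int_assoc)
qed (use assms(1) in auto)

lemma reward_measurable:
  assumes "\<theta> i \<in> measurable N (count_space S)" "countable S" "\<And>k. k \<in> S \<Longrightarrow> Y k i \<in> borel_measurable N"
  shows "reward Y \<theta> i \<in> borel_measurable N"
proof -
  have "(\<lambda>\<omega>. Y (\<theta> i \<omega>) i \<omega>) \<in> borel_measurable N"
    by (rule measurable_compose_countable'[OF assms(3,1,2)])
  then show ?thesis by (simp add: reward_def[abs_def])
qed

text \<open>Conditional means are replaced by the means of the arms played. The two agree almost
  everywhere, but this version is defined pointwise, and its increments depend only on the arm and
  the draw.\<close>

definition state :: "(nat \<Rightarrow> 'a \<Rightarrow> nat) \<Rightarrow> nat \<Rightarrow> nat \<Rightarrow> 'a \<Rightarrow> real \<times> real" where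
  "state \<theta> n i \<omega> = ((\<Sum>j=1..i. amean (law (\<theta> j \<omega>)) / real n),
     (\<Sum>j=1..i. (reward Y \<theta> j \<omega> - amean (law (\<theta> j \<omega>))) / sqrt (real n)))"

lemma state_0 [simp]: "state \<theta> n 0 \<omega> = (0, 0)"
  by (simp add: state_def)

lemma state_Suc: "state \<theta> n (Suc i) \<omega> = state \<theta> n i \<omega> + (amean (law (\<theta> (Suc i) \<omega>)) / real n,
    (Y (\<theta> (Suc i) \<omega>) (Suc i) \<omega> - amean (law (\<theta> (Suc i) \<omega>))) / sqrt (real n))"
  by (simp add: state_def reward_def)

text \<open>Consequently a choice at stage \<open>Suc i\<close> that is a measurable function of
  \<open>state \<theta> n i\<close> respects the information constraint of admissibility.\<close>

lemma state_history: "state \<theta> n i \<in> borel_measurable (history M Y \<theta> i)"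
proof -
  have m: "(\<lambda>\<omega>. amean (law (\<theta> j \<omega>))) \<in> borel_measurable (history M Y \<theta> i)" if "j \<in> {1..i}" for j
    by (rule measurable_compose[OF history_choice[OF that]]) simp
  show ?thesis
    unfolding state_def[abs_def]
    by (intro borel_measurable_Pair borel_measurable_sum borel_measurable_divide borel_measurable_diff
        m history_reward borel_measurable_const)
qed

end

section \<open>The state process of a fixed admissible strategy\<close>

locale strategy = bandit +
  fixes S :: "nat set" and \<theta> :: "nat \<Rightarrow> 'a \<Rightarrow> nat"
  assumes S: "S \<subseteq> {1..K}" and \<theta>: "\<theta> \<in> admissible M S Y"
begin

lemma countable_S: "countable S"
  using S finite_subset by (blast intro: countable_finite)

text \<open>The history is generated by the strategy itself, which calls for strong induction: the
  choice at stage \<open>i\<close> is measurable for the history up to \<open>i - 1\<close>, hence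
  for the past by induction, and the reward then selects measurably among the draws of stage
  \<open>i\<close>.\<close>

lemma past_history_id: "(\<lambda>x. x) \<in> measurable (past m) (history M Y \<theta> m)"
proof (induction m rule: less_induct)
  case (less m)
  have c: "\<theta> i \<in> measurable (past m) (count_space S)" if i: "i \<in> {1..m}" for i
  proof -
    have "\<theta> i \<in> measurable (history M Y \<theta> (i - 1)) (count_space S)"
      using \<theta> i by (auto simp: admissible_def)
    moreover have "i - 1 < m" using i by auto
    ultimately have "\<theta> i \<in> measurable (past (i - 1)) (count_space S)"
      by (rule measurable_compose[OF less.IH, rotated])
    then show ?thesis by (rule past_mono[rotated]) (use i in auto)
  qed
  show ?case
  proof (rule history_id)
    fix i assume i: "i \<in> {1..m}"
    show "reward Y \<theta> i \<in> borel_measurable (past m)"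
      by (rule reward_measurable[of \<theta>, OF c[OF i] countable_S]) (use S i in \<open>auto intro!: Y_past\<close>)
    show "\<theta> i \<in> measurable (past m) (count_space UNIV)"
      using measurable_compose[OF c[OF i], of "\<lambda>x. x" "count_space UNIV"] by simp
  qed simp
qed

lemma history_past: "f \<in> measurable (history M Y \<theta> m) R \<Longrightarrow> f \<in> measurable (past m) R"
  by (rule measurable_compose[OF past_history_id])

lemma choice_past: "\<theta> (Suc m) \<in> measurable (past m) (count_space S)"
proof -
  have "\<theta> (Suc m) \<in> measurable (history M Y \<theta> m) (count_space S)"
    using \<theta> by (fastforce simp: admissible_def)
  then show ?thesis by (rule history_past)
qed

lemma choice_in: "\<omega> \<in> space M \<Longrightarrow> \<theta> (Suc m) \<omega> \<in> S"
  using measurable_space[OF choice_past] by simp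

lemma state_past: "state \<theta> n i \<in> borel_measurable (past i)"
  by (rule history_past[OF state_history])

lemma state_measurable: "state \<theta> n i \<in> borel_measurable M"
  by (rule past_measurable[OF state_past])

lemma choice_measurable: "\<theta> (Suc m) \<in> measurable M (count_space S)"
  by (rule past_measurable[OF choice_past])

lemma armS: "k \<in> S \<Longrightarrow> arm (law k)"
  using S law_props by auto

lemma nn_state_step:
  assumes \<phi>: "\<phi> \<in> borel_measurable borel"
  shows "(\<integral>\<^sup>+\<omega>. \<phi> (state \<theta> n (Suc i) \<omega>) \<partial>M)
    = (\<integral>\<^sup>+\<omega>. (\<integral>\<^sup>+v. \<phi> (state \<theta> n i \<omega> + v) \<partial>increment_law (law (\<theta> (Suc i) \<omega>)) n) \<partial>M)"
proof -
  define h where "h k = (\<lambda>(z, x). \<phi> (z + (amean (law k) / real n, (x - amean (law k)) / sqrt (real n))))" for k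
  have h: "h k \<in> borel_measurable (borel \<Otimes>\<^sub>M borel)" for k
    unfolding h_def split_beta by (rule measurable_compose[OF _ \<phi>]) measurable
  have "(\<integral>\<^sup>+\<omega>. \<phi> (state \<theta> n (Suc i) \<omega>) \<partial>M)
      = (\<integral>\<^sup>+\<omega>. h (\<theta> (Suc i) \<omega>) (state \<theta> n i \<omega>, Y (\<theta> (Suc i) \<omega>) (Suc i) \<omega>) \<partial>M)"
    by (simp add: h_def state_Suc)
  also have "\<dots> = (\<integral>\<^sup>+\<omega>. (\<integral>\<^sup>+x. h (\<theta> (Suc i) \<omega>) (state \<theta> n i \<omega>, x) \<partial>law (\<theta> (Suc i) \<omega>)) \<partial>M)"
    by (rule joint_law_choice[OF S choice_past state_past h])
  also have "\<dots> = (\<integral>\<^sup>+\<omega>. (\<integral>\<^sup>+v. \<phi> (state \<theta> n i \<omega> + v) \<partial>increment_law (law (\<theta> (Suc i) \<omega>)) n) \<partial>M)"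
  proof (rule nn_integral_cong)
    fix \<omega> assume "\<omega> \<in> space M"
    have "(\<lambda>v. \<phi> (state \<theta> n i \<omega> + v)) \<in> borel_measurable borel"
      by (rule measurable_compose[OF _ \<phi>]) measurable
    then show "(\<integral>\<^sup>+x. h (\<theta> (Suc i) \<omega>) (state \<theta> n i \<omega>, x) \<partial>law (\<theta> (Suc i) \<omega>))
        = (\<integral>\<^sup>+v. \<phi> (state \<theta> n i \<omega> + v) \<partial>increment_law (law (\<theta> (Suc i) \<omega>)) n)"
      unfolding increment_law_def h_def
      using increment_law_measurable[OF armS[OF choice_in[OF \<open>\<omega> \<in> space M\<close>]]]
      by (subst nn_integral_distr) auto
  qed
  finally show ?thesis .
qed

lemma state_step:
  assumes "modulus B w" "bduc B w h"
  shows "expectation (\<lambda>\<omega>. h (state \<theta> n (Suc i) \<omega>))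
      = expectation (\<lambda>\<omega>. avg (increment_law (law (\<theta> (Suc i) \<omega>)) n) h (state \<theta> n i \<omega>))"
    "integrable M (\<lambda>\<omega>. h (state \<theta> n i \<omega>))"
    "integrable M (\<lambda>\<omega>. avg (increment_law (law (\<theta> (Suc i) \<omega>)) n) h (state \<theta> n i \<omega>))"
proof -
  note [measurable] = bduc_measurable[OF assms] state_measurable
  show int: "integrable M (\<lambda>\<omega>. h (state \<theta> n i \<omega>))" for i
    by (rule integrable_const_bound[where B=B]) (auto intro: bduc_bound[OF assms(2)])
  have ua: "bduc B w (avg (increment_law (law k) n) h)" if "k \<in> S" for k
    by (rule avg_bduc[OF assms plane_prob_increment_law[OF armS[OF that]]])
  show inta: "integrable M (\<lambda>\<omega>. avg (increment_law (law (\<theta> (Suc i) \<omega>)) n) h (state \<theta> n i \<omega>))"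
  proof (rule integrable_const_bound[where B=B])
    show "AE \<omega> in M. norm (avg (increment_law (law (\<theta> (Suc i) \<omega>)) n) h (state \<theta> n i \<omega>)) \<le> B"
      using bduc_bound[OF ua[OF choice_in]] by (intro AE_I2) simp
    have "(\<lambda>\<omega>. avg (increment_law (law k) n) h (state \<theta> n i \<omega>)) \<in> borel_measurable M" if "k \<in> S" for k
      by (rule measurable_compose[OF state_measurable bduc_measurable[OF assms(1) ua[OF that]]])
    then show "(\<lambda>\<omega>. avg (increment_law (law (\<theta> (Suc i) \<omega>)) n) h (state \<theta> n i \<omega>)) \<in> borel_measurable M"
      by (rule measurable_compose_countable'[OF _ choice_measurable countable_S])
  qed
  \<comment> \<open>Adding \<open>B\<close> makes the integrand nonnegative, so that
    \<open>nn_state_step\<close> applies; the shift is removed at the end.\<close>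
  have B: "0 \<le> h z + B" for z using bduc_bound[OF assms(2), of z] by linarith
  have "ennreal (expectation (\<lambda>\<omega>. h (state \<theta> n (Suc i) \<omega>)) + B)
      = (\<integral>\<^sup>+\<omega>. ennreal (h (state \<theta> n (Suc i) \<omega>) + B) \<partial>M)"
    using int B by (subst nn_integral_eq_integral) (auto simp: prob_space)
  also have "\<dots> = (\<integral>\<^sup>+\<omega>. (\<integral>\<^sup>+v. ennreal (h (state \<theta> n i \<omega> + v) + B) \<partial>increment_law (law (\<theta> (Suc i) \<omega>)) n) \<partial>M)"
    by (rule nn_state_step[of "\<lambda>z. ennreal (h z + B)"]) measurable
  also have "\<dots> = (\<integral>\<^sup>+\<omega>. ennreal (avg (increment_law (law (\<theta> (Suc i) \<omega>)) n) h (state \<theta> n i \<omega>) + B) \<partial>M)"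
  proof (rule nn_integral_cong)
    fix \<omega> assume \<omega>: "\<omega> \<in> space M"
    let ?p = "increment_law (law (\<theta> (Suc i) \<omega>)) n"
    have plane_prob: "plane_prob ?p" by (rule plane_prob_increment_law[OF armS[OF choice_in[OF \<omega>]]])
    then interpret p: prob_space ?p by (simp add: plane_prob_def)
    note I = bduc_integrable[OF assms plane_prob]
    show "(\<integral>\<^sup>+v. ennreal (h (state \<theta> n i \<omega> + v) + B) \<partial>?p) = ennreal (avg ?p h (state \<theta> n i \<omega>) + B)"
      using I B by (subst nn_integral_eq_integral) (auto simp: p.prob_space avg_def)
  qed
  also have "\<dots> = ennreal (expectation (\<lambda>\<omega>. avg (increment_law (law (\<theta> (Suc i) \<omega>)) n) h (state \<theta> n i \<omega>)) + B)"
  proof -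
    have "AE \<omega> in M. 0 \<le> avg (increment_law (law (\<theta> (Suc i) \<omega>)) n) h (state \<theta> n i \<omega>) + B"
    proof (rule AE_I2)
      fix \<omega> assume "\<omega> \<in> space M"
      from bduc_bound[OF ua[OF choice_in[OF this]], of i "state \<theta> n i \<omega>"]
      show "0 \<le> avg (increment_law (law (\<theta> (Suc i) \<omega>)) n) h (state \<theta> n i \<omega>) + B" by linarith
    qed
    then show ?thesis using inta by (subst nn_integral_eq_integral) (auto simp: prob_space)
  qed
  finally have eq: "ennreal (expectation (\<lambda>\<omega>. h (state \<theta> n (Suc i) \<omega>)) + B)
    = ennreal (expectation (\<lambda>\<omega>. avg (increment_law (law (\<theta> (Suc i) \<omega>)) n) h (state \<theta> n i \<omega>)) + B)" .
  \<comment> \<open>Both expectations are at least \<open>- B\<close>, so the shifted values are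
    nonnegative and \<open>ennreal\<close> is injective on them.\<close>
  have "\<bar>expectation f\<bar> \<le> B" if f: "integrable M f" "\<And>\<omega>. \<omega> \<in> space M \<Longrightarrow> \<bar>f \<omega>\<bar> \<le> B" for f
  proof -
    have "\<bar>expectation f\<bar> \<le> expectation (\<lambda>\<omega>. \<bar>f \<omega>\<bar>)" by simp
    also have "\<dots> \<le> expectation (\<lambda>\<omega>. B)" by (intro integral_mono) (use f in auto)
    finally show ?thesis by (simp add: prob_space)
  qed
  from this[OF int bduc_bound[OF assms(2)], of "Suc i"] this[OF inta bduc_bound[OF ua[OF choice_in]]]
  show "expectation (\<lambda>\<omega>. h (state \<theta> n (Suc i) \<omega>))
      = expectation (\<lambda>\<omega>. avg (increment_law (law (\<theta> (Suc i) \<omega>)) n) h (state \<theta> n i \<omega>))"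
    using eq by (subst (asm) ennreal_inj) (auto simp: abs_le_iff)
qed

text \<open>The value with \<open>n - i\<close> stages to go, evaluated at the state after
  \<open>i\<close> stages, has nonincreasing expectation in \<open>i\<close>, because the Bellman
  operator dominates the average of the arm actually chosen.\<close>

lemma value_upper:
  assumes "modulus B w" "bduc B w f" "S \<noteq> {}"
  shows "expectation (\<lambda>\<omega>. f (state \<theta> n n \<omega>)) \<le> (bellman S law n ^^ n) f (0, 0)"
proof -
  interpret arms S law
    using assms(3) armS S by unfold_locales (auto intro: finite_subset)
  have "expectation (\<lambda>\<omega>. (bellman S law n ^^ (n - i)) f (state \<theta> n i \<omega>)) \<le> (bellman S law n ^^ n) f (0, 0)"
    if "i \<le> n" for i
    using that
  proof (induction i)
    case (Suc i)
    let ?w = "\<lambda>j. (bellman S law n ^^ j) f"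
    note u = iter_bduc[OF assms(1,2)]
    have j: "n - i = Suc (n - Suc i)" using Suc.prems by simp
    have "expectation (\<lambda>\<omega>. ?w (n - Suc i) (state \<theta> n (Suc i) \<omega>))
        = expectation (\<lambda>\<omega>. avg (increment_law (law (\<theta> (Suc i) \<omega>)) n) (?w (n - Suc i)) (state \<theta> n i \<omega>))"
      by (rule state_step(1)[OF assms(1) u])
    also have "\<dots> \<le> expectation (\<lambda>\<omega>. ?w (n - i) (state \<theta> n i \<omega>))"
    proof (intro integral_mono state_step(2,3)[OF assms(1) u])
      fix \<omega> assume "\<omega> \<in> space M"
      from bellman_ge[OF choice_in[OF this]]
      show "avg (increment_law (law (\<theta> (Suc i) \<omega>)) n) (?w (n - Suc i)) (state \<theta> n i \<omega>) \<le> ?w (n - i) (state \<theta> n i \<omega>)"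
        unfolding j by simp
    qed
    also have "\<dots> \<le> ?w n (0, 0)" using Suc by simp
    finally show ?case .
  qed (simp add: prob_space)
  from this[of n] show ?thesis by simp
qed

text \<open>For \<open>A\<close> in the history, the indicator of \<open>A\<close> and of the choice
  of arm \<open>k\<close> belongs to the past, so it is independent of \<open>Y k (Suc m)\<close>
  and the expectation of the product factorizes. Summing over the arms verifies the defining
  property of conditional expectation.\<close>

lemma cond_exp_reward:
  "AE \<omega> in M. real_cond_exp M (history M Y \<theta> m) (reward Y \<theta> (Suc m)) \<omega> = amean (law (\<theta> (Suc m) \<omega>))"
proof -
  have fin: "finite S" using S finite_subset by blast
  have sub: "subalgebra M (history M Y \<theta> m)"
    unfolding subalgebra_def
  proof
    show "sets (history M Y \<theta> m) \<subseteq> events"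
    proof
      fix A assume "A \<in> sets (history M Y \<theta> m)"
      \<comment> \<open>The inclusion of the history in the past is available for measurable
        functions, so the set is passed on through its indicator.\<close>
      then have "(indicator A :: 'a \<Rightarrow> real) \<in> borel_measurable (history M Y \<theta> m)" by simp
      from borel_measurable_indicator_iff[THEN iffD1, OF past_measurable[OF history_past[OF this]]]
      show "A \<in> events" using \<open>A \<in> sets (history M Y \<theta> m)\<close> sets.sets_into_space by (fastforce simp: Int_absorb2)
    qed
  qed simp
  interpret sigma_finite_subalgebra M "history M Y \<theta> m"
    by (rule finite_measure_subalgebra_is_sigma_finite)
      (intro finite_measure_subalgebra.intro finite_measure_subalgebra_axioms.intro sub; unfold_locales)
  let ?r = "reward Y \<theta> (Suc m)"
  note lp = law_props[OF subsetD[OF S]]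
  have Yi: "integrable M (Y k (Suc m))" "expectation (Y k (Suc m)) = amean (law k)" if k: "k \<in> S" for k
  proof -
    have kK: "k \<in> {1..K}" using k S by auto
    have Ym: "Y k (Suc m) \<in> borel_measurable M" by (rule Y_measurable[OF kK]) simp
    have l: "law k = distr M borel (Y k (Suc m))" using kK by (simp add: distr_Y)
    show "integrable M (Y k (Suc m))"
      using arm_integrable(1)[OF armS[OF k]] Ym unfolding l by (subst (asm) integrable_distr_eq) auto
    show "expectation (Y k (Suc m)) = amean (law k)"
      unfolding amean_def l using Ym by (subst integral_distr) auto
  qed
  have ind: "expectation (\<lambda>\<omega>. indicator A \<omega> * (indicator {k} (\<theta> (Suc m) \<omega>) * Y k (Suc m) \<omega>))
      = expectation (\<lambda>\<omega>. indicator A \<omega> * (indicator {k} (\<theta> (Suc m) \<omega>) * amean (law k)))"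
    "integrable M (\<lambda>\<omega>. indicator A \<omega> * (indicator {k} (\<theta> (Suc m) \<omega>) * Y k (Suc m) \<omega>))"
    "integrable M (\<lambda>\<omega>. indicator A \<omega> * (indicator {k} (\<theta> (Suc m) \<omega>) * amean (law k)))"
    if A: "A \<in> sets (history M Y \<theta> m)" and k: "k \<in> S" for A k
  proof -
    let ?G = "\<lambda>\<omega>. indicator A \<omega> * indicator {k} (\<theta> (Suc m) \<omega>) :: real"
    have kK: "k \<in> {1..K}" using k S by auto
    have [measurable]: "(\<lambda>\<omega>. indicator {k} (\<theta> (Suc m) \<omega>) :: real) \<in> borel_measurable (past m)"
      by (rule measurable_compose[OF choice_past]) simp
    have [measurable]: "(indicator A :: 'a \<Rightarrow> real) \<in> borel_measurable (past m)"
      using A by (intro history_past) simp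
    have G: "?G \<in> borel_measurable (past m)" by measurable
    have iG: "integrable M ?G"
      by (rule integrable_const_bound[where B=1]) (auto intro: past_measurable[OF G] split: split_indicator)
    have iv: "indep_var borel ?G borel (Y k (Suc m))"
      unfolding indep_var_distribution_eq using pair_law[OF kK G] past_measurable[OF G] Y_measurable[OF kK] kK
      by (simp add: distr_Y)
    show "expectation (\<lambda>\<omega>. indicator A \<omega> * (indicator {k} (\<theta> (Suc m) \<omega>) * Y k (Suc m) \<omega>))
      = expectation (\<lambda>\<omega>. indicator A \<omega> * (indicator {k} (\<theta> (Suc m) \<omega>) * amean (law k)))"
      using indep_var_lebesgue_integral[OF iv iG Yi(1)[OF k]] Yi(2)[OF k]
      by (simp add: mult.assoc[symmetric])
    show "integrable M (\<lambda>\<omega>. indicator A \<omega> * (indicator {k} (\<theta> (Suc m) \<omega>) * Y k (Suc m) \<omega>))"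
      using indep_var_integrable[OF iv iG Yi(1)[OF k]] by (simp add: mult.assoc)
    show "integrable M (\<lambda>\<omega>. indicator A \<omega> * (indicator {k} (\<theta> (Suc m) \<omega>) * amean (law k)))"
      using iG by (simp add: mult.assoc[symmetric])
  qed
  have split: "g (\<theta> (Suc m) \<omega>) = (\<Sum>k\<in>S. indicator {k} (\<theta> (Suc m) \<omega>) * g k)"
    if "\<omega> \<in> space M" for g :: "nat \<Rightarrow> real" and \<omega>
    using choice_in[OF that] fin by (simp add: indicator_def sum.delta' if_distrib cong: if_cong)
  have sr: "indicator A \<omega> * ?r \<omega> = (\<Sum>k\<in>S. indicator A \<omega> * (indicator {k} (\<theta> (Suc m) \<omega>) * Y k (Suc m) \<omega>))"
    if "\<omega> \<in> space M" for \<omega> and A :: "'a set"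
    using split[OF that, of "\<lambda>k. Y k (Suc m) \<omega>"] by (simp add: reward_def sum_distrib_left)
  have sm: "indicator A \<omega> * amean (law (\<theta> (Suc m) \<omega>))
      = (\<Sum>k\<in>S. indicator A \<omega> * (indicator {k} (\<theta> (Suc m) \<omega>) * amean (law k)))"
    if "\<omega> \<in> space M" for \<omega> and A :: "'a set"
    using split[OF that, of "\<lambda>k. amean (law k)"] by (simp add: sum_distrib_left)
  have ir: "integrable M (\<lambda>\<omega>. indicator A \<omega> * ?r \<omega>)" if "A \<in> sets (history M Y \<theta> m)" for A
    by (subst Bochner_Integration.integrable_cong[OF refl sr]) (auto intro!: ind(2) that)
  have im: "integrable M (\<lambda>\<omega>. indicator A \<omega> * amean (law (\<theta> (Suc m) \<omega>)))" if "A \<in> sets (history M Y \<theta> m)" for A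
    by (subst Bochner_Integration.integrable_cong[OF refl sm]) (auto intro!: ind(3) that)
  \<comment> \<open>With \<open>A\<close> the whole space, \<open>ir\<close> and \<open>im\<close>
    give the integrability of the two functions themselves.\<close>
  have top: "space M \<in> sets (history M Y \<theta> m)" using sets.top[of "history M Y \<theta> m"] by simp
  show ?thesis
  proof (rule real_cond_exp_charact)
    fix A assume A: "A \<in> sets (history M Y \<theta> m)"
    have "expectation (\<lambda>\<omega>. indicator A \<omega> * ?r \<omega>)
        = (\<Sum>k\<in>S. expectation (\<lambda>\<omega>. indicator A \<omega> * (indicator {k} (\<theta> (Suc m) \<omega>) * Y k (Suc m) \<omega>)))"
      by (subst Bochner_Integration.integral_cong[OF refl sr]) (auto intro!: Bochner_Integration.integral_sum ind(2) A)
    also have "\<dots> = (\<Sum>k\<in>S. expectation (\<lambda>\<omega>. indicator A \<omega> * (indicator {k} (\<theta> (Suc m) \<omega>) * amean (law k))))"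
      by (intro sum.cong refl ind(1) A)
    also have "\<dots> = expectation (\<lambda>\<omega>. indicator A \<omega> * amean (law (\<theta> (Suc m) \<omega>)))"
      by (subst Bochner_Integration.integral_cong[OF refl sm]) (auto intro!: Bochner_Integration.integral_sum[symmetric] ind(3) A)
    finally show "(LINT \<omega>:A|M. ?r \<omega>) = (LINT \<omega>:A|M. amean (law (\<theta> (Suc m) \<omega>)))"
      by (simp add: set_lebesgue_integral_def)
  next
    show "integrable M ?r"
      by (subst Bochner_Integration.integrable_cong[OF refl, of _ _ "\<lambda>\<omega>. indicator (space M) \<omega> * ?r \<omega>"]) (auto intro!: ir top)
    show "integrable M (\<lambda>\<omega>. amean (law (\<theta> (Suc m) \<omega>)))"
      by (subst Bochner_Integration.integrable_cong[OF refl, of _ _ "\<lambda>\<omega>. indicator (space M) \<omega> * amean (law (\<theta> (Suc m) \<omega>))"]) (auto intro!: im top)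
    have "\<theta> (Suc m) \<in> measurable (history M Y \<theta> m) (count_space S)"
      using \<theta> by (fastforce simp: admissible_def)
    then show "(\<lambda>\<omega>. amean (law (\<theta> (Suc m) \<omega>))) \<in> borel_measurable (history M Y \<theta> m)"
      by (rule measurable_compose) simp
  qed
qed

end

section \<open>Moments of the state\<close>

text \<open>Second-order Taylor formula in \<open>d\<close>; the inequality \<open>1 + (y +
  t)\<^sup>2 \<le> 2 * (1 + y\<^sup>2) * (1 + t\<^sup>2)\<close> separates \<open>y\<close> from the
  intermediate point. The linear term is kept exactly because it has mean zero for a centred
  \<open>d\<close>. The quadratic term is relaxed to a multiple of
  \<open>(1 + y\<^sup>2) powr q\<close>, so that the estimate can be iterated.\<close>

lemma growth_taylor:
  fixes y d q :: real
  assumes "1 \<le> q"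
  shows "(1 + (y + d)\<^sup>2) powr q \<le> (1 + y\<^sup>2) powr q + 2 * q * y * (1 + y\<^sup>2) powr (q - 1) * d
    + q * (2 * q - 1) * 2 powr (q - 1) * (1 + y\<^sup>2) powr q * (d\<^sup>2 * (1 + d\<^sup>2) powr (q - 1))"
proof -
  have pos: "0 < 1 + t\<^sup>2" for t :: real by (simp add: add_pos_nonneg)
  have dp: "((\<lambda>t. (1 + (y + t)\<^sup>2) powr p) has_real_derivative p * (1 + (y + t)\<^sup>2) powr (p - 1) * (2 * (y + t))) (at t)"
    for p t
  proof -
    have "((\<lambda>t. 1 + (y + t)\<^sup>2) has_real_derivative 2 * (y + t)) (at t)"
      by (auto intro!: derivative_eq_intros)
    from DERIV_fun_powr[OF this pos, of p] show ?thesis by simp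
  qed
  define D where "D m t = (if m = 0 then (1 + (y + t)\<^sup>2) powr q
      else if m = 1 then 2 * q * (y + t) * (1 + (y + t)\<^sup>2) powr (q - 1)
      else 2 * q * (1 + (y + t)\<^sup>2) powr (q - 1) + 4 * q * (q - 1) * (y + t)\<^sup>2 * (1 + (y + t)\<^sup>2) powr (q - 2))"
    for m :: nat and t
  have "\<exists>t. \<bar>t\<bar> \<le> \<bar>d\<bar> \<and> (1 + (y + d)\<^sup>2) powr q = (\<Sum>m<2. D m 0 / fact m * d ^ m) + D 2 t / fact 2 * d ^ 2"
  proof (rule Maclaurin_bi_le, goal_cases)
    case 2
    show ?case
    proof (intro allI impI)
      fix m :: nat and t :: real assume "m < 2 \<and> \<bar>t\<bar> \<le> \<bar>d\<bar>"
      then consider "m = 0" | "m = 1" by fastforce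
      then show "(D m has_real_derivative D (Suc m) t) (at t)"
      proof cases
        case 1
        show ?thesis
          using dp[of q t] unfolding D_def 1 by (simp add: mult_ac)
      next
        case 2
        have "((\<lambda>t. 2 * q * (y + t)) has_real_derivative 2 * q) (at t)"
          by (auto intro!: derivative_eq_intros)
        note DERIV_mult[OF this dp[of "q - 1" t]]
        moreover have "2 * q * G + (q - 1) * H * (2 * a) * (2 * q * a) = 2 * q * G + 4 * q * (q - 1) * a\<^sup>2 * H"
          for G H a :: real by (simp add: power2_eq_square algebra_simps)
        moreover have "q - 1 - 1 = q - 2" by simp
        ultimately have "((\<lambda>t. 2 * q * (y + t) * (1 + (y + t)\<^sup>2) powr (q - 1)) has_real_derivative
          2 * q * (1 + (y + t)\<^sup>2) powr (q - 1) + 4 * q * (q - 1) * (y + t)\<^sup>2 * (1 + (y + t)\<^sup>2) powr (q - 2)) (at t)"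
          by (simp only:)
        then show ?thesis
          unfolding D_def 2 by simp
      qed
    qed
  qed (auto simp: D_def)
  then obtain t where t: "\<bar>t\<bar> \<le> \<bar>d\<bar>" "(1 + (y + d)\<^sup>2) powr q = (1 + y\<^sup>2) powr q
      + 2 * q * y * (1 + y\<^sup>2) powr (q - 1) * d + D 2 t / 2 * d\<^sup>2"
    by (auto simp: D_def numeral_2_eq_2)
  have "(y + t)\<^sup>2 * (1 + (y + t)\<^sup>2) powr (q - 2) \<le> (1 + (y + t)\<^sup>2) * (1 + (y + t)\<^sup>2) powr (q - 2)"
    by (intro mult_right_mono) auto
  also have "\<dots> = (1 + (y + t)\<^sup>2) powr (q - 1)"
    using pos[of "y + t"] powr_mult_base[of "1 + (y + t)\<^sup>2" "q - 2"] by simp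
  finally have "4 * q * (q - 1) * ((y + t)\<^sup>2 * (1 + (y + t)\<^sup>2) powr (q - 2))
      \<le> 4 * q * (q - 1) * (1 + (y + t)\<^sup>2) powr (q - 1)"
    using assms by (intro mult_left_mono) auto
  then have "D 2 t \<le> 2 * q * (1 + (y + t)\<^sup>2) powr (q - 1) + 4 * q * (q - 1) * (1 + (y + t)\<^sup>2) powr (q - 1)"
    by (simp add: D_def mult.assoc)
  also have "\<dots> = 2 * (q * (2 * q - 1)) * (1 + (y + t)\<^sup>2) powr (q - 1)"
    by (simp add: algebra_simps)
  also have "\<dots> \<le> 2 * (q * (2 * q - 1)) * (2 powr (q - 1) * (1 + y\<^sup>2) powr q * (1 + d\<^sup>2) powr (q - 1))"
  proof (intro mult_left_mono)
    have "t\<^sup>2 \<le> d\<^sup>2" using t(1) by (simp add: abs_le_square_iff)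
    have "1 + (y + t)\<^sup>2 \<le> 2 * (1 + y\<^sup>2) * (1 + t\<^sup>2)"
    proof -
      have "2 * (1 + y\<^sup>2) * (1 + t\<^sup>2) - (1 + (y + t)\<^sup>2) = 1 + (y - t)\<^sup>2 + 2 * (y\<^sup>2 * t\<^sup>2)"
        by (simp add: power2_eq_square algebra_simps)
      moreover have "0 \<le> 1 + (y - t)\<^sup>2 + 2 * (y\<^sup>2 * t\<^sup>2)" by (intro add_nonneg_nonneg) auto
      ultimately show ?thesis by linarith
    qed
    also have "\<dots> \<le> 2 * (1 + y\<^sup>2) * (1 + d\<^sup>2)"
      using \<open>t\<^sup>2 \<le> d\<^sup>2\<close> by (intro mult_left_mono) auto
    finally have "(1 + (y + t)\<^sup>2) powr (q - 1) \<le> (2 * (1 + y\<^sup>2) * (1 + d\<^sup>2)) powr (q - 1)"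
      using assms by (intro powr_mono2) auto
    also have "\<dots> = 2 powr (q - 1) * (1 + y\<^sup>2) powr (q - 1) * (1 + d\<^sup>2) powr (q - 1)"
      by (simp add: powr_mult del: distrib_left_numeral)
    also have "\<dots> \<le> 2 powr (q - 1) * (1 + y\<^sup>2) powr q * (1 + d\<^sup>2) powr (q - 1)"
      by (intro mult_right_mono mult_left_mono powr_mono) auto
    finally show "(1 + (y + t)\<^sup>2) powr (q - 1) \<le> 2 powr (q - 1) * (1 + y\<^sup>2) powr q * (1 + d\<^sup>2) powr (q - 1)" .
  qed (use assms in auto)
  finally have "D 2 t / 2 * d\<^sup>2 \<le> (q * (2 * q - 1)) * (2 powr (q - 1) * (1 + y\<^sup>2) powr q * (1 + d\<^sup>2) powr (q - 1)) * d\<^sup>2"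
    by (intro mult_right_mono) auto
  moreover have "a * b * (c * e * h) * k = a * b * c * e * (k * h)" for a b c e h k :: real
    by (simp only: mult_ac)
  ultimately show ?thesis unfolding t(2) by (simp only:)
qed

text \<open>Bounds the relative growth of \<open>E (1 + y\<^sup>2) powr q\<close> in one stage by \<open>growth_const q \<nu> / n\<close>.\<close>

definition growth_const :: "real \<Rightarrow> real measure \<Rightarrow> real" where
  "growth_const q \<nu> = q * (2 * q - 1) * 2 powr (q - 1) * (\<integral>x. (1 + (x - amean \<nu>)\<^sup>2) powr q \<partial>\<nu>)"

lemma growth_const_nonneg: "1 \<le> q \<Longrightarrow> 0 \<le> growth_const q \<nu>"
  unfolding growth_const_def by (intro mult_nonneg_nonneg Bochner_Integration.integral_nonneg) auto

text \<open>The linear term of \<open>growth_taylor\<close> integrates to zero, the squared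
  increment yields the factor \<open>1 / real n\<close>, and the remaining power of the increment is
  bounded by its unscaled version since \<open>1 \<le> n\<close>.\<close>

lemma growth_step:
  assumes "arm \<nu>" "1 \<le> q" "integrable \<nu> (\<lambda>x. (1 + (x - amean \<nu>)\<^sup>2) powr q)" "1 \<le> n"
  shows "(\<integral>\<^sup>+v. ennreal ((1 + (snd (z + v))\<^sup>2) powr q) \<partial>increment_law \<nu> n)
    \<le> ennreal ((1 + growth_const q \<nu> / real n) * (1 + (snd z)\<^sup>2) powr q)"
proof -
  interpret prob_space \<nu> using assms by (simp add: arm_def)
  let ?m = "amean \<nu>" and ?y = "snd z"
  let ?r = "(1 + ?y\<^sup>2) powr q" and ?s = "2 * q * ?y * (1 + ?y\<^sup>2) powr (q - 1)"
  let ?C = "q * (2 * q - 1) * 2 powr (q - 1)"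
  define b where "b x = ?r + ?s * ((x - ?m) / sqrt (real n)) + ?C * ?r * ((1 + (x - ?m)\<^sup>2) powr q / real n)" for x
  have point: "(1 + (?y + (x - ?m) / sqrt (real n))\<^sup>2) powr q \<le> b x" for x
  proof -
    let ?d = "(x - ?m) / sqrt (real n)"
    have d2: "?d\<^sup>2 = (x - ?m)\<^sup>2 / real n" using assms(4) by (simp add: power_divide)
    have le: "(x - ?m)\<^sup>2 / real n \<le> (x - ?m)\<^sup>2" using assms(4) mult_left_mono[of 1 "real n" "(x - ?m)\<^sup>2"] by (simp add: divide_le_eq)
    have "?d\<^sup>2 * (1 + ?d\<^sup>2) powr (q - 1) \<le> (x - ?m)\<^sup>2 / real n * (1 + (x - ?m)\<^sup>2) powr (q - 1)"
      unfolding d2 using le assms(2) by (intro mult_left_mono powr_mono2) auto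
    also have "\<dots> \<le> (1 + (x - ?m)\<^sup>2) * (1 + (x - ?m)\<^sup>2) powr (q - 1) / real n"
      unfolding times_divide_eq_left by (intro divide_right_mono mult_right_mono) auto
    also have "(1 + (x - ?m)\<^sup>2) * (1 + (x - ?m)\<^sup>2) powr (q - 1) = (1 + (x - ?m)\<^sup>2) powr q"
      using powr_mult_base[of "1 + (x - ?m)\<^sup>2" "q - 1"] by simp
    finally have "?C * ?r * (?d\<^sup>2 * (1 + ?d\<^sup>2) powr (q - 1)) \<le> ?C * ?r * ((1 + (x - ?m)\<^sup>2) powr q / real n)"
      using assms(2) by (intro mult_left_mono mult_nonneg_nonneg) auto
    then show ?thesis
      using growth_taylor[OF assms(2), of ?y ?d] unfolding b_def by linarith
  qed
  have b0: "0 \<le> b x" for x by (rule order_trans[OF _ point]) simp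
  have ib: "integrable \<nu> b"
    unfolding b_def using arm_integrable[OF assms(1)] assms(3) by simp
  have "(\<integral>\<^sup>+v. ennreal ((1 + (snd (z + v))\<^sup>2) powr q) \<partial>increment_law \<nu> n)
      = (\<integral>\<^sup>+x. ennreal ((1 + (?y + (x - ?m) / sqrt (real n))\<^sup>2) powr q) \<partial>\<nu>)"
    unfolding increment_law_def
    by (subst nn_integral_distr[OF increment_law_measurable[OF assms(1)]])
      (auto intro!: measurable_compose[OF _ measurable_ennreal] borel_measurable_continuous_onI continuous_intros simp: add_nonneg_eq_0_iff)
  also have "\<dots> \<le> (\<integral>\<^sup>+x. ennreal (b x) \<partial>\<nu>)"
    using point by (intro nn_integral_mono ennreal_leI)
  also have "\<dots> = ennreal (\<integral>x. b x \<partial>\<nu>)"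
    using ib b0 by (intro nn_integral_eq_integral) auto
  also have "(\<integral>x. b x \<partial>\<nu>) = ?r + ?s * (0 / sqrt (real n))
      + ?C * ?r * ((\<integral>x. (1 + (x - ?m)\<^sup>2) powr q \<partial>\<nu>) / real n)"
    unfolding b_def using arm_integrable[OF assms(1)] assms(3) by (simp add: prob_space)
  also have "\<dots> = (1 + growth_const q \<nu> / real n) * ?r"
  proof -
    have "r + s * (0 / a) + c * r * (I / b) = (1 + c * I / b) * r" for r s a b c I :: real
      by (simp add: algebra_simps)
    then show ?thesis unfolding growth_const_def .
  qed
  finally show ?thesis .
qed

context strategy
begin

text \<open>A discrete Gronwall argument: each stage multiplies the moment by at most
  \<open>1 + C / real n\<close>, and the \<open>n\<close>-th power of this is at most
  \<open>exp C\<close>, independently of strategy and horizon.\<close>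

lemma state_moment:
  assumes q: "1 \<le> q" and n: "1 \<le> n"
    and int: "\<And>k. k \<in> S \<Longrightarrow> integrable (law k) (\<lambda>x. (1 + (x - amean (law k))\<^sup>2) powr q)"
    and C: "\<And>k. k \<in> S \<Longrightarrow> growth_const q (law k) \<le> C" "0 \<le> C"
  shows "integrable M (\<lambda>\<omega>. (1 + (snd (state \<theta> n n \<omega>))\<^sup>2) powr q)"
    and "expectation (\<lambda>\<omega>. (1 + (snd (state \<theta> n n \<omega>))\<^sup>2) powr q) \<le> exp C"
proof -
  let ?r = "\<lambda>z :: real \<times> real. (1 + (snd z)\<^sup>2) powr q"
  have rm[measurable]: "?r \<in> borel_measurable borel"
    by (intro measurable_compose[OF borel_measurable_continuous_onI[of snd]] continuous_intros) measurable
  note [measurable] = state_measurable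
  have "(\<integral>\<^sup>+\<omega>. ennreal (?r (state \<theta> n i \<omega>)) \<partial>M) \<le> ennreal ((1 + C / real n) ^ i)" for i
  proof (induction i)
    case (Suc i)
    have "(\<integral>\<^sup>+\<omega>. ennreal (?r (state \<theta> n (Suc i) \<omega>)) \<partial>M)
        = (\<integral>\<^sup>+\<omega>. (\<integral>\<^sup>+v. ennreal (?r (state \<theta> n i \<omega> + v)) \<partial>increment_law (law (\<theta> (Suc i) \<omega>)) n) \<partial>M)"
      by (rule nn_state_step[of "\<lambda>z. ennreal (?r z)"]) measurable
    also have "\<dots> \<le> (\<integral>\<^sup>+\<omega>. ennreal (1 + C / real n) * ennreal (?r (state \<theta> n i \<omega>)) \<partial>M)"
    proof (rule nn_integral_mono)
      fix \<omega> assume "\<omega> \<in> space M"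
      then have k: "\<theta> (Suc i) \<omega> \<in> S" by (rule choice_in)
      have "(\<integral>\<^sup>+v. ennreal (?r (state \<theta> n i \<omega> + v)) \<partial>increment_law (law (\<theta> (Suc i) \<omega>)) n)
          \<le> ennreal ((1 + growth_const q (law (\<theta> (Suc i) \<omega>)) / real n) * ?r (state \<theta> n i \<omega>))"
        by (rule growth_step[OF armS[OF k] q int[OF k] n])
      also have "\<dots> \<le> ennreal ((1 + C / real n) * ?r (state \<theta> n i \<omega>))"
        using C(1)[OF k] by (intro ennreal_leI mult_right_mono add_left_mono divide_right_mono) auto
      also have "\<dots> = ennreal (1 + C / real n) * ennreal (?r (state \<theta> n i \<omega>))"
        using C(2) by (intro ennreal_mult) auto
      finally show "(\<integral>\<^sup>+v. ennreal (?r (state \<theta> n i \<omega> + v)) \<partial>increment_law (law (\<theta> (Suc i) \<omega>)) n)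
        \<le> ennreal (1 + C / real n) * ennreal (?r (state \<theta> n i \<omega>))" .
    qed
    also have "\<dots> = ennreal (1 + C / real n) * (\<integral>\<^sup>+\<omega>. ennreal (?r (state \<theta> n i \<omega>)) \<partial>M)"
      by (rule nn_integral_cmult) measurable
    also have "\<dots> \<le> ennreal (1 + C / real n) * ennreal ((1 + C / real n) ^ i)"
      by (intro mult_left_mono Suc) auto
    also have "\<dots> = ennreal ((1 + C / real n) ^ Suc i)"
      using C(2) by (simp add: ennreal_mult)
    finally show ?case .
  qed (simp add: emeasure_space_1)
  note this[of n]
  also have "ennreal ((1 + C / real n) ^ n) \<le> ennreal (exp C)"
  proof (rule ennreal_leI)
    have "(1 + C / real n) ^ n \<le> exp (C / real n) ^ n"
      using C(2) exp_ge_add_one_self[of "C / real n"] by (intro power_mono) auto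
    also have "\<dots> = exp C" using n by (simp add: exp_of_nat_mult[symmetric])
    finally show "(1 + C / real n) ^ n \<le> exp C" .
  qed
  finally have le: "(\<integral>\<^sup>+\<omega>. ennreal (?r (state \<theta> n n \<omega>)) \<partial>M) \<le> ennreal (exp C)" .
  show i: "integrable M (\<lambda>\<omega>. ?r (state \<theta> n n \<omega>))"
    using order_le_less_trans[OF le ennreal_less_top] by (intro integrableI_nonneg) (auto simp: top.not_eq_extremum)
  have "ennreal (expectation (\<lambda>\<omega>. ?r (state \<theta> n n \<omega>))) \<le> ennreal (exp C)"
    using le i by (subst (asm) nn_integral_eq_integral) auto
  then show "expectation (\<lambda>\<omega>. ?r (state \<theta> n n \<omega>)) \<le> exp C"
    by simp
qed

text \<open>Only finitely many conditional expectations occur, so almost everywhere all of them can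
  be replaced at once by the means of the arms played.\<close>

lemma expected_utility_state:
  assumes u: "u \<in> borel_measurable borel" and n: "1 \<le> n"
  shows "expected_utility M Y u n \<theta> = expectation (\<lambda>\<omega>.
     u (fst (state \<theta> n n \<omega>) + snd (state \<theta> n n \<omega>) / sqrt (real n), snd (state \<theta> n n \<omega>)))"
  unfolding expected_utility_def
proof (rule integral_cong_AE)
  have rw: "reward Y \<theta> i \<in> borel_measurable M" if "i \<in> {1..n}" for i
    by (rule past_measurable[OF history_past[OF history_reward[OF that]]])
  have ce: "real_cond_exp M F h \<in> borel_measurable M" for F h by simp
  show "(\<lambda>\<omega>. u ((1 / real n) * (\<Sum>i=1..n. reward Y \<theta> i \<omega>),
        (1 / sqrt (real n)) * (\<Sum>i=1..n. reward Y \<theta> i \<omega>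
            - real_cond_exp M (history M Y \<theta> (i - 1)) (reward Y \<theta> i) \<omega>))) \<in> borel_measurable M"
    by (intro measurable_compose[OF _ u] borel_measurable_Pair borel_measurable_times borel_measurable_sum
        borel_measurable_diff rw ce borel_measurable_const)
  show "(\<lambda>\<omega>. u (fst (state \<theta> n n \<omega>) + snd (state \<theta> n n \<omega>) / sqrt (real n), snd (state \<theta> n n \<omega>)))
      \<in> borel_measurable M"
    using n by (intro measurable_compose[OF measurable_compose[OF state_measurable borel_measurable_continuous_onI] u]
        continuous_intros) auto
  have "AE \<omega> in M. real_cond_exp M (history M Y \<theta> (i - 1)) (reward Y \<theta> i) \<omega> = amean (law (\<theta> i \<omega>))"
    if "i \<in> {1..n}" for i
    using cond_exp_reward[of "i - 1"] that by simp
  then have "AE \<omega> in M. \<forall>i\<in>{1..n}. real_cond_exp M (history M Y \<theta> (i - 1)) (reward Y \<theta> i) \<omega> = amean (law (\<theta> i \<omega>))"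
    by (intro AE_finite_allI) auto
  then show "AE \<omega> in M. u ((1 / real n) * (\<Sum>i=1..n. reward Y \<theta> i \<omega>),
        (1 / sqrt (real n)) * (\<Sum>i=1..n. reward Y \<theta> i \<omega>
            - real_cond_exp M (history M Y \<theta> (i - 1)) (reward Y \<theta> i) \<omega>))
    = u (fst (state \<theta> n n \<omega>) + snd (state \<theta> n n \<omega>) / sqrt (real n), snd (state \<theta> n n \<omega>))"
  proof eventually_elim
    case (elim \<omega>)
    have a: "(1 / sqrt (real n)) * (\<Sum>i=1..n. reward Y \<theta> i \<omega>
            - real_cond_exp M (history M Y \<theta> (i - 1)) (reward Y \<theta> i) \<omega>) = snd (state \<theta> n n \<omega>)"
      using elim by (simp add: state_def sum_distrib_left)
    have "snd (state \<theta> n n \<omega>) / sqrt (real n) = (\<Sum>j=1..n. (reward Y \<theta> j \<omega> - amean (law (\<theta> j \<omega>))) / real n)"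
      by (simp add: state_def sum_divide_distrib)
    then have "fst (state \<theta> n n \<omega>) + snd (state \<theta> n n \<omega>) / sqrt (real n)
        = (\<Sum>j=1..n. amean (law (\<theta> j \<omega>)) / real n + (reward Y \<theta> j \<omega> - amean (law (\<theta> j \<omega>))) / real n)"
      by (simp add: state_def sum.distrib)
    also have "\<dots> = (1 / real n) * (\<Sum>i=1..n. reward Y \<theta> i \<omega>)"
      by (simp add: sum_divide_distrib flip: add_divide_distrib)
    finally show ?case using a by simp
  qed
qed

end

text \<open>If a maximizing arm is played in every state, the expectation that is nonincreasing in
  \<open>value_upper\<close> stays constant.\<close>

lemma (in bandit) value_attained:
  assumes "modulus B w" "bduc B w f" "S \<subseteq> {1..K}" "S \<noteq> {}"
  shows "\<exists>\<theta>\<in>admissible M S Y. expectation (\<lambda>\<omega>. f (state \<theta> n n \<omega>)) = (bellman S law n ^^ n) f (0, 0)"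
proof -
  interpret arms S law
    using assms(3,4) law_props by unfold_locales (auto intro: finite_subset)
  define v where "v j = (bellman S law n ^^ j) f" for j
  have uv: "bduc B w (v j)" for j unfolding v_def by (rule iter_bduc[OF assms(1,2)])
  \<comment> \<open>The least maximizing arm depends measurably on \<open>z\<close>, because each
    candidate is tested by a Borel predicate.\<close>
  define \<kappa> where "\<kappa> j z = (LEAST k. k \<in> S \<and> avg (increment_law (law k) n) (v j) z = v (Suc j) z)" for j z
  have \<kappa>: "\<kappa> j z \<in> S \<and> avg (increment_law (law (\<kappa> j z)) n) (v j) z = v (Suc j) z" for j z
  proof -
    have "\<exists>k. k \<in> S \<and> avg (increment_law (law k) n) (v j) z = v (Suc j) z"
      using bellman_attained[of n "v j" z] by (auto simp: v_def)
    from LeastI_ex[OF this] show ?thesis unfolding \<kappa>_def .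
  qed
  have \<kappa>m: "\<kappa> j \<in> measurable borel (count_space S)" for j
  proof -
    have "Measurable.pred borel (\<lambda>z. k \<in> S \<and> avg (increment_law (law k) n) (v j) z = v (Suc j) z)" for k
    proof (cases "k \<in> S")
      case True
      note [measurable] = bduc_measurable[OF assms(1) uv] bduc_measurable[OF assms(1) avg_bduc[OF assms(1) uv plane_prob_increment_law[OF arm[OF True]]]]
      show ?thesis using True by measurable
    qed simp
    then have "(\<lambda>z. LEAST k. k \<in> S \<and> avg (increment_law (law k) n) (v j) z = v (Suc j) z) \<in> measurable borel (count_space UNIV)"
      by (rule measurable_Least)
    then have "\<kappa> j \<in> measurable borel (count_space UNIV)"
      unfolding \<kappa>_def .
    then have "\<kappa> j -` {a} \<inter> space borel \<in> sets borel" for a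
      by (rule measurable_sets) simp
    then show ?thesis
      unfolding measurable_count_space_eq2_countable using \<kappa> by blast
  qed
  \<comment> \<open>Choices depend on the state and the state on the choices. The recursion
    therefore builds the state as a process in its own right, and \<open>\<theta>\<close> is read
    off from it.\<close>
  define s where "s = rec_nat (\<lambda>_. (0, 0)) (\<lambda>i s \<omega>. s \<omega> + (amean (law (\<kappa> (n - Suc i) (s \<omega>))) / real n,
     (Y (\<kappa> (n - Suc i) (s \<omega>)) (Suc i) \<omega> - amean (law (\<kappa> (n - Suc i) (s \<omega>)))) / sqrt (real n)))"
  \<comment> \<open>The choice at stage \<open>i\<close> uses the state before the draw and leaves
    \<open>n - i\<close> stages. Beyond the horizon \<open>n - i\<close> is \<open>0\<close>, so the
    choices remain arms of \<open>S\<close>, as admissibility demands at every stage.\<close>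
  define \<theta> where "\<theta> i \<omega> = \<kappa> (n - i) (s (i - 1) \<omega>)" for i \<omega>
  have s: "s i = state \<theta> n i" for i
  proof (induction i)
    case (Suc i)
    have "s (Suc i) \<omega> = state \<theta> n (Suc i) \<omega>" for \<omega>
      unfolding state_Suc Suc[symmetric] \<theta>_def by (simp add: s_def)
    then show ?case by (rule ext)
  qed (simp add: s_def fun_eq_iff)
  have e: "\<theta> i = (\<lambda>\<omega>. \<kappa> (n - i) (state \<theta> n (i - 1) \<omega>))" for i
    unfolding s[symmetric] by (simp add: \<theta>_def fun_eq_iff)
  have "(\<lambda>\<omega>. \<kappa> (n - i) (state \<theta> n (i - 1) \<omega>)) \<in> measurable (history M Y \<theta> (i - 1)) (count_space S)" for i
    by (rule measurable_compose[OF state_history \<kappa>m])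
  then have "\<theta> i \<in> measurable (history M Y \<theta> (i - 1)) (count_space S)" for i
    unfolding e[symmetric] .
  then have adm: "\<theta> \<in> admissible M S Y" by (simp add: admissible_def)
  interpret strategy M K X Y g S \<theta>
    using assms(3) adm by unfold_locales
  have "expectation (\<lambda>\<omega>. v (n - i) (state \<theta> n i \<omega>)) = v n (0, 0)" if "i \<le> n" for i
    using that
  proof (induction i)
    case (Suc i)
    have j: "n - i = Suc (n - Suc i)" using Suc.prems by simp
    have "expectation (\<lambda>\<omega>. v (n - Suc i) (state \<theta> n (Suc i) \<omega>))
        = expectation (\<lambda>\<omega>. avg (increment_law (law (\<theta> (Suc i) \<omega>)) n) (v (n - Suc i)) (state \<theta> n i \<omega>))"
      by (rule state_step(1)[OF assms(1) uv])
    also have "\<dots> = expectation (\<lambda>\<omega>. v (n - i) (state \<theta> n i \<omega>))"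
    proof -
      have "\<theta> (Suc i) \<omega> = \<kappa> (n - Suc i) (state \<theta> n i \<omega>)" for \<omega>
        using e[of "Suc i"] by simp
      then show ?thesis unfolding j using \<kappa> by (simp only:)
    qed
    finally show ?case using Suc by simp
  qed (simp add: prob_space)
  from this[of n] adm show ?thesis by (auto simp: v_def)
qed

section \<open>Truncation of the utility\<close>

text \<open>The optimal modulus of continuity serves as \<open>w\<close>. Near zero it is small by
  uniform continuity on the ball of radius \<open>r + 1\<close>; if one of two points at distance at
  most \<open>1\<close> lies outside that ball, \<open>f\<close> vanishes at both.\<close>

lemma compact_support_modulus:
  fixes f :: "real \<times> real \<Rightarrow> real"
  assumes f: "continuous_on UNIV f" and z: "\<And>z. r \<le> norm z \<Longrightarrow> f z = 0"
  shows "\<exists>B w. modulus B w \<and> bduc B w f"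
proof -
  have "bounded (f ` cball 0 r)"
    by (intro compact_imp_bounded compact_continuous_image continuous_on_subset[OF f]) auto
  then obtain B where B: "\<forall>y\<in>f ` cball 0 r. norm y \<le> B" "0 < B"
    unfolding bounded_pos by blast
  have fB: "\<bar>f x\<bar> \<le> B" for x
  proof (cases "norm x \<le> r")
    case True
    then have "f x \<in> f ` cball 0 r" by (intro imageI) simp
    then show ?thesis using B(1) by fastforce
  next
    case False
    then show ?thesis using z[of x] B(2) by simp
  qed
  \<comment> \<open>With \<open>max 0 d\<close> the set is nonempty also for negative
    \<open>d\<close>, and \<open>w\<close> vanishes there, so the two-sided continuity at
    \<open>0\<close> only concerns positive arguments.\<close>
  define D where "D d = {\<bar>f x - f y\<bar> | x y. dist x y \<le> max 0 d}" for d
  define w where "w d = Sup (D d)" for d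
  have ne: "0 \<in> D d" for d unfolding D_def by (intro CollectI exI[of _ 0]) auto
  have ub: "a \<le> 2 * B" if "a \<in> D d" for a d
  proof -
    obtain x y where "a = \<bar>f x - f y\<bar>" using \<open>a \<in> D d\<close> unfolding D_def by blast
    then show ?thesis using fB[of x] fB[of y] by linarith
  qed
  have bdd: "bdd_above (D d)" for d using ub by (rule bdd_aboveI)
  have wle: "w d \<le> c" if "\<And>a. a \<in> D d \<Longrightarrow> a \<le> c" for d c
    unfolding w_def using ne that by (intro cSup_least) auto
  have wge: "a \<le> w d" if "a \<in> D d" for a d
    unfolding w_def by (rule cSup_upper[OF that bdd])
  have mono: "mono w"
  proof (rule monoI, rule wle)
    fix d d' a :: real assume "d \<le> d'" "a \<in> D d"
    then have "a \<in> D d'" unfolding D_def by fastforce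
    then show "a \<le> w d'" by (rule wge)
  qed
  have w0: "w 0 = 0"
  proof (rule antisym)
    show "w 0 \<le> 0" by (rule wle) (auto simp: D_def)
  qed (rule wge[OF ne])
  have "\<exists>s>0. w s \<le> e" if "0 < e" for e
  proof -
    have "uniformly_continuous_on (cball 0 (r + 1)) f"
      by (intro compact_uniformly_continuous continuous_on_subset[OF f]) auto
    then have "\<exists>s>0. \<forall>x\<in>cball 0 (r + 1). \<forall>y\<in>cball 0 (r + 1). dist y x < s \<longrightarrow> dist (f y) (f x) < e"
      using that unfolding uniformly_continuous_on_def by blast
    then obtain s where s: "0 < s" "\<forall>x\<in>cball 0 (r + 1). \<forall>y\<in>cball 0 (r + 1). dist y x < s \<longrightarrow> dist (f y) (f x) < e"
      by blast
    define t where "t = min (s / 2) 1"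
    have t: "0 < t" "t < s" "t \<le> 1" using s(1) by (auto simp: t_def)
    have "w t \<le> e"
    proof (rule wle)
      fix a assume "a \<in> D t"
      then obtain x y where a: "a = \<bar>f x - f y\<bar>" and xy: "dist x y \<le> t" using t(1) by (auto simp: D_def)
      show "a \<le> e"
      proof (cases "norm x \<le> r + 1 \<and> norm y \<le> r + 1")
        case True
        then show ?thesis using s(2)[rule_format, of y x] xy t(2) by (simp add: a dist_real_def)
      next
        case False
        have "\<bar>norm x - norm y\<bar> \<le> 1" using norm_triangle_ineq3[of x y] xy t(3) by (simp add: dist_norm)
        then have "r \<le> norm x" "r \<le> norm y" using False by auto
        then show ?thesis using that by (simp add: a z)
      qed
    qed
    then show ?thesis using t(1) by blast
  qed
  note small = this
  have "isCont w 0"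
    unfolding isCont_def
  proof (rule tendstoI)
    fix e :: real assume "0 < e"
    then obtain s where s: "0 < s" "w s \<le> e / 2" using small[of "e / 2"] by auto
    have "dist (w x) (w 0) < e" if "dist x 0 < s" for x
    proof -
      have "w x \<le> w s" using mono that by (intro monoD[OF mono]) auto
      moreover have "0 \<le> w x" by (rule wge[OF ne])
      ultimately show ?thesis using s \<open>0 < e\<close> by (simp add: w0)
    qed
    then show "\<forall>\<^sub>F x in at 0. dist (w x) (w 0) < e"
      using s(1) unfolding eventually_at by blast
  qed
  then have "modulus B w"
    unfolding modulus_def using mono w0 wle[of _ "2 * B"] ub by blast
  moreover have "bduc B w f"
    unfolding bduc_def
  proof (intro conjI allI)
    fix x y
    show "\<bar>f x - f y\<bar> \<le> w (dist x y)" unfolding D_def by (rule wge[unfolded D_def]) (intro CollectI exI[of _ x] exI[of _ y], simp)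
  qed (rule fB)
  ultimately show ?thesis by blast
qed

section \<open>Cutting off the utility outside a ball\<close>

definition cutoff :: "real \<Rightarrow> (real \<times> real \<Rightarrow> real) \<Rightarrow> real \<times> real \<Rightarrow> real" where
  "cutoff R u z = max 0 (min 1 (R + 1 - norm z)) * u z"

lemma cutoff_modulus: "continuous_on UNIV u \<Longrightarrow> \<exists>B w. modulus B w \<and> bduc B w (cutoff R u)"
  by (rule compact_support_modulus[where r = "R + 1"])
    (auto simp: cutoff_def[abs_def] intro!: continuous_intros)

lemma cutoff_diff_le: "\<bar>u z - cutoff R u z\<bar> \<le> \<bar>u z\<bar>"
proof -
  let ?c = "max 0 (min 1 (R + 1 - norm z))"
  have "\<bar>u z - cutoff R u z\<bar> = (1 - ?c) * \<bar>u z\<bar>"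
  proof -
    have "u z - cutoff R u z = (1 - ?c) * u z" by (simp add: cutoff_def left_diff_distrib)
    moreover have "0 \<le> 1 - ?c" by simp
    ultimately show ?thesis by (simp only: abs_mult abs_of_nonneg)
  qed
  also have "\<dots> \<le> 1 * \<bar>u z\<bar>" by (intro mult_right_mono) auto
  finally show ?thesis by simp
qed

lemma cutoff_eq: "norm z \<le> R \<Longrightarrow> cutoff R u z = u z"
  by (simp add: cutoff_def)

text \<open>The growth exponent \<open>g - 1\<close> is one less than \<open>g\<close>: outside the
  ball, multiplying by the norm, which exceeds \<open>R\<close>, trades this spare power for a
  factor \<open>1 / R\<close>. The exponent \<open>2 * q\<close> is at least \<open>g\<close>, and
  \<open>1 \<le> q\<close> is what the moment bound asks for.\<close>

lemma cutoff_tail: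
  fixes u :: "real \<times> real \<Rightarrow> real"
  assumes growth: "\<And>x y. \<bar>u (x, y)\<bar> \<le> c * (1 + norm (x, y) powr (g - 1))" and "0 < c" "1 \<le> g" "1 \<le> R" "1 \<le> n"
    and a: "\<bar>a\<bar> \<le> A" and q: "q = max g 2 / 2"
  shows "\<bar>u (a + y / sqrt (real n), y) - cutoff R u (a + y / sqrt (real n), y)\<bar>
    \<le> 2 * c * (2 * A\<^sup>2 + 3) powr q / R * (1 + y\<^sup>2) powr q"
proof -
  let ?z = "(a + y / sqrt (real n), y)"
  have q1: "1 \<le> q" "g - 1 + 1 \<le> 2 * q" using q by auto
  show ?thesis
  proof (cases "norm ?z \<le> R")
    case True
    then show ?thesis using assms(2,4) by (simp add: cutoff_eq)
  next
    case False
    let ?N = "norm ?z"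
    have N: "R < ?N" "1 < ?N" using False assms(4) by auto
    have "?N\<^sup>2 = (a + y / sqrt (real n))\<^sup>2 + y\<^sup>2" by (simp add: norm_Pair)
    also have "(a + y / sqrt (real n))\<^sup>2 \<le> 2 * a\<^sup>2 + 2 * (y / sqrt (real n))\<^sup>2"
    proof -
      have "2 * a\<^sup>2 + 2 * b\<^sup>2 - (a + b)\<^sup>2 = (a - b)\<^sup>2" for b by (simp add: power2_eq_square algebra_simps)
      from this[of "y / sqrt (real n)"] show ?thesis using zero_le_power2[of "a - y / sqrt (real n)"] by linarith
    qed
    also have "(y / sqrt (real n))\<^sup>2 \<le> y\<^sup>2"
      using assms(5) mult_left_mono[of 1 "real n" "y\<^sup>2"] by (simp add: power_divide divide_le_eq)
    also have "a\<^sup>2 \<le> A\<^sup>2" using a by (simp add: abs_le_square_iff[symmetric])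
    finally have "?N\<^sup>2 \<le> 2 * A\<^sup>2 + 2 * y\<^sup>2 + y\<^sup>2" by simp
    also have "\<dots> \<le> (2 * A\<^sup>2 + 3) * (1 + y\<^sup>2)" by (simp add: algebra_simps)
    finally have N2: "?N\<^sup>2 \<le> (2 * A\<^sup>2 + 3) * (1 + y\<^sup>2)" .
    have "\<bar>u ?z\<bar> \<le> c * (1 + ?N powr (g - 1))" by (rule growth)
    also have "\<dots> \<le> c * (2 * ?N powr (g - 1))"
      using N(2) assms(2,3) ge_one_powr_ge_zero[of ?N "g - 1"] by (intro mult_left_mono) auto
    finally have "\<bar>u ?z\<bar> * R \<le> c * (2 * ?N powr (g - 1)) * ?N"
      using N assms(2,4) by (intro mult_mono) auto
    also have "\<dots> = 2 * c * ?N powr (g - 1 + 1)"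
    proof -
      have "?N powr (g - 1 + 1) = ?N powr (g - 1) * ?N" unfolding powr_add using N(2) by simp
      then show ?thesis by (simp only: mult_ac)
    qed
    also have "\<dots> \<le> 2 * c * ?N powr (2 * q)"
      using N(2) q1 assms(2) by (intro mult_left_mono powr_mono) auto
    also have "?N powr (2 * q) = (?N\<^sup>2) powr q"
      using N(2) by (simp add: powr_powr flip: powr_numeral)
    also have "2 * c * (?N\<^sup>2) powr q \<le> 2 * c * ((2 * A\<^sup>2 + 3) * (1 + y\<^sup>2)) powr q"
      using N2 q1 assms(2) by (intro mult_left_mono powr_mono2) auto
    also have "\<dots> = 2 * c * (2 * A\<^sup>2 + 3) powr q * (1 + y\<^sup>2) powr q"
      by (subst powr_mult) auto
    finally have "\<bar>u ?z\<bar> \<le> 2 * c * (2 * A\<^sup>2 + 3) powr q * (1 + y\<^sup>2) powr q / R"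
      using assms(4) by (simp add: pos_le_divide_eq)
    then show ?thesis using cutoff_diff_le[of u ?z R] by simp
  qed
qed

context strategy
begin

text \<open>Two replacements are made: \<open>u\<close> by its cutoff, paid by the tail estimate and
  the moment bound, and then the argument by the state, a shift by
  \<open>\<bar>y\<bar> / sqrt (real n)\<close>. Shifts up to \<open>s\<close> cost
  \<open>w s\<close>; larger ones cost \<open>2 * B\<close> and are rare by Chebyshev's
  inequality.\<close>

lemma utility_approx:
  assumes u: "continuous_on UNIV u"
    and growth: "\<And>x y. \<bar>u (x, y)\<bar> \<le> c * (1 + norm (x, y) powr (g - 1))" and c: "0 < c" and g: "1 \<le> g"
    and R: "1 \<le> R" and n: "1 \<le> n" and q: "q = max g 2 / 2"
    and int: "\<And>k. k \<in> S \<Longrightarrow> integrable (law k) (\<lambda>x. (1 + (x - amean (law k))\<^sup>2) powr q)"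
    and C: "\<And>k. k \<in> S \<Longrightarrow> growth_const q (law k) \<le> C" "0 \<le> C"
    and A: "\<And>k. k \<in> S \<Longrightarrow> \<bar>amean (law k)\<bar> \<le> A"
    and w: "modulus B w" "bduc B w (cutoff R u)" and s: "0 < s"
  shows "\<bar>expected_utility M Y u n \<theta> - expectation (\<lambda>\<omega>. cutoff R u (state \<theta> n n \<omega>))\<bar>
    \<le> 2 * c * (2 * A\<^sup>2 + 3) powr q / R * exp C + w s + 2 * B * exp C / (s\<^sup>2 * real n)"
proof -
  let ?x = "\<lambda>\<omega>. fst (state \<theta> n n \<omega>)" and ?y = "\<lambda>\<omega>. snd (state \<theta> n n \<omega>)"
  let ?z = "\<lambda>\<omega>. (?x \<omega> + ?y \<omega> / sqrt (real n), ?y \<omega>)" and ?f = "cutoff R u"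
  let ?r = "\<lambda>\<omega>. (1 + (?y \<omega>)\<^sup>2) powr q"
  let ?D = "2 * c * (2 * A\<^sup>2 + 3) powr q / R"
  have q1: "1 \<le> q" using q by auto
  note mom = state_moment[OF q1 n int C]
  have B0: "0 \<le> B" using bduc_bound[OF w(2), of "(0,0)"] by linarith
  have zm: "?z \<in> borel_measurable M"
    using n by (intro measurable_compose[OF state_measurable borel_measurable_continuous_onI] continuous_intros) auto
  have um: "(\<lambda>\<omega>. u (?z \<omega>)) \<in> borel_measurable M"
    by (rule measurable_compose[OF zm borel_measurable_continuous_onI[OF u]])
  have fm: "(\<lambda>\<omega>. ?f (?z \<omega>)) \<in> borel_measurable M"
    by (rule measurable_compose[OF zm bduc_measurable[OF w]])
  have fi: "integrable M (\<lambda>\<omega>. ?f (?z \<omega>))"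
    by (rule integrable_const_bound[where B=B, OF _ fm]) (auto intro: bduc_bound[OF w(2)])
  have si: "integrable M (\<lambda>\<omega>. ?f (state \<theta> n n \<omega>))"
    by (rule state_step(2)[OF w])
  have xA: "\<bar>?x \<omega>\<bar> \<le> A" if \<omega>: "\<omega> \<in> space M" for \<omega>
  proof -
    have "\<bar>?x \<omega>\<bar> \<le> (\<Sum>j=1..n. \<bar>amean (law (\<theta> j \<omega>)) / real n\<bar>)"
      unfolding state_def fst_conv by (rule sum_abs)
    also have "\<dots> \<le> (\<Sum>j=1..n. A / real n)"
    proof (rule sum_mono)
      fix j assume "j \<in> {1..n}"
      then have "\<theta> j \<omega> \<in> S" using choice_in[OF \<omega>, of "j - 1"] by simp
      then show "\<bar>amean (law (\<theta> j \<omega>)) / real n\<bar> \<le> A / real n"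
        using A by (simp add: divide_right_mono)
    qed
    also have "\<dots> = A" using n by simp
    finally show ?thesis .
  qed
  have d1: "\<bar>u (?z \<omega>) - ?f (?z \<omega>)\<bar> \<le> ?D * ?r \<omega>" if "\<omega> \<in> space M" for \<omega>
    by (rule cutoff_tail[OF growth c g R n xA[OF that] q])
  have i1: "integrable M (\<lambda>\<omega>. u (?z \<omega>) - ?f (?z \<omega>))"
  proof (rule Bochner_Integration.integrable_bound)
    show "integrable M (\<lambda>\<omega>. ?D * ?r \<omega>)" using mom(1) by simp
    show "(\<lambda>\<omega>. u (?z \<omega>) - ?f (?z \<omega>)) \<in> borel_measurable M" by (rule borel_measurable_diff[OF um fm])
    show "AE \<omega> in M. norm (u (?z \<omega>) - ?f (?z \<omega>)) \<le> norm (?D * ?r \<omega>)"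
      unfolding real_norm_def by (intro AE_I2 order_trans[OF d1 abs_ge_self])
  qed
  have ui: "integrable M (\<lambda>\<omega>. u (?z \<omega>))"
    using Bochner_Integration.integrable_add[OF i1 fi] by simp
  have "\<bar>expectation (\<lambda>\<omega>. u (?z \<omega>)) - expectation (\<lambda>\<omega>. ?f (?z \<omega>))\<bar> = \<bar>expectation (\<lambda>\<omega>. u (?z \<omega>) - ?f (?z \<omega>))\<bar>"
    using ui fi by simp
  also have "\<dots> \<le> expectation (\<lambda>\<omega>. \<bar>u (?z \<omega>) - ?f (?z \<omega>)\<bar>)" by simp
  also have "\<dots> \<le> expectation (\<lambda>\<omega>. ?D * ?r \<omega>)"
    using i1 mom(1) d1 by (intro integral_mono) auto
  also have "\<dots> \<le> ?D * exp C"
    using mom c R by (simp add: mult_left_mono divide_right_mono)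
  finally have 1: "\<bar>expectation (\<lambda>\<omega>. u (?z \<omega>)) - expectation (\<lambda>\<omega>. ?f (?z \<omega>))\<bar> \<le> ?D * exp C" .
  have d2: "\<bar>?f (?z \<omega>) - ?f (state \<theta> n n \<omega>)\<bar> \<le> w s + 2 * B / (s\<^sup>2 * real n) * ?r \<omega>" for \<omega>
  proof -
    have "dist (?z \<omega>) (state \<theta> n n \<omega>) = \<bar>?y \<omega>\<bar> / sqrt (real n)"
    proof -
      have "dist (fst p + t, snd p) p = \<bar>t\<bar>" for p :: "real \<times> real" and t
        by (cases p) (simp add: dist_Pair_Pair dist_real_def)
      then show ?thesis by simp
    qed
    with bduc_modulus[OF w(2), of "?z \<omega>" "state \<theta> n n \<omega>"]
    have le: "\<bar>?f (?z \<omega>) - ?f (state \<theta> n n \<omega>)\<bar> \<le> w (\<bar>?y \<omega>\<bar> / sqrt (real n))" by simp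
    have r1: "1 + (?y \<omega>)\<^sup>2 \<le> ?r \<omega>" using powr_mono[OF q1, of "1 + (?y \<omega>)\<^sup>2"] by simp
    then have r0: "0 \<le> ?r \<omega>" by simp
    show ?thesis
    proof (cases "\<bar>?y \<omega>\<bar> / sqrt (real n) \<le> s")
      case True
      have "w (\<bar>?y \<omega>\<bar> / sqrt (real n)) \<le> w s" by (rule modulus_mono[OF w(1) True])
      moreover have "0 \<le> 2 * B / (s\<^sup>2 * real n) * ?r \<omega>" using B0 r0 by simp
      ultimately show ?thesis using le by linarith
    next
      case False
      then have "s\<^sup>2 \<le> (\<bar>?y \<omega>\<bar> / sqrt (real n))\<^sup>2" using s by (intro power_mono) auto
      then have "s\<^sup>2 * real n \<le> (?y \<omega>)\<^sup>2" using n by (simp add: power_divide pos_le_divide_eq)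
      then have "s\<^sup>2 * real n \<le> ?r \<omega>" using r1 by linarith
      then have "1 \<le> ?r \<omega> / (s\<^sup>2 * real n)" using s n by (simp add: pos_le_divide_eq)
      then have "2 * B * 1 \<le> 2 * B * (?r \<omega> / (s\<^sup>2 * real n))" using B0 by (intro mult_left_mono) auto
      moreover have "w (\<bar>?y \<omega>\<bar> / sqrt (real n)) \<le> 2 * B" using w(1) by (simp add: modulus_def)
      moreover have "0 \<le> w s" using modulus_nonneg[OF w(1)] s by simp
      ultimately show ?thesis using le by simp
    qed
  qed
  have "\<bar>expectation (\<lambda>\<omega>. ?f (?z \<omega>)) - expectation (\<lambda>\<omega>. ?f (state \<theta> n n \<omega>))\<bar>
      = \<bar>expectation (\<lambda>\<omega>. ?f (?z \<omega>) - ?f (state \<theta> n n \<omega>))\<bar>"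
    using fi si by simp
  also have "\<dots> \<le> expectation (\<lambda>\<omega>. \<bar>?f (?z \<omega>) - ?f (state \<theta> n n \<omega>)\<bar>)" by simp
  also have "\<dots> \<le> expectation (\<lambda>\<omega>. w s + 2 * B / (s\<^sup>2 * real n) * ?r \<omega>)"
    using fi si mom(1) d2 by (intro integral_mono) auto
  also have "\<dots> = w s + 2 * B / (s\<^sup>2 * real n) * expectation ?r"
    using mom(1) by (simp add: prob_space)
  also have "\<dots> \<le> w s + 2 * B / (s\<^sup>2 * real n) * exp C"
    using mom(2) B0 by (intro add_left_mono mult_left_mono) auto
  finally have 2: "\<bar>expectation (\<lambda>\<omega>. ?f (?z \<omega>)) - expectation (\<lambda>\<omega>. ?f (state \<theta> n n \<omega>))\<bar>
      \<le> w s + 2 * B * exp C / (s\<^sup>2 * real n)" by simp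
  have "expected_utility M Y u n \<theta> = expectation (\<lambda>\<omega>. u (?z \<omega>))"
    by (rule expected_utility_state[OF borel_measurable_continuous_onI[OF u] n])
  with 1 2 show ?thesis by linarith
qed

end

context bandit
begin

text \<open>Since \<open>2 * q\<close> is \<open>g\<close> or \<open>2\<close>, the power of
  \<open>x\<close> is covered by the \<open>g\<close>-th moment if \<open>g \<ge> 2\<close> and by
  the variance otherwise; the dominating function contains both.\<close>

lemma moment_integrable:
  assumes k: "k \<in> {1..K}" and q: "q = max g 2 / 2"
  shows "integrable (law k) (\<lambda>x. (1 + (x - amean (law k))\<^sup>2) powr q)"
proof -
  have [measurable]: "X k \<in> borel_measurable M" by (rule payoff_rv[OF k])
  let ?m = "amean (law k)"
  have q1: "1 \<le> q" using q by auto
  have g: "integrable M (\<lambda>\<omega>. \<bar>X k \<omega>\<bar> powr g)"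
  proof (rule integrableI_nonneg)
    have "(\<integral>\<^sup>+\<omega>. ennreal (\<bar>X k \<omega>\<bar> powr g) \<partial>M) \<le> (SUP k\<in>{1..K}. \<integral>\<^sup>+\<omega>. ennreal (\<bar>X k \<omega>\<bar> powr g) \<partial>M)"
      by (rule SUP_upper[OF k])
    then show "(\<integral>\<^sup>+\<omega>. ennreal (\<bar>X k \<omega>\<bar> powr g) \<partial>M) < \<infinity>"
      using finite_moment by (rule order_le_less_trans)
  qed auto
  have le: "(1 + (x - ?m)\<^sup>2) powr q \<le> (4 * (1 + ?m\<^sup>2)) powr q * (1 + x\<^sup>2 + \<bar>x\<bar> powr g)" for x
  proof -
    have "2 * (1 + ?m\<^sup>2) * (1 + x\<^sup>2) \<le> 2 * (1 + ?m\<^sup>2) * (2 * max 1 (x\<^sup>2))"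
      by (intro mult_left_mono) auto
    moreover have "2 * (1 + ?m\<^sup>2) * (2 * max 1 (x\<^sup>2)) = 4 * (1 + ?m\<^sup>2) * max 1 (x\<^sup>2)"
      by (simp only: mult_ac)
    moreover have "2 * (1 + ?m\<^sup>2) * (1 + x\<^sup>2) - (1 + (x - ?m)\<^sup>2) = 1 + (x + ?m)\<^sup>2 + 2 * (x\<^sup>2 * ?m\<^sup>2)"
      by (simp add: power2_eq_square algebra_simps)
    moreover have "0 \<le> 1 + (x + ?m)\<^sup>2 + 2 * (x\<^sup>2 * ?m\<^sup>2)" by (intro add_nonneg_nonneg) auto
    ultimately have "1 + (x - ?m)\<^sup>2 \<le> 4 * (1 + ?m\<^sup>2) * max 1 (x\<^sup>2)" by linarith
    then have "(1 + (x - ?m)\<^sup>2) powr q \<le> (4 * (1 + ?m\<^sup>2) * max 1 (x\<^sup>2)) powr q"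
      using q1 by (intro powr_mono2) auto
    also have "\<dots> = (4 * (1 + ?m\<^sup>2)) powr q * max 1 (x\<^sup>2) powr q"
      by (subst powr_mult) auto
    also have "\<dots> \<le> (4 * (1 + ?m\<^sup>2)) powr q * (1 + x\<^sup>2 + \<bar>x\<bar> powr g)"
    proof (intro mult_left_mono)
      show "max 1 (x\<^sup>2) powr q \<le> 1 + x\<^sup>2 + \<bar>x\<bar> powr g"
      proof (cases "x\<^sup>2 \<le> 1")
        case False
        then have x: "0 < \<bar>x\<bar>" by auto
        have "(x\<^sup>2) powr q = \<bar>x\<bar> powr (max g 2)"
        proof -
          have "x\<^sup>2 = \<bar>x\<bar> powr 2" using x by (simp add: powr_numeral)
          moreover have "2 * q = max g 2" unfolding q by simp
          ultimately show ?thesis by (simp only: powr_powr)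
        qed
        also have "\<dots> = x\<^sup>2 \<or> \<dots> = \<bar>x\<bar> powr g"
          using x by (auto simp: max_def)
        ultimately show ?thesis using False by (auto simp: max_def)
      qed (auto simp: max_def)
    qed auto
    finally show ?thesis .
  qed
  have "integrable M (\<lambda>\<omega>. (1 + (X k \<omega> - ?m)\<^sup>2) powr q)"
  proof (rule Bochner_Integration.integrable_bound)
    show "integrable M (\<lambda>\<omega>. (4 * (1 + ?m\<^sup>2)) powr q * (1 + (X k \<omega>)\<^sup>2 + \<bar>X k \<omega>\<bar> powr g))"
      using g finite_variance[OF k] by simp
    show "AE \<omega> in M. norm ((1 + (X k \<omega> - ?m)\<^sup>2) powr q)
        \<le> norm ((4 * (1 + ?m\<^sup>2)) powr q * (1 + (X k \<omega>)\<^sup>2 + \<bar>X k \<omega>\<bar> powr g))"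
      using le by (intro AE_I2) (simp add: abs_mult)
  qed measurable
  then show ?thesis
    unfolding law_def by (subst integrable_distr_eq) auto
qed

text \<open>The radius is fixed before \<open>n\<close> because the modulus of the cutoff depends on
  it. The approximation is uniform over admissible strategies and so passes to the supremum; a
  strategy that is optimal for the truncated problem gives the lower bound.\<close>

lemma bandit_value_approx:
  assumes u: "continuous_on UNIV u"
    and growth: "\<And>x y. \<bar>u (x, y)\<bar> \<le> c * (1 + norm (x, y) powr (g - 1))" and c: "0 < c" and g: "1 \<le> g"
    and S: "S \<subseteq> {1..K}" "S \<noteq> {}" and e: "0 < e"
  shows "\<exists>R0. \<forall>R\<ge>R0. \<exists>n0. \<forall>n\<ge>n0. bandit_value M S Y u n \<le> ereal ((bellman S law n ^^ n) (cutoff R u) (0, 0) + e)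
    \<and> ereal ((bellman S law n ^^ n) (cutoff R u) (0, 0) - e) \<le> bandit_value M S Y u n"
proof -
  note Sne = S(2)
  define q where q: "q = max g 2 / 2"
  have q1: "1 \<le> q" using q by auto
  have fin: "finite S" using S(1) finite_subset by blast
  define C where "C = (\<Sum>k\<in>S. growth_const q (law k))"
  have C: "growth_const q (law k) \<le> C" "0 \<le> C" if "k \<in> S" for k
    unfolding C_def using that fin growth_const_nonneg[OF q1] by (auto intro!: member_le_sum sum_nonneg)
  have C0: "0 \<le> C" using C(2) S(2) by blast
  define A where "A = (\<Sum>k\<in>S. \<bar>amean (law k)\<bar>)"
  have A: "\<bar>amean (law k)\<bar> \<le> A" if "k \<in> S" for k
    unfolding A_def using that fin by (intro member_le_sum[where f = "\<lambda>k. \<bar>amean (law k)\<bar>"]) auto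
  define D where "D = 2 * c * (2 * A\<^sup>2 + 3) powr q * exp C"
  have D0: "0 \<le> D" unfolding D_def using c by simp
  have int: "integrable (law k) (\<lambda>x. (1 + (x - amean (law k))\<^sup>2) powr q)" if "k \<in> S" for k
    using moment_integrable[OF _ q, of k] S(1) that by blast
  show ?thesis
  \<comment> \<open>The three errors of \<open>utility_approx\<close> get a third of
    \<open>e\<close> each, by the choice of \<open>R\<close>, of \<open>s\<close> and of
    \<open>n\<close> respectively.\<close>
  proof (rule exI[of _ "max 1 (3 * D / e)"], intro allI impI)
    fix R assume "max 1 (3 * D / e) \<le> R"
    then have R: "1 \<le> R" "3 * D / e \<le> R" by auto
    then have DR: "D / R \<le> e / 3" using e by (simp add: field_simps)
    obtain B w where w: "modulus B w" "bduc B w (cutoff R u)"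
      using cutoff_modulus[OF u] by blast
    obtain s where s: "0 < s" "w s < e / 3" using modulus_small[OF w(1), of "e / 3"] e by auto
    have "(\<lambda>n. 2 * B * exp C / s\<^sup>2 / real n) \<longlonglongrightarrow> 0" by (rule lim_const_over_n)
    then have "\<forall>\<^sub>F n in sequentially. 2 * B * exp C / s\<^sup>2 / real n < e / 3"
      using e by (intro order_tendstoD) auto
    then obtain n0 where n0: "\<And>n. n \<ge> n0 \<Longrightarrow> 2 * B * exp C / s\<^sup>2 / real n < e / 3"
      by (auto simp: eventually_sequentially)
    show "\<exists>n0. \<forall>n\<ge>n0. bandit_value M S Y u n \<le> ereal ((bellman S law n ^^ n) (cutoff R u) (0, 0) + e)
      \<and> ereal ((bellman S law n ^^ n) (cutoff R u) (0, 0) - e) \<le> bandit_value M S Y u n"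
    proof (rule exI[of _ "max 1 n0"], intro allI impI)
      fix n assume "max 1 n0 \<le> n"
      then have n: "1 \<le> n" "n0 \<le> n" by auto
      have near: "\<bar>expected_utility M Y u n \<theta> - expectation (\<lambda>\<omega>. cutoff R u (state \<theta> n n \<omega>))\<bar> \<le> e"
        if "\<theta> \<in> admissible M S Y" for \<theta>
      proof -
        interpret strategy M K X Y g S \<theta> using S(1) that by unfold_locales
        have "\<bar>expected_utility M Y u n \<theta> - expectation (\<lambda>\<omega>. cutoff R u (state \<theta> n n \<omega>))\<bar>
          \<le> 2 * c * (2 * A\<^sup>2 + 3) powr q / R * exp C + w s + 2 * B * exp C / (s\<^sup>2 * real n)"
          by (rule utility_approx[OF u growth c g R(1) n(1) q int C(1) C0 A w s(1)])
        moreover have "2 * c * (2 * A\<^sup>2 + 3) powr q / R * exp C = D / R" by (simp add: D_def)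
        moreover have "2 * B * exp C / (s\<^sup>2 * real n) = 2 * B * exp C / s\<^sup>2 / real n" by simp
        ultimately show ?thesis using DR s(2) n0[OF n(2)] by linarith
      qed
      show "bandit_value M S Y u n \<le> ereal ((bellman S law n ^^ n) (cutoff R u) (0, 0) + e)
        \<and> ereal ((bellman S law n ^^ n) (cutoff R u) (0, 0) - e) \<le> bandit_value M S Y u n"
      proof
        show "bandit_value M S Y u n \<le> ereal ((bellman S law n ^^ n) (cutoff R u) (0, 0) + e)"
          unfolding bandit_value_def
        proof (rule SUP_least)
          fix \<theta> assume t: "\<theta> \<in> admissible M S Y"
          interpret strategy M K X Y g S \<theta> using S(1) t by unfold_locales
          show "ereal (expected_utility M Y u n \<theta>) \<le> ereal ((bellman S law n ^^ n) (cutoff R u) (0, 0) + e)"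
            using near[OF t] value_upper[OF w Sne, of n] by simp
        qed
        obtain \<theta> where t: "\<theta> \<in> admissible M S Y"
          "expectation (\<lambda>\<omega>. cutoff R u (state \<theta> n n \<omega>)) = (bellman S law n ^^ n) (cutoff R u) (0, 0)"
          using value_attained[OF w S] by blast
        have "ereal ((bellman S law n ^^ n) (cutoff R u) (0, 0) - e) \<le> ereal (expected_utility M Y u n \<theta>)"
          using near[OF t(1)] t(2) by simp
        also have "\<dots> \<le> bandit_value M S Y u n"
          unfolding bandit_value_def by (rule SUP_upper[OF t(1)])
        finally show "ereal ((bellman S law n ^^ n) (cutoff R u) (0, 0) - e) \<le> bandit_value M S Y u n" .
      qed
    qed
  qed
qed

end

section \<open>Convergence of the values\<close>

text \<open>Both systems are truncated at the same radius, as \<open>comparison\<close> concerns a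
  single terminal function. Its quantifiers, first \<open>n\<close> and then \<open>m\<close>
  depending on \<open>n\<close>, become the limsup on one side and the liminf on the other.\<close>

lemma bandit_comparison:
  fixes M :: "'a measure" and M' :: "'b measure" and u :: "real \<times> real \<Rightarrow> real"
  assumes u: "continuous_on UNIV u" "1 \<le> g" "0 < c"
      "\<And>x y. \<bar>u (x, y)\<bar> \<le> c * (1 + norm (x, y) powr (g - 1))"
    and b: "bandit M K X Y g" "S \<subseteq> {1..K}" "S \<noteq> {}"
    and b': "bandit M' K' X' Y' g" "S' \<subseteq> {1..K'}" "S' \<noteq> {}"
    and hull: "mv M' X' ` S' \<subseteq> convex hull (mv M X ` S)"
  shows "limsup (bandit_value M' S' Y' u) \<le> liminf (bandit_value M S Y u)"
proof (rule ereal_le_epsilon2)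
  fix e :: real assume e: "0 < e"
  interpret b: bandit M K X Y g by (rule b(1))
  interpret b': bandit M' K' X' Y' g by (rule b'(1))
  have e3: "0 < e / 3" using e by simp
  have arms: "arms S b.law"
    using b(2,3) b.law_props(1) by unfold_locales (auto intro: finite_subset)
  have arms': "arms S' b'.law"
    using b'(2,3) b'.law_props(1) by unfold_locales (auto intro: finite_subset)
  have img: "mv M X ` S = (\<lambda>k. (amean (b.law k), avar (b.law k))) ` S"
    using b(2) b.mv_law by (intro image_cong) auto
  have hull': "(amean (b'.law k), avar (b'.law k)) \<in> convex hull ((\<lambda>k. (amean (b.law k), avar (b.law k))) ` S)"
    if k: "k \<in> S'" for k
  proof -
    have "mv M' X' k \<in> convex hull (mv M X ` S)" using hull k by blast
    moreover have "mv M' X' k = (amean (b'.law k), avar (b'.law k))" using k b'(2) by (intro b'.mv_law) blast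
    ultimately show ?thesis by (simp only: img)
  qed
  let ?v = "\<lambda>R n. (bellman S b.law n ^^ n) (cutoff R u) (0, 0)" and ?v' = "\<lambda>R n. (bellman S' b'.law n ^^ n) (cutoff R u) (0, 0)"
  obtain R1 where R1: "\<And>R. R1 \<le> R \<Longrightarrow> \<exists>n0. \<forall>n\<ge>n0. bandit_value M S Y u n \<le> ereal (?v R n + e / 3)
      \<and> ereal (?v R n - e / 3) \<le> bandit_value M S Y u n"
    using b.bandit_value_approx[OF u(1,4,3,2) b(2,3) e3] by blast
  obtain R2 where R2: "\<And>R. R2 \<le> R \<Longrightarrow> \<exists>n0. \<forall>n\<ge>n0. bandit_value M' S' Y' u n \<le> ereal (?v' R n + e / 3)
      \<and> ereal (?v' R n - e / 3) \<le> bandit_value M' S' Y' u n"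
    using b'.bandit_value_approx[OF u(1,4,3,2) b'(2,3) e3] by blast
  define R where "R = max R1 R2"
  obtain n1 where n1: "\<And>m. n1 \<le> m \<Longrightarrow> ereal (?v R m - e / 3) \<le> bandit_value M S Y u m"
    using R1[of R] by (auto simp: R_def)
  obtain n2 where n2: "\<And>n. n2 \<le> n \<Longrightarrow> bandit_value M' S' Y' u n \<le> ereal (?v' R n + e / 3)"
    using R2[of R] by (auto simp: R_def)
  obtain B w where w: "modulus B w" "bduc B w (cutoff R u)"
    using cutoff_modulus[OF u(1)] by blast
  obtain n3 where n3: "\<And>n. n3 \<le> n \<Longrightarrow> \<exists>m0. \<forall>m\<ge>m0. ?v' R n \<le> ?v R m + e / 3"
    using comparison[OF w arms arms' e3 hull'] by blast
  have "bandit_value M' S' Y' u n \<le> liminf (bandit_value M S Y u) + ereal e" if n: "max n2 n3 \<le> n" for n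
  proof -
    obtain m0 where m0: "\<And>m. m0 \<le> m \<Longrightarrow> ?v' R n \<le> ?v R m + e / 3"
      using n3[of n] n by auto
    \<comment> \<open>Two thirds of \<open>e\<close> are spent here, on \<open>comparison\<close>
      and on the truncation of the unprimed system; the last third is for the truncation of the
      primed one.\<close>
    have "ereal (?v' R n + e / 3 - e) \<le> liminf (bandit_value M S Y u)"
    proof (rule Liminf_bounded)
      have "ereal (?v' R n + e / 3 - e) \<le> bandit_value M S Y u m" if "max n1 m0 \<le> m" for m
      proof -
        have "ereal (?v' R n + e / 3 - e) \<le> ereal (?v R m - e / 3)" using m0[of m] that by simp
        also have "\<dots> \<le> bandit_value M S Y u m" using n1[of m] that by simp
        finally show ?thesis .
      qed
      then show "\<forall>\<^sub>F m in sequentially. ereal (?v' R n + e / 3 - e) \<le> bandit_value M S Y u m"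
        by (intro eventually_sequentiallyI[of "max n1 m0"])
    qed
    then have "ereal (?v' R n + e / 3 - e) + ereal e \<le> liminf (bandit_value M S Y u) + ereal e"
      by (rule add_right_mono)
    moreover have "bandit_value M' S' Y' u n \<le> ereal (?v' R n + e / 3 - e) + ereal e"
      using n2[of n] n by (simp add: add.commute)
    ultimately show ?thesis by (rule order_trans[rotated])
  qed
  then show "limsup (bandit_value M' S' Y' u) \<le> liminf (bandit_value M S Y u) + ereal e"
    by (intro Limsup_bounded eventually_sequentiallyI[of "max n2 n3"])
qed

lemma (in bandit) liminf_finite:
  assumes u: "continuous_on UNIV u" "1 \<le> g" "0 < c"
      "\<And>x y. \<bar>u (x, y)\<bar> \<le> c * (1 + norm (x, y) powr (g - 1))"
    and S: "S \<subseteq> {1..K}" "S \<noteq> {}"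
  shows "\<bar>liminf (bandit_value M S Y u)\<bar> \<noteq> \<infinity>"
proof -
  interpret arms S law
    using S law_props(1) by unfold_locales (auto intro: finite_subset)
  obtain R n0 where n0: "\<And>n. n0 \<le> n \<Longrightarrow> bandit_value M S Y u n \<le> ereal ((bellman S law n ^^ n) (cutoff R u) (0, 0) + 1)"
      "\<And>n. n0 \<le> n \<Longrightarrow> ereal ((bellman S law n ^^ n) (cutoff R u) (0, 0) - 1) \<le> bandit_value M S Y u n"
    using bandit_value_approx[OF u(1,4,3,2) S zero_less_one] by blast
  obtain B w where w: "modulus B w" "bduc B w (cutoff R u)"
    using cutoff_modulus[OF u(1)] by blast
  have B: "\<bar>(bellman S law n ^^ n) (cutoff R u) (0, 0)\<bar> \<le> B" for n
    by (rule bduc_bound[OF iter_bduc[OF w]])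
  have "ereal (- B - 1) \<le> bandit_value M S Y u n" if "n0 \<le> n" for n
    by (rule order_trans[OF _ n0(2)[OF that]]) (use B[of n] in simp)
  then have "ereal (- B - 1) \<le> liminf (bandit_value M S Y u)"
    by (intro Liminf_bounded) (auto simp: eventually_sequentially)
  moreover have "bandit_value M S Y u n \<le> ereal (B + 1)" if "n0 \<le> n" for n
    by (rule order_trans[OF n0(1)[OF that]]) (use B[of n] in simp)
  then have "limsup (bandit_value M S Y u) \<le> ereal (B + 1)"
    by (intro Limsup_bounded) (auto simp: eventually_sequentially)
  then have "liminf (bandit_value M S Y u) \<le> ereal (B + 1)"
    by (rule order_trans[OF Liminf_le_Limsup, rotated]) simp
  ultimately show ?thesis by auto
qed

text \<open>Together with liminf below limsup the two assumptions close a cycle of inequalities, so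
  all four limits agree. The case that \<open>a\<close> and \<open>b\<close> coincide is plain
  convergence.\<close>

lemma tendsto_from_limsup_liminf:
  fixes a b :: "nat \<Rightarrow> ereal"
  assumes "limsup a \<le> liminf b" "limsup b \<le> liminf a"
  shows "a \<longlonglongrightarrow> liminf b"
proof (rule Liminf_eq_Limsup)
  have "liminf a \<le> limsup a" "liminf b \<le> limsup b" by (simp_all add: Liminf_le_Limsup)
  with assms show "liminf a = liminf b" "limsup a = liminf b" by auto
qed simp

theorem theorem1:
  fixes M :: "'a measure" and K :: nat
    and X :: "nat \<Rightarrow> 'a \<Rightarrow> real" and Y :: "nat \<Rightarrow> nat \<Rightarrow> 'a \<Rightarrow> real"
    and u :: "real \<times> real \<Rightarrow> real" and g c :: real
  assumes "continuous_on UNIV u"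
    and "g \<ge> 1" and "c > 0"
    and "\<And>x y. \<bar>u (x, y)\<bar> \<le> c * (1 + norm (x, y) powr (g - 1))"
    and "bandit M K X Y g"
  shows "\<exists>V::real.
      (\<lambda>n. bandit_value M {1..K} Y u n) \<longlonglongrightarrow> ereal V
    \<and> (\<forall>(M' :: 'b measure) K' X' Y'.
          bandit M' K' X' Y' g \<and> mv M' X' ` {1..K'} = mv M X ` {1..K}
          \<longrightarrow> (\<lambda>n. bandit_value M' {1..K'} Y' u n) \<longlonglongrightarrow> ereal V)
    \<and> (\<lambda>n. bandit_value M {k \<in> {1..K}. mv M X k \<in> extreme_points (mv M X ` {1..K})} Y u n)
          \<longlonglongrightarrow> ereal V"
proof -
  interpret bandit M K X Y g by fact
  note u = assms(1-4)
  let ?S = "{1..K}" and ?A = "mv M X ` {1..K}"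
  define T where "T = {k \<in> ?S. mv M X k \<in> extreme_points ?A}"
  have S: "?S \<noteq> {}" using arms_nonempty by simp
  have T: "T \<subseteq> ?S" by (auto simp: T_def)
  \<comment> \<open>Every extreme point of the hull of a set belongs to the set, hence is the pair
    of some arm; by compactness of the hull of finitely many points, the extreme points span the
    same hull.\<close>
  have "extreme_points ?A \<subseteq> ?A"
    unfolding extreme_points_def by (rule extreme_points_of_convex_hull)
  then have "mv M X ` T = extreme_points ?A" by (auto simp: T_def)
  moreover have "convex hull ?A = convex hull (extreme_points ?A)"
    unfolding extreme_points_def
    by (intro Krein_Milman_Minkowski) (auto intro: finite_imp_compact_convex_hull)
  ultimately have hT: "convex hull (mv M X ` T) = convex hull ?A" by simp
  then have T0: "T \<noteq> {}"
    using S by (metis convex_hull_eq_empty image_is_empty)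
  obtain V where V: "liminf (bandit_value M ?S Y u) = ereal V"
    using liminf_finite[OF u order_refl S] by (cases "liminf (bandit_value M ?S Y u)") auto
  \<comment> \<open>Comparing the system with itself turns the one-sided bound into
    convergence.\<close>
  have "bandit_value M ?S Y u \<longlonglongrightarrow> ereal V"
    unfolding V[symmetric]
    by (intro tendsto_from_limsup_liminf bandit_comparison[OF u assms(5) _ S assms(5) _ S] hull_subset order_refl)
  moreover have "bandit_value M T Y u \<longlonglongrightarrow> ereal V"
    unfolding V[symmetric]
  proof (rule tendsto_from_limsup_liminf)
    show "limsup (bandit_value M T Y u) \<le> liminf (bandit_value M ?S Y u)"
      by (rule bandit_comparison[OF u assms(5) order_refl S assms(5) T T0])
        (unfold hT[symmetric], rule hull_subset)
    show "limsup (bandit_value M ?S Y u) \<le> liminf (bandit_value M T Y u)"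
      by (rule bandit_comparison[OF u assms(5) T T0 assms(5) order_refl S])
        (unfold hT, rule hull_subset)
  qed
  moreover have "bandit_value M' {1..K'} Y' u \<longlonglongrightarrow> ereal V"
    if b': "bandit M' K' X' Y' g" and eq: "mv M' X' ` {1..K'} = ?A"
    for M' :: "'b measure" and K' X' Y'
    unfolding V[symmetric]
  proof (rule tendsto_from_limsup_liminf)
    have S': "{1..K'} \<noteq> {}" using eq S by (metis image_is_empty)
    show "limsup (bandit_value M' {1..K'} Y' u) \<le> liminf (bandit_value M ?S Y u)"
      by (rule bandit_comparison[OF u assms(5) order_refl S b' order_refl S']) (unfold eq, rule hull_subset)
    show "limsup (bandit_value M ?S Y u) \<le> liminf (bandit_value M' {1..K'} Y' u)"
      by (rule bandit_comparison[OF u b' order_refl S' assms(5) order_refl S]) (unfold eq, rule hull_subset)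
  qed
  ultimately show ?thesis unfolding T_def by blast
qed

end
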